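(* Let $R$ be a field and $n\in\mathbb{N}$, $n\ge 1$. The $R$-linear map $\Phi\colon \mathrm{Inc}(\mathcal{P}_n)\longrightarrow \mathcal{A}_n$ given by $\Phi(X_{(K,J)})=f^{(n)}_K\,\mathsf{P}_{(K,J)}\,f^{(n)}_J$ for all subsets $K\ge_n J$ of $\{1,\dots,n\}$ is an isomorphism of $R$-algebras.
   Context: Poset and incidence algebra. $\mathcal{P}_n$ is the set of subsets of $\{1,\dots,n\}$ ordered by: for $K=\{k_1<\dots<k_r\}$ and $J=\{j_1<\dots<j_m\}$, $K\ge_n J$ iff $m=r$ and $k_i\ge j_i$ for all $i$. $\mathrm{Inc}(\mathcal{P}_n)$ is the free $R$-module on symbols $X_{(K,J)}$ with $K\ge_n J$, with multiplication $X_{(L,K)}X_{(K',J)}=X_{(L,J)}$ if $K=K'$ and $0$ otherwise. The algebra $\mathcal{A}_n$. Let $Q_n$ be the quiver $1\to2\to\dots\to n$. For a vertex $t$ let $\mathsf{P}_t$ be the endofunctor of the category of finite dimensional representations of $Q_n$ over $R$ (equivalently, finite dimensional $RQ_n$-modules) sending $V$ to $V/\mathsf{t}_{S_t}(V)$, where $\mathsf{t}_{S_t}(V)$ is the greatest submodule of $V$ isomorphic to a direct sum of copies of the simple $S_t$ at $t$. Let $\pi_{Q_n}$ be the monoid of natural isomorphism classes of finite compositions of the $\mathsf{P}_t$ (multiplication is composition, unit the identity functor), and $\mathcal{A}_n=R\pi_{Q_n}$ its monoid algebra. For $m\le n$, $\mathcal{A}_m$ is regarded as the subalgebra of $\mathcal{A}_n$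 generated by $\mathsf{P}_1,\dots,\mathsf{P}_m$. Elements $y^{(n)}_k$. Put $y^{(1)}_1=\mathsf{P}_1$, $y^{(n)}_k=0$ for $k>n$, and for $n\ge2$: $y^{(n)}_1=y^{(n-1)}_1-\mathsf{P}_ny^{(n-1)}_1+\mathsf{P}_n$, and $y^{(n)}_k=y^{(n-1)}_k-\mathsf{P}_ny^{(n-1)}_k+y^{(n-1)}_{k-1}\mathsf{P}_n$ for $2\le k\le n$. Elements $z^{(n)}_k$. $z^{(n)}_0=1-y^{(n)}_1$ and $z^{(n)}_k=y^{(n)}_k-y^{(n)}_{k+1}$ for $1\le k\le n$. Elements $g^{(n)}_J$ for $\emptyset\ne J\subseteq\{1,\dots,n\}$. $g^{(1)}_{\{1\}}=\mathsf{P}_1$, and for $n\ge2$: $g^{(n)}_J=g^{(n-1)}_J-\mathsf{P}_ng^{(n-1)}_J$ if $n\notin J$; $g^{(n)}_{\{n\}}=\mathsf{P}_n$; $g^{(n)}_J=g^{(n-1)}_{J\setminus\{n\}}\mathsf{P}_n$ if $n\in J\neq\{n\}$. Elements $f^{(n)}_J$. $f^{(n)}_\emptyset=z^{(n)}_0$ and $f^{(n)}_J=g^{(n)}_Jz^{(n)}_{|J|}$ for $J\ne\emptyset$. Elements $\mathsf{P}_{(K,J)}$. For a word $w=w_1w_2\cdots w_m$ over $\{1,\dots,n\}$ put $\mathsf{P}_w=\mathsf{P}_{w_1}\mathsf{P}_{w_2}\cdots\mathsf{P}_{w_m}$ ($\mathsf{P}_\emptyset=1$). For $j\ge i$ let $j\leftharpoonup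 i$ be the word $j,(j-1),\dots,i+1,i$. For $K=\{k_1<\dots<k_r\}\ge_nJ=\{j_1<\dots<j_r\}$ put $\mathsf{P}_{(K,J)}=\mathsf{P}_{k_1\leftharpoonup j_1}\mathsf{P}_{k_2\leftharpoonup j_2}\cdots\mathsf{P}_{k_r\leftharpoonup j_r}$, with $\mathsf{P}_{(\emptyset,\emptyset)}=1$. *)

theory Defs
  imports "Jordan_Normal_Form.VS_Connect" "HOL-Algebra.QuotRing" "HOL-Library.Poly_Mapping"
begin

text \<open>
  Finite dimensional representations of the quiver \<open>1 \<rightarrow> 2 \<rightarrow> \<dots> \<rightarrow> n\<close>: the ground field is a type \<open>'r\<close> of class \<open>field\<close>, seen as the record \<open>class_ring\<close>.
  A representation consists of arbitrary vector space structures on subsets of the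
  type \<open>'r vec\<close>, which contains every coordinate space; so every finite dimensional
  representation is isomorphic to one of these.  Only the spaces at the vertices \<open>1..n\<close> and
  the arrows \<open>i \<rightarrow> i + 1\<close> with \<open>1 \<le> i < n\<close> are relevant.
\<close>

record 'r rep =
  space :: "nat \<Rightarrow> ('r, 'r vec) module"
  arr :: "nat \<Rightarrow> 'r vec \<Rightarrow> 'r vec"

type_synonym 'r rep_map = "nat \<Rightarrow> 'r vec \<Rightarrow> 'r vec"

definition is_rep :: "nat \<Rightarrow> 'r::field rep \<Rightarrow> bool" where
  "is_rep n V \<longleftrightarrow>
     (\<forall>i\<in>{1..n}. vectorspace class_ring (space V i) \<and> vectorspace.fin_dim class_ring (space V i)) \<and>
     (\<forall>i\<in>{1..<n}. arr V i \<in> LinearCombinations.module_hom class_ring (space V i) (space V (i + 1)))"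

definition rep_hom :: "nat \<Rightarrow> 'r::field rep \<Rightarrow> 'r rep \<Rightarrow> 'r rep_map set" where
  "rep_hom n V W = {\<phi>.
     (\<forall>i\<in>{1..n}. \<phi> i \<in> LinearCombinations.module_hom class_ring (space V i) (space W i)) \<and>
     (\<forall>i\<in>{1..<n}. \<forall>x\<in>carrier (space V i). \<phi> (i + 1) (arr V i x) = arr W i (\<phi> i x))}"

definition rep_iso :: "nat \<Rightarrow> 'r::field rep \<Rightarrow> 'r rep \<Rightarrow> 'r rep_map set" where
  "rep_iso n V W =
     {\<phi> \<in> rep_hom n V W. \<forall>i\<in>{1..n}. bij_betw (\<phi> i) (carrier (space V i)) (carrier (space W i))}"

text \<open>
  A submodule of \<open>V\<close> is given by its subspaces \<open>U i\<close>.  They are required to be empty at indices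
  that are not vertices, so that distinct families are distinct submodules and the order of
  submodules is the order of functions.
\<close>

definition is_submod :: "nat \<Rightarrow> 'r::field rep \<Rightarrow> (nat \<Rightarrow> 'r vec set) \<Rightarrow> bool" where
  "is_submod n V U \<longleftrightarrow>
     (\<forall>i\<in>{1..n}. subspace class_ring (U i) (space V i)) \<and>
     (\<forall>i\<in>{1..<n}. arr V i ` U i \<subseteq> U (i + 1)) \<and>
     (\<forall>i. i \<notin> {1..n} \<longrightarrow> U i = {})"

definition sub_rep :: "'r rep \<Rightarrow> (nat \<Rightarrow> 'r vec set) \<Rightarrow> 'r rep" where
  "sub_rep V U = \<lparr>space = \<lambda>i. space V i \<lparr>carrier := U i\<rparr>, arr = arr V\<rparr>"

text \<open>The vertex spaces of the direct sum of \<open>m\<close> copies of the simple at \<open>t\<close> are the coordinate spaces.\<close>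

definition simple_power :: "nat \<Rightarrow> nat \<Rightarrow> 'r::field rep" where
  "simple_power t m =
     \<lparr>space = \<lambda>i. module_vec TYPE('r) (if i = t then m else 0),
      arr = \<lambda>i x. 0\<^sub>v (if i + 1 = t then m else 0)\<rparr>"

definition trace_submod :: "nat \<Rightarrow> nat \<Rightarrow> 'r::field rep \<Rightarrow> nat \<Rightarrow> 'r vec set" where
  "trace_submod n t V =
     (GREATEST U. is_submod n V U \<and> (\<exists>m. rep_iso n (sub_rep V U) (simple_power t m) \<noteq> {}))"

text \<open>
  The quotient of a vector space \<open>M\<close> by a subspace \<open>N\<close> is carried by a system of representatives
  of the cosets instead of by the cosets themselves, so that it lives on the same type as \<open>M\<close>
  and quotients can be iterated.
\<close>

definition coset_rep :: "('r, 'v) module \<Rightarrow> 'v set \<Rightarrow> 'v \<Rightarrow> 'v" where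
  "coset_rep M N x = (SOME y. y \<in> N +>\<^bsub>M\<^esub> x)"

definition quot_space :: "('r, 'v) module \<Rightarrow> 'v set \<Rightarrow> ('r, 'v) module" where
  "quot_space M N = M
     \<lparr>carrier := coset_rep M N ` carrier M,
      zero := coset_rep M N \<zero>\<^bsub>M\<^esub>,
      add := (\<lambda>x y. coset_rep M N (x \<oplus>\<^bsub>M\<^esub> y)),
      smult := (\<lambda>a x. coset_rep M N (a \<odot>\<^bsub>M\<^esub> x))\<rparr>"

definition quot_rep :: "'r rep \<Rightarrow> (nat \<Rightarrow> 'r vec set) \<Rightarrow> 'r rep" where
  "quot_rep V U =
     \<lparr>space = \<lambda>i. quot_space (space V i) (U i),
      arr = \<lambda>i x. coset_rep (space V (i + 1)) (U (i + 1)) (arr V i x)\<rparr>"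

text \<open>\<open>mor F V W\<close> is the action of the functor on the morphisms from \<open>V\<close> to \<open>W\<close>.\<close>

record 'r endofunctor =
  ob :: "'r rep \<Rightarrow> 'r rep"
  mor :: "'r rep \<Rightarrow> 'r rep \<Rightarrow> 'r rep_map \<Rightarrow> 'r rep_map"

definition id_functor :: "'r endofunctor" where
  "id_functor = \<lparr>ob = \<lambda>V. V, mor = \<lambda>V W \<phi>. \<phi>\<rparr>"

definition comp_functor :: "'r endofunctor \<Rightarrow> 'r endofunctor \<Rightarrow> 'r endofunctor" where
  "comp_functor F G =
     \<lparr>ob = \<lambda>V. ob F (ob G V), mor = \<lambda>V W \<phi>. mor F (ob G V) (ob G W) (mor G V W \<phi>)\<rparr>"

definition nat_iso :: "nat \<Rightarrow> 'r::field endofunctor \<Rightarrow> 'r endofunctor \<Rightarrow> bool" where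
  "nat_iso n F G \<longleftrightarrow> (\<exists>\<eta>.
     (\<forall>V. is_rep n V \<longrightarrow> \<eta> V \<in> rep_iso n (ob F V) (ob G V)) \<and>
     (\<forall>V W \<phi>. is_rep n V \<and> is_rep n W \<and> \<phi> \<in> rep_hom n V W \<longrightarrow>
        (\<forall>i\<in>{1..n}. \<forall>x\<in>carrier (space (ob F V) i).
           \<eta> W i (mor F V W \<phi> i x) = mor G V W \<phi> i (\<eta> V i x))))"

definition proj_functor :: "nat \<Rightarrow> nat \<Rightarrow> 'r::field endofunctor" where
  "proj_functor n t =
     \<lparr>ob = \<lambda>V. quot_rep V (trace_submod n t V),
      mor = \<lambda>V W \<phi> i x. coset_rep (space W i) (trace_submod n t W i) (\<phi> i x)\<rparr>"

definition proj_comps :: "nat \<Rightarrow> 'r::field endofunctor set" where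
  "proj_comps n =
     {foldr (\<lambda>t F. comp_functor (proj_functor n t) F) w id_functor | w. set w \<subseteq> {1..n}}"

definition nat_iso_rel :: "nat \<Rightarrow> ('r::field endofunctor \<times> 'r endofunctor) set" where
  "nat_iso_rel n = {(F, G). F \<in> proj_comps n \<and> G \<in> proj_comps n \<and> nat_iso n F G}"

definition proj_monoid :: "nat \<Rightarrow> 'r::field endofunctor set monoid" where
  "proj_monoid n =
     \<lparr>carrier = proj_comps n // nat_iso_rel n,
      mult = (\<lambda>A B. \<Union>F\<in>A. \<Union>G\<in>B. nat_iso_rel n `` {comp_functor F G}),
      one = nat_iso_rel n `` {id_functor}\<rparr>"

text \<open>
  The free module on a set \<open>B\<close>, as finitely supported functions, with the bilinear
  multiplication given on basis elements by \<open>\<mu>\<close> and with unit \<open>u\<close>.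
\<close>

definition scale :: "'r::field \<Rightarrow> ('b \<Rightarrow>\<^sub>0 'r) \<Rightarrow> ('b \<Rightarrow>\<^sub>0 'r)" where
  "scale c f = Poly_Mapping.map (\<lambda>x. c * x) f"

definition free_algebra_on ::
    "'b set \<Rightarrow> ('b \<Rightarrow> 'b \<Rightarrow> ('b \<Rightarrow>\<^sub>0 'r)) \<Rightarrow> ('b \<Rightarrow>\<^sub>0 'r) \<Rightarrow> ('r::field, 'b \<Rightarrow>\<^sub>0 'r) module" where
  "free_algebra_on B \<mu> u =
     \<lparr>carrier = {f. Poly_Mapping.keys f \<subseteq> B},
      mult = (\<lambda>f g. \<Sum>a\<in>Poly_Mapping.keys f. \<Sum>b\<in>Poly_Mapping.keys g.
        scale (Poly_Mapping.lookup f a * Poly_Mapping.lookup g b) (\<mu> a b)),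
      one = u,
      zero = 0,
      add = (+),
      smult = scale\<rparr>"

definition monoid_algebra :: "('b, 'c) monoid_scheme \<Rightarrow> ('r::field, 'b \<Rightarrow>\<^sub>0 'r) module" where
  "monoid_algebra M =
     free_algebra_on (carrier M)
       (\<lambda>a b. Poly_Mapping.single (a \<otimes>\<^bsub>M\<^esub> b) 1) (Poly_Mapping.single \<one>\<^bsub>M\<^esub> 1)"

type_synonym 'r proj_alg_elt = "'r endofunctor set \<Rightarrow>\<^sub>0 'r"

definition proj_algebra :: "nat \<Rightarrow> ('r::field, 'r proj_alg_elt) module" (\<open>\<A>\<close>) where
  "proj_algebra n = monoid_algebra (proj_monoid n)"

definition proj_elt :: "nat \<Rightarrow> nat \<Rightarrow> 'r::field proj_alg_elt" (\<open>\<P>\<close>) where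
  "proj_elt n t = Poly_Mapping.single (nat_iso_rel n `` {proj_functor n t}) 1"

text \<open>
  In what follows the first argument \<open>n\<close> fixes the algebra \<open>\<A> n\<close> in which everything is computed,
  and \<open>m \<le> n\<close> is the superscript, the smaller algebra being regarded as the subalgebra
  of \<open>\<A> n\<close> generated by \<open>\<P> n 1, \<dots>, \<P> n m\<close>.  The superscript \<open>0\<close>, the index \<open>k = 0\<close> of
  \<open>y_elt\<close> and the index set \<open>J = {}\<close> of \<open>g_elt\<close> have no meaning and get the value zero.
\<close>

primrec y_elt :: "nat \<Rightarrow> nat \<Rightarrow> nat \<Rightarrow> 'r::field proj_alg_elt" where
  "y_elt n 0 k = \<zero>\<^bsub>\<A> n\<^esub>"
| "y_elt n (Suc m) k =
    (if k = 0 \<or> k > Suc m then \<zero>\<^bsub>\<A> n\<^esub>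
     else if m = 0 then \<P> n 1
     else if k = 1 then
       (y_elt n m 1 \<ominus>\<^bsub>\<A> n\<^esub> \<P> n (Suc m) \<otimes>\<^bsub>\<A> n\<^esub> y_elt n m 1) \<oplus>\<^bsub>\<A> n\<^esub> \<P> n (Suc m)
     else
       (y_elt n m k \<ominus>\<^bsub>\<A> n\<^esub> \<P> n (Suc m) \<otimes>\<^bsub>\<A> n\<^esub> y_elt n m k)
         \<oplus>\<^bsub>\<A> n\<^esub> y_elt n m (k - 1) \<otimes>\<^bsub>\<A> n\<^esub> \<P> n (Suc m))"

definition z_elt :: "nat \<Rightarrow> nat \<Rightarrow> 'r::field proj_alg_elt" where
  "z_elt n k =
    (if k = 0 then \<one>\<^bsub>\<A> n\<^esub> \<ominus>\<^bsub>\<A> n\<^esub> y_elt n n 1 else y_elt n n k \<ominus>\<^bsub>\<A> n\<^esub> y_elt n n (k + 1))"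

primrec g_elt :: "nat \<Rightarrow> nat \<Rightarrow> nat set \<Rightarrow> 'r::field proj_alg_elt" where
  "g_elt n 0 J = \<zero>\<^bsub>\<A> n\<^esub>"
| "g_elt n (Suc m) J =
    (if J = {} then \<zero>\<^bsub>\<A> n\<^esub>
     else if Suc m \<notin> J then g_elt n m J \<ominus>\<^bsub>\<A> n\<^esub> \<P> n (Suc m) \<otimes>\<^bsub>\<A> n\<^esub> g_elt n m J
     else if J = {Suc m} then \<P> n (Suc m)
     else g_elt n m (J - {Suc m}) \<otimes>\<^bsub>\<A> n\<^esub> \<P> n (Suc m))"

definition f_elt :: "nat \<Rightarrow> nat set \<Rightarrow> 'r::field proj_alg_elt" where
  "f_elt n J = (if J = {} then z_elt n 0 else g_elt n n J \<otimes>\<^bsub>\<A> n\<^esub> z_elt n (card J))"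

definition word_elt :: "nat \<Rightarrow> nat list \<Rightarrow> 'r::field proj_alg_elt" where
  "word_elt n w = foldr (\<lambda>t x. \<P> n t \<otimes>\<^bsub>\<A> n\<^esub> x) w \<one>\<^bsub>\<A> n\<^esub>"

definition down_word :: "nat \<Rightarrow> nat \<Rightarrow> nat list" where
  "down_word j i = rev [i..<Suc j]"

definition pair_elt :: "nat \<Rightarrow> nat set \<Rightarrow> nat set \<Rightarrow> 'r::field proj_alg_elt" where
  "pair_elt n K J =
     foldr (\<lambda>(k, j) x. word_elt n (down_word k j) \<otimes>\<^bsub>\<A> n\<^esub> x)
       (zip (sorted_list_of_set K) (sorted_list_of_set J)) \<one>\<^bsub>\<A> n\<^esub>"

definition poset_ge :: "nat \<Rightarrow> nat set \<Rightarrow> nat set \<Rightarrow> bool" where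
  "poset_ge n K J \<longleftrightarrow> K \<subseteq> {1..n} \<and> J \<subseteq> {1..n} \<and> card K = card J \<and>
     (\<forall>i<card K. sorted_list_of_set K ! i \<ge> sorted_list_of_set J ! i)"

type_synonym 'r inc_elt = "(nat set \<times> nat set) \<Rightarrow>\<^sub>0 'r"

definition inc_gen :: "nat set \<Rightarrow> nat set \<Rightarrow> 'r::field inc_elt" where
  "inc_gen K J = Poly_Mapping.single (K, J) 1"

definition inc_algebra :: "nat \<Rightarrow> ('r::field, 'r inc_elt) module" where
  "inc_algebra n =
     free_algebra_on {(K, J). poset_ge n K J}
       (\<lambda>(L, K) (K', J). if K = K' then inc_gen L J else 0)
       (\<Sum>K\<in>Pow {1..n}. inc_gen K K)"

definition Phi :: "nat \<Rightarrow> 'r::field inc_elt \<Rightarrow> 'r proj_alg_elt" where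
  "Phi n x =
     finsum (\<A> n)
       (\<lambda>(K, J). Poly_Mapping.lookup x (K, J) \<odot>\<^bsub>\<A> n\<^esub>
          (f_elt n K \<otimes>\<^bsub>\<A> n\<^esub> pair_elt n K J \<otimes>\<^bsub>\<A> n\<^esub> f_elt n J))
       (Poly_Mapping.keys x)"

end

theory Submission
  imports Defs
begin

text \<open>
  A word \<open>w\<close> in the projection functors replaces the space of \<open>V\<close> at the vertex \<open>i\<close> by the image
  of the structure map \<open>V\<^sub>i \<rightarrow> V\<^sub>j\<close> with \<open>j = route w i\<close> (and \<open>V\<^sub>j = 0\<close> for \<open>j = Suc n\<close>), where the
  letters of \<open>w\<close> act one after the other by \<open>t \<mapsto> Suc t\<close>.  Evaluating on the representations
  with support \<open>1, \<dots>, j\<close> shows that two words give isomorphic functors iff they have the same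
  route, so the monoid is the Catalan monoid of monotone increasing maps, with composition reversed.

  Such a map acts from the right on the subsets \<open>K\<close> of \<open>{1..n}\<close>: it moves the complement of \<open>K\<close>,
  and the result is zero when it identifies two elements of the complement or sends one to
  \<open>Suc n\<close>.  This represents the algebra by matrices indexed by subsets.  The representation
  is faithful: each map \<open>\<phi>\<close> has a matrix entry that is nonzero only for maps below \<open>\<phi>\<close>.  In it
  \<open>y\<^sub>k\<close> is the projection onto the subsets with at least \<open>k\<close> elements and \<open>f\<^sub>J\<close> the matrix unit at
  \<open>(J, J)\<close>, while the word of \<open>(K, J)\<close> takes \<open>K\<close> to \<open>J\<close>.  Hence \<open>Phi\<close> is inverse to the
  representation.
\<close>

section \<open>The Catalan monoid and its action on subsets\<close>

text \<open>The action on subsets is that on an exterior algebra. On the free module with basis e_1,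
  ..., e_(n+1) a monotone map sends the wedge of the e_i with i in C to the wedge over the image of
  C, or to zero if it is not injective on C. Monotonicity keeps the factors in order, so no signs
  occur. The sets C that contain \<open>Suc n\<close> span the part in question, and K is the
  complement of C. Seen from K, elements only move down, so all matrices are supported on the pairs
  of \<open>poset_ge\<close>. This triangularity replaces any counting of the monoid: the matrix of
  an element of \<open>\<A> n\<close> is itself an element of the incidence algebra, and
  surjectivity follows. The obstacle is that the elements with superscript m < n are not diagonal,
  since an element \<open>Suc m\<close> of K can still slide down. The inductions for y and g
  therefore say less about the rows in which \<open>Suc m\<close> lies in K; at m = n there are no
  such rows, because \<open>Suc n\<close> is never in K.\<close>

definition bump :: "nat \<Rightarrow> nat \<Rightarrow> nat" where
  "bump t i = (if i = t then Suc i else i)"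

text \<open>The functor of the first letter is applied last, yet its bump comes first: the outer
  quotient at t kills an element iff the inner word already kills its image at \<open>Suc t\<close>,
  where the zero space stands at \<open>Suc n\<close>.\<close>

definition route :: "nat list \<Rightarrow> nat \<Rightarrow> nat" where
  "route w = fold bump w"

lemma route_simps [simp]:
  "route [] = id"
  "route (t # w) i = route w (bump t i)"
  by (simp_all add: route_def)

lemma route_append: "route (u @ v) = route v \<circ> route u"
  by (simp add: route_def)

lemma route_ge: "i \<le> route w i"
proof (induction w arbitrary: i)
  case (Cons t w)
  have "i \<le> bump t i" by (simp add: bump_def)
  also have "\<dots> \<le> route w (bump t i)" by (rule Cons.IH)
  finally show ?case by simp
qed simp

lemma mono_route: "mono (route w)"
proof (induction w)
  case (Cons t w)
  have "mono (bump t)" by (auto simp: mono_def bump_def)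
  with Cons.IH show ?case by (simp add: mono_def)
qed (simp add: mono_def)

lemma route_fixed:
  assumes "set w \<subseteq> {1..n}" "i \<notin> {1..n}"
  shows "route w i = i"
  using assms by (induction w) (auto simp: bump_def)

lemma route_le:
  assumes "set w \<subseteq> {1..n}" "i \<le> Suc n"
  shows "route w i \<le> Suc n"
  by (metis assms mono_route monoD route_fixed atLeastAtMost_iff not_less_eq_eq order_refl)

lemma route_in:
  assumes "set w \<subseteq> {1..n}" "i \<in> {1..Suc n}"
  shows "route w i \<in> {1..Suc n}"
  using route_le[OF assms(1), of i] route_ge[of i w] assms(2) by auto

text \<open>
  A monotone map acts on subsets through their complements in \<open>{1..Suc n}\<close>; the fixed
  point \<open>Suc n\<close>, which always lies in the complement, absorbs the elements that leave \<open>{1..n}\<close>.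
\<close>

definition transport :: "nat \<Rightarrow> (nat \<Rightarrow> nat) \<Rightarrow> nat set \<Rightarrow> nat set option" where
  "transport n \<phi> K = (let C = {1..Suc n} - K
     in if inj_on \<phi> C then Some ({1..Suc n} - \<phi> ` C) else None)"

lemma transport_id: "K \<subseteq> {1..n} \<Longrightarrow> transport n id K = Some K"
  by (auto simp: transport_def Let_def)

lemma transport_comp:
  assumes "\<phi> ` {1..Suc n} \<subseteq> {1..Suc n}"
  shows "transport n (\<psi> \<circ> \<phi>) K = Option.bind (transport n \<phi> K) (transport n \<psi>)"
proof (cases "inj_on \<phi> ({1..Suc n} - K)")
  case True
  \<comment> \<open>As the map stays inside {1..Suc n}, complementing twice gives back the image,
    and the second map acts on exactly this image.\<close>
  have "{1..Suc n} - ({1..Suc n} - \<phi> ` ({1..Suc n} - K)) = \<phi> ` ({1..Suc n} - K)"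
    using assms by blast
  with True show ?thesis
    by (simp add: transport_def Let_def comp_inj_on_iff image_comp)
next
  case False
  then show ?thesis by (auto simp: transport_def Let_def dest: inj_on_imageI2)
qed

text \<open>If t is in K, the complement avoids t and nothing moves. Otherwise t moves onto
  \<open>Suc t\<close>, which must not be in the complement already, so it has to lie in K. Seen
  from K, the element \<open>Suc t\<close> slides down to t.\<close>

lemma transport_bump:
  assumes "K \<subseteq> {1..n}" "t \<in> {1..n}"
  shows "transport n (bump t) K =
    (if t \<in> K then Some K else if Suc t \<in> K then Some (insert t (K - {Suc t})) else None)"
proof -
  let ?C = "{1..Suc n} - K"
  have im: "bump t ` ?C = (if t \<in> K then ?C else insert (Suc t) (?C - {t}))"
  proof -
    have "bump t ` ?C = ?C" if "t \<in> K"
    proof -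
      have "bump t ` ?C = id ` ?C" using that by (intro image_cong) (auto simp: bump_def)
      then show ?thesis by simp
    qed
    moreover have "bump t ` ?C = insert (Suc t) (?C - {t})" if "t \<notin> K"
    proof -
      have "?C = insert t (?C - {t})" using that assms by auto
      then have "bump t ` ?C = insert (bump t t) (bump t ` (?C - {t}))" by (metis image_insert)
      also have "bump t ` (?C - {t}) = id ` (?C - {t})"
        by (intro image_cong) (auto simp: bump_def)
      finally show ?thesis by (simp add: bump_def)
    qed
    ultimately show ?thesis by simp
  qed
  have inj: "inj_on (bump t) ?C \<longleftrightarrow> t \<in> K \<or> Suc t \<in> K"
  proof -
    have "bump t t = bump t (Suc t)" by (simp add: bump_def)
    moreover have "t \<in> {1..Suc n}" "Suc t \<in> {1..Suc n}" using assms by auto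
    ultimately have "inj_on (bump t) ?C \<Longrightarrow> t \<in> K \<or> Suc t \<in> K"
      by (metis DiffI inj_onD n_not_Suc_n)
    moreover have "t \<in> K \<or> Suc t \<in> K \<Longrightarrow> inj_on (bump t) ?C"
      by (auto simp: inj_on_def bump_def split: if_splits)
    ultimately show ?thesis by blast
  qed
  have "{1..Suc n} - ?C = K" using assms by auto
  moreover have "{1..Suc n} - insert (Suc t) (?C - {t}) = insert t (K - {Suc t})" if "Suc t \<in> K"
    using that assms by auto
  ultimately show ?thesis
    using im inj by (auto simp: transport_def Let_def)
qed

text \<open>Along the sorted list of A both functions enumerate the same image in increasing order,
  and a finite set has only one such enumeration.\<close>

lemma strict_mono_on_eqI:
  fixes f g :: "nat \<Rightarrow> nat"
  assumes "strict_mono_on A f" "strict_mono_on A g" "finite A" "f ` A = g ` A" "a \<in> A"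
  shows "f a = g a"
proof -
  let ?xs = "sorted_list_of_set A"
  have *: "sorted (map h ?xs) \<and> distinct (map h ?xs)" if "strict_mono_on A h" for h :: "nat \<Rightarrow> nat"
  proof -
    have "sorted_wrt (\<lambda>x y. h x < h y) ?xs"
      by (rule sorted_wrt_mono_rel[OF _ strict_sorted_list_of_set])
         (use that assms(3) in \<open>auto simp: strict_mono_on_def\<close>)
    then have "sorted_wrt (<) (map h ?xs)" by (simp add: sorted_wrt_map)
    then show ?thesis by (simp add: strict_sorted_iff)
  qed
  have "set (map f ?xs) = set (map g ?xs)" using assms by simp
  then have "map f ?xs = map g ?xs"
    using * assms by (intro sorted_distinct_set_unique) auto
  then show ?thesis using assms by auto
qed

text \<open>
  A monotone map is determined by the largest points of its fibres and their images; with
  the same data on these points it is the largest map.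
\<close>

lemma transport_determines:
  assumes "set u \<subseteq> {1..n}"
  obtains K L where "K \<subseteq> {1..n}" "transport n (route u) K = Some L"
    "\<And>v. set v \<subseteq> {1..n} \<Longrightarrow> transport n (route v) K = Some L \<Longrightarrow> (\<forall>i. route v i \<le> route u i)"
proof -
  \<comment> \<open>Discarding every i whose image agrees with that of \<open>Suc i\<close> leaves
    in the complement the largest point of each fibre.\<close>
  define K where "K = {i \<in> {1..n}. route u i = route u (Suc i)}"
  let ?C = "{1..Suc n} - K"
  have strict: "strict_mono_on ?C (route u)"
  proof (rule strict_mono_onI)
    fix i j assume "i \<in> ?C" "j \<in> ?C" "i < j"
    then have "i \<in> {1..n}" "i \<notin> K" by auto
    then have "route u i \<noteq> route u (Suc i)" by (simp add: K_def)
    moreover have "route u i \<le> route u (Suc i)" "route u (Suc i) \<le> route u j"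
      using \<open>i < j\<close> by (auto intro!: monoD[OF mono_route])
    ultimately show "route u i < route u j" by linarith
  qed
  let ?L = "{1..Suc n} - route u ` ?C"
  have u: "transport n (route u) K = Some ?L"
    using strict by (simp add: transport_def Let_def strict_mono_on_imp_inj_on)
  have max: "\<exists>a\<in>?C. i \<le> a \<and> route u a = route u i" if "i \<in> {1..Suc n}" for i
    using that
  proof (induction "Suc n - i" arbitrary: i)
    case 0
    then show ?case by (intro bexI[of _ i]) (auto simp: K_def)
  next
    case (Suc d)
    show ?case
    proof (cases "i \<in> K")
      case True
      then have "route u (Suc i) = route u i" by (simp add: K_def)
      moreover have "i \<noteq> Suc n" using True by (simp add: K_def)
      then have "\<exists>a\<in>?C. Suc i \<le> a \<and> route u a = route u (Suc i)"
        using Suc.hyps(2) Suc.prems by (intro Suc.hyps(1)) auto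
      ultimately show ?thesis by (metis Suc_leD)
    qed (use Suc.prems in auto)
  qed
  have "route v i \<le> route u i"
    if v: "set v \<subseteq> {1..n}" and L: "transport n (route v) K = Some ?L" for v i
  proof (cases "i \<in> {1..n}")
    case True
    have im: "route w ` ?C \<subseteq> {1..Suc n}" if "set w \<subseteq> {1..n}" for w
      by (rule image_subsetI) (rule route_in[OF that], blast)
    from L have inj: "inj_on (route v) ?C"
      and eq: "{1..Suc n} - route v ` ?C = {1..Suc n} - route u ` ?C"
      by (auto simp: transport_def Let_def split: if_splits)
    have "strict_mono_on ?C (route v)"
    proof (rule strict_mono_onI)
      fix r s assume "r \<in> ?C" "s \<in> ?C" "r < s"
      with inj have "route v r \<noteq> route v s" by (metis inj_onD less_irrefl)
      moreover have "route v r \<le> route v s" using \<open>r < s\<close> by (simp add: monoD[OF mono_route])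
      ultimately show "route v r < route v s" by simp
    qed
    moreover have "route v ` ?C = route u ` ?C"
      using eq im[OF v] im[OF assms] by blast
    ultimately have agree: "route v a = route u a" if "a \<in> ?C" for a
      using strict_mono_on_eqI[OF _ strict, of "route v" a] that by simp
    obtain a where a: "a \<in> ?C" "i \<le> a" "route u a = route u i" using max[of i] True by auto
    \<comment> \<open>The value of v at i is at most its value at a, the top of the fibre of u
      through i, and there both routes agree.\<close>
    then have "route v i \<le> route v a" by (intro monoD[OF mono_route])
    with a agree show ?thesis by simp
  qed (simp add: route_fixed[OF v] route_fixed[OF assms])
  moreover have "K \<subseteq> {1..n}" by (auto simp: K_def)
  ultimately show thesis using u that by blast
qed

section \<open>The order on subsets and the words of its pairs\<close>

lemma poset_ge_refl: "K \<subseteq> {1..n} \<Longrightarrow> poset_ge n K K"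
  by (simp add: poset_ge_def)

lemma poset_ge_trans: "poset_ge n L K \<Longrightarrow> poset_ge n K J \<Longrightarrow> poset_ge n L J"
  unfolding poset_ge_def by (metis order_trans)

text \<open>Since t is absent, replacing \<open>Suc t\<close> by t cannot collide with or overtake
  another element. In the sorted enumeration one entry drops by one and all others stay.\<close>

lemma poset_ge_shift:
  assumes "K \<subseteq> {1..n}" "t \<in> {1..n}" "t \<notin> K" "Suc t \<in> K"
  shows "poset_ge n K (insert t (K - {Suc t}))"
proof -
  let ?L = "insert t (K - {Suc t})" and ?h = "\<lambda>x. if x = Suc t then t else x"
  have fin: "finite K" using assms(1) finite_subset by blast
  have strict: "sorted_wrt (<) (map ?h (sorted_list_of_set K))"
    unfolding sorted_wrt_map
  proof (rule sorted_wrt_mono_rel[OF _ strict_sorted_list_of_set])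
    fix x y assume "x \<in> set (sorted_list_of_set K)" "y \<in> set (sorted_list_of_set K)" "x < y"
    then show "?h x < ?h y" using assms(3) fin by (auto simp: less_Suc_eq)
  qed
  have im: "?h ` K = ?L" using assms by (auto simp: image_iff)
  then have eq: "sorted_list_of_set ?L = map ?h (sorted_list_of_set K)"
  proof (intro sorted_distinct_set_unique)
    show "sorted (map ?h (sorted_list_of_set K))" "distinct (map ?h (sorted_list_of_set K))"
      using strict by (simp_all only: strict_sorted_iff)
    show "set (sorted_list_of_set ?L) = set (map ?h (sorted_list_of_set K))"
      by (simp only: set_map set_sorted_list_of_set[OF fin] im
          set_sorted_list_of_set[OF finite.insertI[OF finite_Diff[OF fin]]])
  qed simp_all
  have "card ?L = length (sorted_list_of_set ?L)" by simp
  also have "\<dots> = card K" unfolding eq by simp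
  finally have "card ?L = card K" .
  with eq assms(1,2) show ?thesis by (auto simp: poset_ge_def)
qed

lemma transport_Cons:
  assumes "t \<in> {1..n}"
  shows "transport n (route (t # w)) K = Option.bind (transport n (bump t) K) (transport n (route w))"
proof -
  have "route (t # w) = route w \<circ> bump t" by auto
  moreover have "bump t ` {1..Suc n} \<subseteq> {1..Suc n}" using assms by (auto simp: bump_def)
  ultimately show ?thesis by (simp add: transport_comp)
qed

text \<open>Every letter either fixes the subset or slides one element down, and the order is
  transitive. This is the triangularity that places all matrices inside the incidence
  algebra.\<close>

lemma transport_route_poset_ge:
  assumes "set w \<subseteq> {1..n}" "K \<subseteq> {1..n}" "transport n (route w) K = Some L"
  shows "poset_ge n K L"
  using assms
proof (induction w arbitrary: K)
  case Nil
  then show ?case using transport_id[of K n] by (simp add: id_def poset_ge_refl)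
next
  case (Cons t w)
  then obtain M where M: "transport n (bump t) K = Some M" "transport n (route w) M = Some L"
    by (auto simp: transport_Cons bind_eq_Some_conv simp del: route_simps)
  have "poset_ge n K M"
  proof (cases "t \<in> K")
    case True
    with M(1) Cons.prems(1,2) show ?thesis
      by (simp add: transport_bump poset_ge_refl del: One_nat_def)
  next
    case False
    with M(1) Cons.prems(1,2) show ?thesis
      by (auto simp: transport_bump split: if_splits simp del: One_nat_def intro!: poset_ge_shift)
  qed
  moreover from this have "poset_ge n M L"
    using Cons M(2) by (intro Cons.IH) (auto simp: poset_ge_def)
  ultimately show ?case by (rule poset_ge_trans)
qed

lemma transport_append:
  assumes "set u \<subseteq> {1..n}"
  shows "transport n (route (u @ v)) K = Option.bind (transport n (route u) K) (transport n (route v))"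
proof -
  have "route u ` {1..Suc n} \<subseteq> {1..Suc n}" using route_in[OF assms] by (rule image_subsetI)
  then show ?thesis unfolding route_append by (rule transport_comp)
qed

text \<open>The first letter k acts trivially because k lies in K; every later letter slides the
  moving element down by one. The way is free since K has no element in {j..<k}.\<close>

lemma transport_down_word:
  assumes "j \<le> k" "1 \<le> j" "k \<in> K" "K \<subseteq> {1..n}" "{j..<k} \<inter> K = {}"
  shows "transport n (route (down_word k j)) K = Some (insert j (K - {k}))"
  using assms
proof (induction k arbitrary: K rule: dec_induct)
  case base
  have "transport n (bump j) K = Some K" using base transport_bump[of K n j] by auto
  moreover have "route [j] = bump j" by auto
  moreover have "insert j (K - {j}) = K" using base by auto
  ultimately show ?case by (simp add: down_word_def)
next
  case (step k)
  let ?M = "insert k (K - {Suc k})"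
  obtain w where w: "down_word k j = k # w" using step.hyps by (simp add: down_word_def)
  have Suc: "down_word (Suc k) j = Suc k # down_word k j"
    using step.hyps by (simp add: down_word_def)
  have in_n: "k \<in> {1..n}" "Suc k \<in> {1..n}" using step.prems(1-3) step.hyps by auto
  have K: "k \<notin> K" "Suc k \<in> K" "K \<subseteq> {1..n}" "?M \<subseteq> {1..n}"
    using step.prems step.hyps(1) in_n by auto
  \<comment> \<open>The letter \<open>Suc k\<close> fixes K, and the letter k sends both K and
    \<open>?M\<close> to \<open>?M\<close>. So the shorter word may be applied to \<open>?M\<close>,
    which contains k as the induction hypothesis demands.\<close>
  have "transport n (route (down_word (Suc k) j)) K = transport n (route (down_word k j)) ?M"
    using in_n K unfolding Suc w by (simp add: transport_Cons transport_bump del: route_simps)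
  also have "\<dots> = Some (insert j (?M - {k}))"
  proof (rule step.IH)
    show "{j..<k} \<inter> ?M = {}" using step.prems(4) by fastforce
  qed (use step.prems(1) K in auto)
  also have "?M - {k} = K - {Suc k}" using K by auto
  finally show ?case .
qed

definition pair_word :: "nat set \<Rightarrow> nat set \<Rightarrow> nat list" where
  "pair_word K J = concat (map (\<lambda>(k, j). down_word k j)
     (zip (sorted_list_of_set K) (sorted_list_of_set J)))"

text \<open>A collects the elements that have reached their final places. The smallest remaining k
  moves first: below it only A is left, and A lies below the target j, so nothing blocks the
  way.\<close>

lemma transport_concat_down_words:
  assumes "length ks = length js" "sorted_wrt (<) ks" "sorted_wrt (<) js"
    "\<forall>i<length ks. js ! i \<le> ks ! i" "A \<union> set ks \<subseteq> {1..n}" "set js \<subseteq> {1..n}"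
    "\<forall>a\<in>A. \<forall>j\<in>set js. a < j"
  shows "transport n (route (concat (map (\<lambda>(k, j). down_word k j) (zip ks js)))) (A \<union> set ks)
    = Some (A \<union> set js)"
  using assms
proof (induction ks js arbitrary: A rule: list_induct2)
  case Nil
  then show ?case using transport_id[of A n] by (simp add: id_def)
next
  case (Cons k ks j js)
  have "j \<le> k" using Cons.prems(3)[rule_format, of 0] by simp
  have "k \<in> {1..n}" "j \<in> {1..n}" using Cons.prems(4,5) by auto
  have A: "\<forall>a\<in>A. a < j" "\<forall>a\<in>A. \<forall>i\<in>set js. a < i" using Cons.prems(6) by auto
  have ks: "\<forall>i\<in>set ks. k < i" and js: "\<forall>i\<in>set js. j < i"
    using Cons.prems(1,2) by auto
  have le: "\<forall>i<length ks. js ! i \<le> ks ! i"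
  proof safe
    fix i assume "i < length ks"
    with Cons.prems(3) show "js ! i \<le> ks ! i" by (auto dest: spec[of _ "Suc i"])
  qed
  have sub: "set (down_word k j) \<subseteq> {1..n}"
    using \<open>k \<in> {1..n}\<close> \<open>j \<in> {1..n}\<close> by (auto simp: down_word_def)
  have "k \<notin> A \<union> set ks" using A(1) ks \<open>j \<le> k\<close> by (meson UnE leD order_less_irrefl)
  then have "insert j (A \<union> set (k # ks) - {k}) = insert j A \<union> set ks" by auto
  moreover have "transport n (route (down_word k j)) (A \<union> set (k # ks))
      = Some (insert j (A \<union> set (k # ks) - {k}))"
  proof (rule transport_down_word)
    have "x < k \<Longrightarrow> j \<le> x \<Longrightarrow> x \<notin> A \<union> set (k # ks)" for x
      using A(1) ks by (metis Un_iff leD order.asym order_less_irrefl set_ConsD)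
    then show "{j..<k} \<inter> (A \<union> set (k # ks)) = {}" by auto
  qed (use \<open>j \<le> k\<close> \<open>j \<in> {1..n}\<close> Cons.prems(4) in auto)
  ultimately have "transport n (route (down_word k j)) (A \<union> set (k # ks)) = Some (insert j A \<union> set ks)"
    by simp
  moreover have "transport n (route (concat (map (\<lambda>(k, j). down_word k j) (zip ks js)))) (insert j A \<union> set ks)
      = Some (insert j A \<union> set js)"
  proof (rule Cons.IH)
    show "\<forall>a\<in>insert j A. \<forall>i\<in>set js. a < i" using A(2) js by simp
    show "insert j A \<union> set ks \<subseteq> {1..n}" using Cons.prems(4) \<open>j \<in> {1..n}\<close> by simp
  qed (use Cons.prems(1,2,5) le in simp_all)
  ultimately show ?case using sub by (simp add: transport_append)
qed

lemma transport_pair_word: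
  assumes "poset_ge n K J"
  shows "transport n (route (pair_word K J)) K = Some J" "set (pair_word K J) \<subseteq> {1..n}"
proof -
  have fin: "finite K" "finite J" using assms by (auto simp: poset_ge_def intro: finite_subset)
  have "transport n (route (pair_word K J)) ({} \<union> set (sorted_list_of_set K))
      = Some ({} \<union> set (sorted_list_of_set J))"
    unfolding pair_word_def using assms fin
    by (intro transport_concat_down_words) (auto simp: poset_ge_def)
  with fin show "transport n (route (pair_word K J)) K = Some J" by simp
  show "set (pair_word K J) \<subseteq> {1..n}"
  proof
    fix x assume "x \<in> set (pair_word K J)"
    then obtain k j where kj: "(k, j) \<in> set (zip (sorted_list_of_set K) (sorted_list_of_set J))"
      "x \<in> set (down_word k j)"
      by (auto simp: pair_word_def)
    from set_zip_leftD[OF kj(1)] set_zip_rightD[OF kj(1)] fin assms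
    have "k \<in> {1..n}" "j \<in> {1..n}" by (auto simp: poset_ge_def)
    with kj(2) show "x \<in> {1..n}" by (auto simp: down_word_def)
  qed
qed

section \<open>Quotients and coordinates of vector spaces\<close>

abbreviation lin_hom :: "('r::field, 'a) module \<Rightarrow> ('r, 'b) module \<Rightarrow> ('a \<Rightarrow> 'b) set" where
  "lin_hom M N \<equiv> LinearCombinations.module_hom class_ring M N"

lemma linear_mapI:
  assumes "vectorspace class_ring M" "vectorspace class_ring N" "f \<in> lin_hom M N"
  shows "linear_map class_ring M N f"
proof -
  interpret M: vectorspace class_ring M by fact
  interpret N: vectorspace class_ring N by fact
  show ?thesis by unfold_locales (rule assms)
qed

lemma lin_hom_closed: "f \<in> lin_hom M N \<Longrightarrow> x \<in> carrier M \<Longrightarrow> f x \<in> carrier N"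
  by (auto simp: LinearCombinations.module_hom_def)

lemma lin_homI:
  assumes "\<And>x. x \<in> carrier M \<Longrightarrow> f x \<in> carrier N"
    and "\<And>x y. x \<in> carrier M \<Longrightarrow> y \<in> carrier M \<Longrightarrow> f (x \<oplus>\<^bsub>M\<^esub> y) = f x \<oplus>\<^bsub>N\<^esub> f y"
    and "\<And>c x. x \<in> carrier M \<Longrightarrow> f (c \<odot>\<^bsub>M\<^esub> x) = c \<odot>\<^bsub>N\<^esub> f x"
  shows "f \<in> lin_hom M N"
  using assms by (auto simp: LinearCombinations.module_hom_def)

lemma lin_hom_add:
  "f \<in> lin_hom M N \<Longrightarrow> x \<in> carrier M \<Longrightarrow> y \<in> carrier M \<Longrightarrow> f (x \<oplus>\<^bsub>M\<^esub> y) = f x \<oplus>\<^bsub>N\<^esub> f y"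
  by (auto simp: LinearCombinations.module_hom_def)

lemma lin_hom_smult: "f \<in> lin_hom M N \<Longrightarrow> x \<in> carrier M \<Longrightarrow> f (c \<odot>\<^bsub>M\<^esub> x) = c \<odot>\<^bsub>N\<^esub> f x"
  by (auto simp: LinearCombinations.module_hom_def)

lemma lin_hom_zero:
  assumes "vectorspace class_ring M" "vectorspace class_ring N" "f \<in> lin_hom M N"
  shows "f \<zero>\<^bsub>M\<^esub> = \<zero>\<^bsub>N\<^esub>"
proof -
  interpret linear_map class_ring M N f using assms by (rule linear_mapI)
  show ?thesis by simp
qed

lemma lin_hom_diff:
  assumes "vectorspace class_ring M" "vectorspace class_ring N" "f \<in> lin_hom M N"
    "x \<in> carrier M" "y \<in> carrier M"
  shows "f (x \<ominus>\<^bsub>M\<^esub> y) = f x \<ominus>\<^bsub>N\<^esub> f y"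
proof -
  interpret linear_map class_ring M N f using assms(1-3) by (rule linear_mapI)
  show ?thesis using assms(4,5) by simp
qed

lemma lin_hom_eq_iff:
  assumes "vectorspace class_ring M" "vectorspace class_ring N" "f \<in> lin_hom M N"
    "x \<in> carrier M" "y \<in> carrier M"
  shows "f x = f y \<longleftrightarrow> f (x \<ominus>\<^bsub>M\<^esub> y) = \<zero>\<^bsub>N\<^esub>"
proof -
  interpret linear_map class_ring M N f using assms(1-3) by (rule linear_mapI)
  show ?thesis using assms(4,5) by simp
qed

text \<open>Every element of N is a value of q, so the axioms of N are inherited from M. This suits
  quotients carried by representatives, whose operations are known only through the map q.\<close>

lemma vectorspace_image:
  assumes M: "vectorspace K M" and car: "carrier N = q ` carrier M"
    and zero: "q \<zero>\<^bsub>M\<^esub> = \<zero>\<^bsub>N\<^esub>"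
    and add: "\<And>x y. x \<in> carrier M \<Longrightarrow> y \<in> carrier M \<Longrightarrow> q (x \<oplus>\<^bsub>M\<^esub> y) = q x \<oplus>\<^bsub>N\<^esub> q y"
    and smult: "\<And>c x. c \<in> carrier K \<Longrightarrow> x \<in> carrier M \<Longrightarrow> q (c \<odot>\<^bsub>M\<^esub> x) = c \<odot>\<^bsub>N\<^esub> q x"
  shows "vectorspace K N"
proof -
  interpret M: vectorspace K M by fact
  note [simp] = add[symmetric] smult[symmetric] zero[symmetric]
  show ?thesis
  proof (rule vs_criteria)
    show "field K" by unfold_locales
    show "\<forall>v\<in>carrier N. \<exists>w\<in>carrier N. v \<oplus>\<^bsub>N\<^esub> w = \<zero>\<^bsub>N\<^esub>"
    proof
      fix v assume "v \<in> carrier N"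
      then obtain x where x: "x \<in> carrier M" "v = q x" using car by auto
      then have "v \<oplus>\<^bsub>N\<^esub> q (\<ominus>\<^bsub>M\<^esub> x) = \<zero>\<^bsub>N\<^esub>" by (simp add: M.M.r_neg)
      then show "\<exists>w\<in>carrier N. v \<oplus>\<^bsub>N\<^esub> w = \<zero>\<^bsub>N\<^esub>" using x car by auto
    qed
  qed (auto simp: car M.M.add.m_ac M.smult_l_distr M.smult_r_distr M.smult_assoc1)
qed

context
  fixes M :: "('r::field, 'v) module" and N :: "'v set"
  assumes sub: "subspace class_ring N M"
begin

interpretation M: vectorspace class_ring M
  using sub by (simp add: subspace_def)

interpretation N: submodule class_ring N M
  using sub by (simp add: subspace_def)

lemma subspace_diff: "x \<in> N \<Longrightarrow> y \<in> N \<Longrightarrow> x \<ominus>\<^bsub>M\<^esub> y \<in> N"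
proof -
  assume xy: "x \<in> N" "y \<in> N"
  then have "\<ominus>\<^bsub>M\<^esub> y = (\<ominus>\<^bsub>class_ring\<^esub> \<one>\<^bsub>class_ring\<^esub>) \<odot>\<^bsub>M\<^esub> y"
    using N.subset by (intro M.smult_minus_1[symmetric]) blast
  also have "\<dots> \<in> N" using xy(2) by (intro N.smult_closed) simp_all
  finally show ?thesis using xy by (simp add: a_minus_def)
qed

lemma coset_rep_obtain:
  assumes "x \<in> carrier M"
  obtains h where "h \<in> N" "coset_rep M N x = h \<oplus>\<^bsub>M\<^esub> x"
proof -
  have "\<zero>\<^bsub>M\<^esub> \<oplus>\<^bsub>M\<^esub> x \<in> N +>\<^bsub>M\<^esub> x" by (auto simp: a_r_coset_def')
  then have "coset_rep M N x \<in> N +>\<^bsub>M\<^esub> x" unfolding coset_rep_def by (rule someI)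
  with that show thesis by (auto simp: a_r_coset_def')
qed

lemma coset_rep_closed: "x \<in> carrier M \<Longrightarrow> coset_rep M N x \<in> carrier M"
proof -
  assume x: "x \<in> carrier M"
  then obtain h where "h \<in> N" "coset_rep M N x = h \<oplus>\<^bsub>M\<^esub> x" by (rule coset_rep_obtain)
  moreover from this have "h \<in> carrier M" using N.subset by blast
  ultimately show ?thesis using x by simp
qed

text \<open>The representative is chosen from the coset as a set, and shifting by an element of N
  leaves this set unchanged.\<close>

lemma coset_rep_absorb:
  assumes "h \<in> N" "x \<in> carrier M"
  shows "coset_rep M N (h \<oplus>\<^bsub>M\<^esub> x) = coset_rep M N x"
proof -
  have h: "h \<in> carrier M" and N: "\<And>k. k \<in> N \<Longrightarrow> k \<in> carrier M" using assms N.subset by auto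
  have "N +>\<^bsub>M\<^esub> (h \<oplus>\<^bsub>M\<^esub> x) = N +>\<^bsub>M\<^esub> x"
  proof (intro equalityI subsetI)
    fix y assume "y \<in> N +>\<^bsub>M\<^esub> (h \<oplus>\<^bsub>M\<^esub> x)"
    then obtain k where "k \<in> N" "y = k \<oplus>\<^bsub>M\<^esub> (h \<oplus>\<^bsub>M\<^esub> x)" by (auto simp: a_r_coset_def')
    then have "y = (k \<oplus>\<^bsub>M\<^esub> h) \<oplus>\<^bsub>M\<^esub> x" "k \<oplus>\<^bsub>M\<^esub> h \<in> N"
      using h N assms by (auto simp: M.M.a_assoc)
    then show "y \<in> N +>\<^bsub>M\<^esub> x" by (auto simp: a_r_coset_def')
  next
    fix y assume "y \<in> N +>\<^bsub>M\<^esub> x"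
    then obtain k where k: "k \<in> N" "y = k \<oplus>\<^bsub>M\<^esub> x" by (auto simp: a_r_coset_def')
    have "(k \<ominus>\<^bsub>M\<^esub> h) \<oplus>\<^bsub>M\<^esub> (h \<oplus>\<^bsub>M\<^esub> x) = (k \<ominus>\<^bsub>M\<^esub> h \<oplus>\<^bsub>M\<^esub> h) \<oplus>\<^bsub>M\<^esub> x"
      using h N[OF k(1)] assms by (simp add: M.M.a_assoc)
    also have "k \<ominus>\<^bsub>M\<^esub> h \<oplus>\<^bsub>M\<^esub> h = k"
      using h N[OF k(1)] by (simp add: a_minus_def M.M.a_assoc M.M.l_neg)
    finally have "y = (k \<ominus>\<^bsub>M\<^esub> h) \<oplus>\<^bsub>M\<^esub> (h \<oplus>\<^bsub>M\<^esub> x)" using k by simp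
    moreover have "k \<ominus>\<^bsub>M\<^esub> h \<in> N" using k assms by (intro subspace_diff)
    ultimately show "y \<in> N +>\<^bsub>M\<^esub> (h \<oplus>\<^bsub>M\<^esub> x)" by (auto simp: a_r_coset_def')
  qed
  then show ?thesis by (simp add: coset_rep_def)
qed

lemma coset_rep_idem:
  assumes "x \<in> carrier M"
  shows "coset_rep M N (coset_rep M N x) = coset_rep M N x"
proof -
  obtain h where h: "h \<in> N" "coset_rep M N x = h \<oplus>\<^bsub>M\<^esub> x" using assms by (rule coset_rep_obtain)
  then show ?thesis using assms by (simp add: coset_rep_absorb)
qed

lemma coset_rep_add:
  assumes "x \<in> carrier M" "y \<in> carrier M"
  shows "coset_rep M N (coset_rep M N x \<oplus>\<^bsub>M\<^esub> coset_rep M N y) = coset_rep M N (x \<oplus>\<^bsub>M\<^esub> y)"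
proof -
  obtain h where h: "h \<in> N" "coset_rep M N x = h \<oplus>\<^bsub>M\<^esub> x"
    using assms(1) by (rule coset_rep_obtain)
  obtain k where k: "k \<in> N" "coset_rep M N y = k \<oplus>\<^bsub>M\<^esub> y"
    using assms(2) by (rule coset_rep_obtain)
  have "h \<in> carrier M" "k \<in> carrier M" using h k N.subset by auto
  then have "coset_rep M N x \<oplus>\<^bsub>M\<^esub> coset_rep M N y = (h \<oplus>\<^bsub>M\<^esub> k) \<oplus>\<^bsub>M\<^esub> (x \<oplus>\<^bsub>M\<^esub> y)"
    using assms h k by (simp add: M.M.add.m_ac)
  then show ?thesis using h k assms by (simp add: coset_rep_absorb)
qed

lemma coset_rep_smult:
  assumes "x \<in> carrier M"
  shows "coset_rep M N (c \<odot>\<^bsub>M\<^esub> coset_rep M N x) = coset_rep M N (c \<odot>\<^bsub>M\<^esub> x)"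
proof -
  obtain h where h: "h \<in> N" "coset_rep M N x = h \<oplus>\<^bsub>M\<^esub> x"
    using assms(1) by (rule coset_rep_obtain)
  have "h \<in> carrier M" using h N.subset by auto
  then have "c \<odot>\<^bsub>M\<^esub> coset_rep M N x = (c \<odot>\<^bsub>M\<^esub> h) \<oplus>\<^bsub>M\<^esub> (c \<odot>\<^bsub>M\<^esub> x)"
    using assms h by (simp add: M.smult_r_distr)
  moreover have "c \<odot>\<^bsub>M\<^esub> h \<in> N" "c \<odot>\<^bsub>M\<^esub> x \<in> carrier M"
    using h assms by (auto intro: M.smult_closed)
  ultimately show ?thesis by (simp add: coset_rep_absorb)
qed

lemma coset_rep_hom: "coset_rep M N \<in> lin_hom M (quot_space M N)"
proof (rule lin_homI)
  fix x y assume "x \<in> carrier M" "y \<in> carrier M"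
  then show "coset_rep M N (x \<oplus>\<^bsub>M\<^esub> y) = coset_rep M N x \<oplus>\<^bsub>quot_space M N\<^esub> coset_rep M N y"
    unfolding quot_space_def by (simp add: coset_rep_add)
next
  fix c x assume "x \<in> carrier M"
  then show "coset_rep M N (c \<odot>\<^bsub>M\<^esub> x) = c \<odot>\<^bsub>quot_space M N\<^esub> coset_rep M N x"
    unfolding quot_space_def by (simp add: coset_rep_smult)
qed (simp add: quot_space_def)

lemma quot_space_vectorspace: "vectorspace class_ring (quot_space M N)"
proof (rule vectorspace_image[OF M.vectorspace_axioms])
  show "carrier (quot_space M N) = coset_rep M N ` carrier M"
    "coset_rep M N \<zero>\<^bsub>M\<^esub> = \<zero>\<^bsub>quot_space M N\<^esub>"
    by (simp_all add: quot_space_def)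
  show "coset_rep M N (x \<oplus>\<^bsub>M\<^esub> y) = coset_rep M N x \<oplus>\<^bsub>quot_space M N\<^esub> coset_rep M N y"
    if "x \<in> carrier M" "y \<in> carrier M" for x y
    using coset_rep_hom that by (rule lin_hom_add)
  show "coset_rep M N (c \<odot>\<^bsub>M\<^esub> x) = c \<odot>\<^bsub>quot_space M N\<^esub> coset_rep M N x"
    if "x \<in> carrier M" for c x
    using coset_rep_hom that by (rule lin_hom_smult)
qed

lemma quot_space_fin_dim:
  assumes "vectorspace.fin_dim class_ring M"
  shows "vectorspace.fin_dim class_ring (quot_space M N)"
proof -
  interpret linear_map class_ring M "quot_space M N" "coset_rep M N"
    using M.vectorspace_axioms quot_space_vectorspace coset_rep_hom by (rule linear_mapI)
  have "coset_rep M N ` carrier M = carrier (quot_space M N)"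
    unfolding quot_space_def by simp
  with assms show ?thesis by (rule surj_fin_dim)
qed

lemma coset_rep_eq_zero_iff:
  assumes "x \<in> carrier M"
  shows "coset_rep M N x = \<zero>\<^bsub>quot_space M N\<^esub> \<longleftrightarrow> x \<in> N"
proof
  assume "x \<in> N"
  then have "coset_rep M N x = coset_rep M N \<zero>\<^bsub>M\<^esub>"
    using coset_rep_absorb[of x "\<zero>\<^bsub>M\<^esub>"] N.subset by auto
  then show "coset_rep M N x = \<zero>\<^bsub>quot_space M N\<^esub>" by (simp add: quot_space_def)
next
  assume "coset_rep M N x = \<zero>\<^bsub>quot_space M N\<^esub>"
  then have eq: "coset_rep M N x = coset_rep M N \<zero>\<^bsub>M\<^esub>" by (simp add: quot_space_def)
  obtain h where h: "h \<in> N" "coset_rep M N x = h \<oplus>\<^bsub>M\<^esub> x" using assms by (rule coset_rep_obtain)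
  \<comment> \<open>The zero of the quotient is some element k of N that may differ from the zero of
    M; hence x is recovered as the difference of k and h.\<close>
  obtain k where k: "k \<in> N" "coset_rep M N \<zero>\<^bsub>M\<^esub> = k \<oplus>\<^bsub>M\<^esub> \<zero>\<^bsub>M\<^esub>"
    by (rule coset_rep_obtain[of "\<zero>\<^bsub>M\<^esub>"]) auto
  have c: "h \<in> carrier M" "k \<in> carrier M" using h k N.subset by auto
  have "k \<ominus>\<^bsub>M\<^esub> h = (h \<oplus>\<^bsub>M\<^esub> x) \<ominus>\<^bsub>M\<^esub> h" using eq h k c by simp
  also have "\<dots> = x"
    using c assms by (simp add: M.M.add.m_comm[of h x] a_minus_def M.M.a_assoc M.M.r_neg)
  finally show "x \<in> N" using subspace_diff[OF k(1) h(1)] by simp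
qed

text \<open>An independent set in the subspace is independent in M, so its size is at most the
  dimension of M. A maximal one therefore exists, and it generates the subspace.\<close>

lemma subspace_fin_dim:
  assumes "vectorspace.fin_dim class_ring M"
  shows "vectorspace.fin_dim class_ring (M\<lparr>carrier := N\<rparr>)"
proof -
  interpret S: vectorspace class_ring "M\<lparr>carrier := N\<rparr>"
    using sub by (rule M.subspace_is_vs)
  have indpt: "S.lin_indpt A \<longleftrightarrow> M.lin_indpt A" if "A \<subseteq> N" for A
    using M.span_li_not_depend(2)[OF that N.submodule_axioms] by simp
  have "\<exists>A. finite A \<and> maximal A (\<lambda>A. A \<subseteq> carrier (M\<lparr>carrier := N\<rparr>) \<and> S.lin_indpt A)"
  proof (rule maximal_exists)
    fix A assume "A \<subseteq> carrier (M\<lparr>carrier := N\<rparr>) \<and> S.lin_indpt A"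
    then show "finite A \<and> card A \<le> M.dim"
      using indpt M.li_le_dim[OF assms, of A] N.subset by auto
  next
    show "{} \<subseteq> carrier (M\<lparr>carrier := N\<rparr>) \<and> S.lin_indpt {}"
      by (auto simp: S.lin_dep_def)
  qed
  then obtain A where A: "finite A" "maximal A (\<lambda>A. A \<subseteq> carrier (M\<lparr>carrier := N\<rparr>) \<and> S.lin_indpt A)"
    by auto
  then have "S.gen_set A" by (intro S.max_li_is_gen)
  with A show ?thesis unfolding S.fin_dim_def maximal_def by blast
qed

end

text \<open>Powers of a simple module live on coordinate spaces, whereas the spaces of a
  representation are arbitrary; coordinates with respect to a finite basis connect the two.\<close>

lemma coordinates_exist:
  fixes V :: "('r::field, 'v) module"
  assumes vs: "vectorspace class_ring V" and fd: "vectorspace.fin_dim class_ring V"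
  obtains m f where "f \<in> lin_hom V (module_vec TYPE('r) m)" "bij_betw f (carrier V) (carrier_vec m)"
proof -
  interpret V: vectorspace class_ring V by fact
  obtain A where A: "finite A" "V.basis A" using V.finite_basis_exists[OF fd] by auto
  then have AV: "A \<subseteq> carrier V" by (simp add: V.basis_def)
  obtain b where b: "bij_betw b {0..<card A} A" using ex_bij_betw_nat_finite[OF A(1)] by auto
  have ex1: "\<exists>!a. a \<in> A \<rightarrow>\<^sub>E UNIV \<and> V.lincomb a A = v" if "v \<in> carrier V" for v
    using V.basis_criterion[OF A(1) AV] A(2) that by simp
  define co where "co v = (THE a. a \<in> A \<rightarrow>\<^sub>E UNIV \<and> V.lincomb a A = v)" for v
  have co: "co v \<in> A \<rightarrow>\<^sub>E UNIV" "V.lincomb (co v) A = v" if "v \<in> carrier V" for v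
    using theI'[OF ex1[OF that]] by (simp_all add: co_def)
  \<comment> \<open>Uniqueness of coordinates holds among families that are undefined off A, so an
    arbitrary family has to be restricted to A before it is compared.\<close>
  have co_unique: "co v x = a x" if "v \<in> carrier V" "V.lincomb a A = v" "x \<in> A"
    for v x and a :: "'v \<Rightarrow> 'r"
  proof -
    have "V.lincomb (restrict a A) A = V.lincomb a A"
      using AV by (intro V.lincomb_cong) auto
    then have "co v = restrict a A" using ex1[OF that(1)] co[OF that(1)] that(2) by auto
    with that(3) show ?thesis by simp
  qed
  define f where "f v = vec (card A) (\<lambda>i. co v (b i))" for v
  have bA: "b i \<in> A" if "i < card A" for i using b that by (auto simp: bij_betw_def)
  have "f \<in> lin_hom V (module_vec TYPE('r) (card A))"
  proof (rule lin_homI)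
    fix x y assume xy: "x \<in> carrier V" "y \<in> carrier V"
    have "V.lincomb (\<lambda>v. co x v + co y v) A = x \<oplus>\<^bsub>V\<^esub> y"
      using V.lincomb_sum[OF A(1) AV, of "co x" "co y"] xy by (simp add: co)
    then have "co (x \<oplus>\<^bsub>V\<^esub> y) z = co x z + co y z" if "z \<in> A" for z
      using co_unique[of "x \<oplus>\<^bsub>V\<^esub> y" "\<lambda>v. co x v + co y v"] that xy by simp
    then show "f (x \<oplus>\<^bsub>V\<^esub> y) = f x \<oplus>\<^bsub>module_vec TYPE('r) (card A)\<^esub> f y"
      by (auto simp: f_def module_vec_simps bA)
  next
    fix c x assume x: "x \<in> carrier V"
    have "V.lincomb (\<lambda>v. c * co x v) A = c \<odot>\<^bsub>V\<^esub> x"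
      using V.lincomb_smult[OF AV, of "co x" c] x by (simp add: co)
    then have "co (c \<odot>\<^bsub>V\<^esub> x) z = c * co x z" if "z \<in> A" for z
      using co_unique[of "c \<odot>\<^bsub>V\<^esub> x" "\<lambda>v. c * co x v"] that x V.smult_closed by simp
    then show "f (c \<odot>\<^bsub>V\<^esub> x) = c \<odot>\<^bsub>module_vec TYPE('r) (card A)\<^esub> f x"
      by (auto simp: f_def module_vec_simps bA)
  qed (simp add: f_def module_vec_simps)
  moreover have "bij_betw f (carrier V) (carrier_vec (card A))"
  proof (rule bij_betw_imageI)
    show "inj_on f (carrier V)"
    proof (rule inj_onI)
      fix x y assume xy: "x \<in> carrier V" "y \<in> carrier V" "f x = f y"
      have "co x z = co y z" if "z \<in> A" for z
      proof -
        have "z \<in> b ` {0..<card A}" using b that by (simp add: bij_betw_def)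
        then obtain i where "i < card A" "z = b i" by auto
        with arg_cong[OF xy(3), of "\<lambda>u. u $ i"] show ?thesis by (simp add: f_def)
      qed
      then have "V.lincomb (co x) A = V.lincomb (co y) A"
        using AV by (intro V.lincomb_cong) auto
      then show "x = y" using co(2)[OF xy(1)] co(2)[OF xy(2)] by simp
    qed
    show "f ` carrier V = carrier_vec (card A)"
    proof (intro equalityI subsetI)
      fix u :: "'r vec" assume u: "u \<in> carrier_vec (card A)"
      define a where "a x = u $ (inv_into {0..<card A} b x)" for x
      have v: "V.lincomb a A \<in> carrier V" using AV by (intro V.lincomb_closed) auto
      have "co (V.lincomb a A) (b i) = u $ i" if "i < card A" for i
        using co_unique[OF v refl bA[OF that]] that b
        by (simp add: a_def bij_betw_inv_into_left)
      then have "f (V.lincomb a A) = u" using u by (auto simp: f_def)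
      with v show "u \<in> f ` carrier V" by blast
    qed (auto simp: f_def)
  qed
  ultimately show thesis by (rule that)
qed

section \<open>The trace of a simple module\<close>

lemma is_repD:
  assumes "is_rep n V"
  shows "i \<in> {1..n} \<Longrightarrow> vectorspace class_ring (space V i)"
    and "i \<in> {1..n} \<Longrightarrow> vectorspace.fin_dim class_ring (space V i)"
    and "i \<in> {1..<n} \<Longrightarrow> arr V i \<in> lin_hom (space V i) (space V (Suc i))"
  using assms by (simp_all add: is_rep_def)

lemma rep_homD:
  assumes "\<phi> \<in> rep_hom n V W"
  shows "i \<in> {1..n} \<Longrightarrow> \<phi> i \<in> lin_hom (space V i) (space W i)"
    and "i \<in> {1..<n} \<Longrightarrow> x \<in> carrier (space V i) \<Longrightarrow> \<phi> (Suc i) (arr V i x) = arr W i (\<phi> i x)"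
  using assms by (simp_all add: rep_hom_def)

lemma is_submodD:
  assumes "is_submod n V U"
  shows "i \<in> {1..n} \<Longrightarrow> subspace class_ring (U i) (space V i)"
    and "i \<in> {1..<n} \<Longrightarrow> x \<in> U i \<Longrightarrow> arr V i x \<in> U (Suc i)"
  using assms by (fastforce simp: is_submod_def)+

lemma subspace_contains_zero: "subspace K W V \<Longrightarrow> \<zero>\<^bsub>V\<^esub> \<in> W"
  by (rule LinearCombinations.submodule.zero_closed[OF subspace.submod])

lemma subspace_subset: "subspace K W V \<Longrightarrow> W \<subseteq> carrier V"
  by (rule LinearCombinations.submodule.subset[OF subspace.submod])

lemma subspace_zero:
  assumes "vectorspace K V"
  shows "subspace K {\<zero>\<^bsub>V\<^esub>} V"
proof -
  interpret vectorspace K V by fact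
  show ?thesis
    by (intro subspace.intro submodule.intro assms) (auto intro: module_axioms)
qed

lemma subspace_carrier:
  assumes "vectorspace K V"
  shows "subspace K (carrier V) V"
proof -
  interpret vectorspace K V by fact
  show ?thesis
    by (intro subspace.intro submodule.intro assms) (auto intro: module_axioms)
qed

lemma subspace_kernel:
  assumes "vectorspace class_ring V" "vectorspace class_ring W" "f \<in> lin_hom V W"
  shows "subspace class_ring {x \<in> carrier V. f x = \<zero>\<^bsub>W\<^esub>} V"
proof -
  interpret linear_map class_ring V W f using assms by (rule linear_mapI)
  show ?thesis using kerT_is_subspace unfolding ker_def by simp
qed

lemma quot_rep_simps [simp]:
  "space (quot_rep V U) i = quot_space (space V i) (U i)"
  "arr (quot_rep V U) i x = coset_rep (space V (Suc i)) (U (Suc i)) (arr V i x)"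
  by (simp_all add: quot_rep_def)

text \<open>The representative of x differs from x by an element of the submodule. The arrow sends
  this element into the submodule again, where the next representative absorbs it.\<close>

lemma coset_rep_arr:
  assumes V: "is_rep n V" and U: "is_submod n V U" and i: "i \<in> {1..<n}"
    and x: "x \<in> carrier (space V i)"
  shows "arr (quot_rep V U) i (coset_rep (space V i) (U i) x)
    = coset_rep (space V (Suc i)) (U (Suc i)) (arr V i x)"
proof -
  have i': "i \<in> {1..n}" "Suc i \<in> {1..n}" using i by auto
  have arr: "arr V i \<in> lin_hom (space V i) (space V (Suc i))" using V i by (rule is_repD)
  obtain h where h: "h \<in> U i" "coset_rep (space V i) (U i) x = h \<oplus>\<^bsub>space V i\<^esub> x"
    using is_submodD(1)[OF U i'(1)] x by (rule coset_rep_obtain)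
  have hc: "h \<in> carrier (space V i)" using subspace_subset[OF is_submodD(1)[OF U i'(1)]] h by auto
  then have "arr V i (h \<oplus>\<^bsub>space V i\<^esub> x) = arr V i h \<oplus>\<^bsub>space V (Suc i)\<^esub> arr V i x"
    using arr x by (intro lin_hom_add)
  then show ?thesis
    using coset_rep_absorb[OF is_submodD(1)[OF U i'(2)] is_submodD(2)[OF U i h(1)]
        lin_hom_closed[OF arr x]] h(2) by simp
qed

lemma is_rep_quot_rep:
  assumes V: "is_rep n V" and U: "is_submod n V U"
  shows "is_rep n (quot_rep V U)"
  unfolding is_rep_def
proof (intro conjI ballI)
  fix i assume i: "i \<in> {1..n}"
  show "vectorspace class_ring (space (quot_rep V U) i)"
    using quot_space_vectorspace[OF is_submodD(1)[OF U i]] by simp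
  show "vectorspace.fin_dim class_ring (space (quot_rep V U) i)"
    using quot_space_fin_dim[OF is_submodD(1)[OF U i] is_repD(2)[OF V i]] by simp
next
  fix i assume i: "i \<in> {1..<n}"
  then have i': "i \<in> {1..n}" "Suc i \<in> {1..n}" by auto
  let ?q = "\<lambda>i. coset_rep (space V i) (U i)"
  have arr: "arr V i \<in> lin_hom (space V i) (space V (Suc i))" using V i by (rule is_repD)
  have q: "?q i \<in> lin_hom (space V i) (quot_space (space V i) (U i))" if "i \<in> {1..n}" for i
    by (rule coset_rep_hom[OF is_submodD(1)[OF U that]])
  have car: "carrier (quot_space (space V i) (U i)) = ?q i ` carrier (space V i)"
    by (simp add: quot_space_def)
  interpret V: vectorspace class_ring "space V i" by (rule is_repD(1)[OF V i'(1)])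
  note arr_q = coset_rep_arr[OF V U i]
  have "arr (quot_rep V U) i \<in> lin_hom (quot_space (space V i) (U i)) (quot_space (space V (Suc i)) (U (Suc i)))"
  proof (rule lin_homI)
    fix x assume "x \<in> carrier (quot_space (space V i) (U i))"
    then obtain v where v: "v \<in> carrier (space V i)" "x = ?q i v" using car by auto
    then show "arr (quot_rep V U) i x \<in> carrier (quot_space (space V (Suc i)) (U (Suc i)))"
      using arr_q lin_hom_closed[OF q[OF i'(2)] lin_hom_closed[OF arr v(1)]] by simp
    show "arr (quot_rep V U) i (c \<odot>\<^bsub>quot_space (space V i) (U i)\<^esub> x)
      = c \<odot>\<^bsub>quot_space (space V (Suc i)) (U (Suc i))\<^esub> arr (quot_rep V U) i x" for c
    proof -
      have "c \<odot>\<^bsub>quot_space (space V i) (U i)\<^esub> x = ?q i (c \<odot>\<^bsub>space V i\<^esub> v)"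
        using lin_hom_smult[OF q[OF i'(1)] v(1)] v(2) by simp
      moreover have "c \<odot>\<^bsub>space V i\<^esub> v \<in> carrier (space V i)" using v(1) by simp
      ultimately show ?thesis
        using arr_q[OF v(1)] arr_q[of "c \<odot>\<^bsub>space V i\<^esub> v"] lin_hom_smult[OF arr v(1)] v(2)
          lin_hom_smult[OF q[OF i'(2)] lin_hom_closed[OF arr v(1)]]
        by metis
    qed
    fix y assume "y \<in> carrier (quot_space (space V i) (U i))"
    then obtain w where w: "w \<in> carrier (space V i)" "y = ?q i w" using car by auto
    have "x \<oplus>\<^bsub>quot_space (space V i) (U i)\<^esub> y = ?q i (v \<oplus>\<^bsub>space V i\<^esub> w)"
      using lin_hom_add[OF q[OF i'(1)] v(1) w(1)] v(2) w(2) by simp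
    moreover have "v \<oplus>\<^bsub>space V i\<^esub> w \<in> carrier (space V i)" using v(1) w(1) by simp
    ultimately show "arr (quot_rep V U) i (x \<oplus>\<^bsub>quot_space (space V i) (U i)\<^esub> y)
      = arr (quot_rep V U) i x \<oplus>\<^bsub>quot_space (space V (Suc i)) (U (Suc i))\<^esub> arr (quot_rep V U) i y"
      using arr_q[OF v(1)] arr_q[OF w(1)] arr_q[of "v \<oplus>\<^bsub>space V i\<^esub> w"]
        lin_hom_add[OF arr v(1) w(1)] v(2) w(2)
        lin_hom_add[OF q[OF i'(2)] lin_hom_closed[OF arr v(1)] lin_hom_closed[OF arr w(1)]]
      by metis
  qed
  then show "arr (quot_rep V U) i \<in> lin_hom (space (quot_rep V U) i) (space (quot_rep V U) (i + 1))"
    by simp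
qed

text \<open>The explicit form of the trace of the simple at t. At the sink t = n no arrow leaves, so
  the whole space qualifies. The empty value off the vertices follows the convention of
  \<open>is_submod\<close>, which lets submodules be compared as functions.\<close>

definition socle_at :: "nat \<Rightarrow> nat \<Rightarrow> 'r::field rep \<Rightarrow> nat \<Rightarrow> 'r vec set" where
  "socle_at n t V i =
    (if i \<notin> {1..n} then {}
     else if i = t then {x \<in> carrier (space V t). t < n \<longrightarrow> arr V t x = \<zero>\<^bsub>space V (Suc t)\<^esub>}
     else {\<zero>\<^bsub>space V i\<^esub>})"

lemma subspace_socle_at:
  assumes V: "is_rep n V" and i: "i \<in> {1..n}"
  shows "subspace class_ring (socle_at n t V i) (space V i)"
proof (cases "i = t")
  case True
  show ?thesis
  proof (cases "t < n")
    case lt: True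
    then have "socle_at n t V i = {x \<in> carrier (space V t). arr V t x = \<zero>\<^bsub>space V (Suc t)\<^esub>}"
      using True i by (simp add: socle_at_def)
    then show ?thesis
      using subspace_kernel[OF is_repD(1)[OF V, of t] is_repD(1)[OF V, of "Suc t"] is_repD(3)[OF V, of t]]
        True i lt by simp
  next
    case False
    then have "socle_at n t V i = carrier (space V i)" using True i by (simp add: socle_at_def)
    then show ?thesis using subspace_carrier[OF is_repD(1)[OF V i]] by simp
  qed
next
  case False
  then have "socle_at n t V i = {\<zero>\<^bsub>space V i\<^esub>}" using i by (simp add: socle_at_def)
  then show ?thesis using subspace_zero[OF is_repD(1)[OF V i]] by simp
qed

lemma arr_zero:
  assumes "is_rep n V" "i \<in> {1..<n}"
  shows "arr V i \<zero>\<^bsub>space V i\<^esub> = \<zero>\<^bsub>space V (Suc i)\<^esub>"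
  using assms by (intro lin_hom_zero is_repD) auto

lemma is_submod_socle_at:
  assumes V: "is_rep n V"
  shows "is_submod n V (socle_at n t V)"
  unfolding is_submod_def
proof (intro conjI ballI allI impI)
  fix i assume i: "i \<in> {1..<n}"
  have 0: "\<zero>\<^bsub>space V (i + 1)\<^esub> \<in> socle_at n t V (i + 1)"
    using i by (intro subspace_contains_zero[OF subspace_socle_at[OF V]]) auto
  have "arr V i x = \<zero>\<^bsub>space V (i + 1)\<^esub>" if "x \<in> socle_at n t V i" for x
    using that i arr_zero[OF V i] by (auto simp: socle_at_def split: if_splits)
  with 0 show "arr V i ` socle_at n t V i \<subseteq> socle_at n t V (i + 1)" by auto
qed (use subspace_socle_at[OF V] in \<open>auto simp: socle_at_def\<close>)

lemma socle_at_iso_simple_power: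
  fixes V :: "'r::field rep"
  assumes V: "is_rep n V" and t: "t \<in> {1..n}"
  obtains m where "rep_iso n (sub_rep V (socle_at n t V)) (simple_power t m) \<noteq> {}"
proof -
  let ?S = "\<lambda>i. space V i\<lparr>carrier := socle_at n t V i\<rparr>"
  interpret T: vectorspace class_ring "space V t" using V t by (rule is_repD)
  have S: "vectorspace class_ring (?S t)" "vectorspace.fin_dim class_ring (?S t)"
    using subspace_socle_at[OF V t, of t] is_repD(2)[OF V t]
    by (auto intro: T.subspace_is_vs subspace_fin_dim)
  obtain m f where f: "f \<in> lin_hom (?S t) (module_vec TYPE('r) m)"
    "bij_betw f (carrier (?S t)) (carrier_vec m)"
    using S by (rule coordinates_exist)
  \<comment> \<open>At the vertices other than t both spaces have a single element, so only the
    coordinates at t carry information.\<close>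
  define \<phi> where "\<phi> i = (if i = t then f else (\<lambda>x. 0\<^sub>v 0))" for i
  have f0: "f \<zero>\<^bsub>space V t\<^esub> = 0\<^sub>v m"
    using lin_hom_zero[OF S(1) vec_vs f(1)] by (simp add: module_vec_simps)
  have arr0: "arr V i x = \<zero>\<^bsub>space V (Suc i)\<^esub>" if "i \<in> {1..<n}" "x \<in> socle_at n t V i" for i x
    using that arr_zero[OF V that(1)] by (auto simp: socle_at_def split: if_splits)
  have "\<phi> \<in> rep_iso n (sub_rep V (socle_at n t V)) (simple_power t m)"
    unfolding rep_iso_def rep_hom_def
  proof (safe)
    fix i assume i: "i \<in> {1..n}"
    show "\<phi> i \<in> lin_hom (space (sub_rep V (socle_at n t V)) i) (space (simple_power t m) i)"
    proof (cases "i = t")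
      case True
      then show ?thesis using f by (simp add: \<phi>_def sub_rep_def simple_power_def)
    next
      case False
      then show ?thesis
        by (intro lin_homI) (auto simp: \<phi>_def simple_power_def module_vec_simps)
    qed
    show "bij_betw (\<phi> i) (carrier (space (sub_rep V (socle_at n t V)) i)) (carrier (space (simple_power t m) i))"
    proof (cases "i = t")
      case True
      then show ?thesis using f by (simp add: \<phi>_def sub_rep_def simple_power_def module_vec_simps)
    next
      case False
      then show ?thesis using i
        by (auto simp: \<phi>_def simple_power_def module_vec_simps sub_rep_def socle_at_def bij_betw_def)
    qed
  next
    fix i x assume i: "i \<in> {1..<n}" and x: "x \<in> carrier (space (sub_rep V (socle_at n t V)) i)"
    then have "arr V i x = \<zero>\<^bsub>space V (Suc i)\<^esub>" using arr0[OF i] by (simp add: sub_rep_def)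
    then show "\<phi> (i + 1) (arr (sub_rep V (socle_at n t V)) i x) = arr (simple_power t m) i (\<phi> i x)"
      using f0 by (simp add: sub_rep_def simple_power_def \<phi>_def)
  qed
  then show thesis using that by blast
qed

text \<open>The isomorphism makes U trivial at all vertices except t. The arrow out of t maps U into
  the trivial space at \<open>Suc t\<close>, so U at t lies in the kernel of this arrow.\<close>

lemma simple_power_submod_le_socle_at:
  assumes V: "is_rep n V" and t: "t \<in> {1..n}" and U: "is_submod n V U"
    and iso: "rep_iso n (sub_rep V U) (simple_power t m) \<noteq> {}"
  shows "U \<le> socle_at n t V"
proof (rule le_funI)
  fix i
  from iso obtain \<phi> where \<phi>: "\<phi> \<in> rep_iso n (sub_rep V U) (simple_power t m)" by auto
  have triv: "U i = {\<zero>\<^bsub>space V i\<^esub>}" if "i \<in> {1..n}" "i \<noteq> t" for i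
  proof -
    have "bij_betw (\<phi> i) (U i) (carrier_vec 0)"
    proof -
      have "bij_betw (\<phi> i) (carrier (space (sub_rep V U) i)) (carrier (space (simple_power t m) i))"
        using \<phi> that(1) by (simp add: rep_iso_def)
      with that(2) show ?thesis by (simp add: sub_rep_def simple_power_def module_vec_simps)
    qed
    then have inj: "inj_on (\<phi> i) (U i)" and img: "\<phi> i ` U i \<subseteq> {0\<^sub>v 0}"
      by (auto simp: bij_betw_def)
    have zero: "\<zero>\<^bsub>space V i\<^esub> \<in> U i"
      using is_submodD(1)[OF U that(1)] by (rule subspace_contains_zero)
    have "x = \<zero>\<^bsub>space V i\<^esub>" if "x \<in> U i" for x
    proof (rule inj_onD[OF inj])
      show "\<phi> i x = \<phi> i \<zero>\<^bsub>space V i\<^esub>" 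
        using subsetD[OF img imageI[OF that]] subsetD[OF img imageI[OF zero]] by simp
    qed (rule that zero)+
    then have "U i \<subseteq> {\<zero>\<^bsub>space V i\<^esub>}" by (simp add: subset_iff)
    moreover have "{\<zero>\<^bsub>space V i\<^esub>} \<subseteq> U i" using zero by simp
    ultimately show ?thesis by (rule subset_antisym)
  qed
  show "U i \<subseteq> socle_at n t V i"
  proof (cases "i \<in> {1..n}")
    case True
    show ?thesis
    proof (cases "i = t")
      case it: True
      have "U t \<subseteq> carrier (space V t)" using is_submodD(1)[OF U t] by (rule subspace_subset)
      moreover have "arr V t x = \<zero>\<^bsub>space V (Suc t)\<^esub>" if "t < n" "x \<in> U t" for x
        using is_submodD(2)[OF U, of t x] triv[of "Suc t"] that t by auto
      ultimately show ?thesis using it t by (auto simp: socle_at_def)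
    next
      case False
      then show ?thesis using triv True by (simp add: socle_at_def)
    qed
  next
    case False
    then show ?thesis using U by (simp add: is_submod_def)
  qed
qed

lemma trace_submod_eq_socle_at:
  assumes "is_rep n V" "t \<in> {1..n}"
  shows "trace_submod n t V = socle_at n t V"
  unfolding trace_submod_def
proof (rule Greatest_equality)
  show "is_submod n V (socle_at n t V) \<and>
    (\<exists>m. rep_iso n (sub_rep V (socle_at n t V)) (simple_power t m) \<noteq> {})"
    using is_submod_socle_at[OF assms(1)] socle_at_iso_simple_power[OF assms] by blast
qed (use simple_power_submod_le_socle_at[OF assms] in blast)

section \<open>Composites of projection functors\<close>

definition word_functor :: "nat \<Rightarrow> nat list \<Rightarrow> 'r::field endofunctor" where
  "word_functor n w = foldr (\<lambda>t F. comp_functor (proj_functor n t) F) w id_functor"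

lemma word_functor_Nil [simp]: "word_functor n [] = id_functor"
  by (simp add: word_functor_def)

lemma word_functor_Cons:
  "word_functor n (t # w) = comp_functor (proj_functor n t) (word_functor n w)"
  by (simp add: word_functor_def)

lemma ob_word_functor_Cons:
  "ob (word_functor n (t # w)) V =
     quot_rep (ob (word_functor n w) V) (trace_submod n t (ob (word_functor n w) V))"
  by (simp add: word_functor_Cons comp_functor_def proj_functor_def)

lemma ob_id_functor [simp]: "ob id_functor V = V"
  by (simp add: id_functor_def)

text \<open>The composite of the successive quotient maps, that is, the natural epimorphism from V
  onto the value of the word functor at V.\<close>

primrec canon :: "nat \<Rightarrow> nat list \<Rightarrow> 'r::field rep \<Rightarrow> nat \<Rightarrow> 'r vec \<Rightarrow> 'r vec" where
  "canon n [] V i x = x"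
| "canon n (t # w) V i x =
     coset_rep (space (ob (word_functor n w) V) i)
       (trace_submod n t (ob (word_functor n w) V) i) (canon n w V i x)"

primrec path :: "'r rep \<Rightarrow> nat \<Rightarrow> nat \<Rightarrow> 'r vec \<Rightarrow> 'r vec" where
  "path V i 0 x = x"
| "path V i (Suc d) x = path V (Suc i) d (arr V i x)"

text \<open>The target \<open>Suc n\<close> stands for the zero space.\<close>

definition vanishes :: "nat \<Rightarrow> 'r rep \<Rightarrow> nat \<Rightarrow> nat \<Rightarrow> 'r vec \<Rightarrow> bool" where
  "vanishes n V i j x \<longleftrightarrow> (j \<le> n \<longrightarrow> path V i (j - i) x = \<zero>\<^bsub>space V j\<^esub>)"

lemma path_closed:
  assumes "is_rep n V" "1 \<le> i" "i + d \<le> n" "x \<in> carrier (space V i)"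
  shows "path V i d x \<in> carrier (space V (i + d))"
  using assms
proof (induction d arbitrary: i x)
  case (Suc d)
  have "arr V i \<in> lin_hom (space V i) (space V (Suc i))" using Suc.prems by (intro is_repD(3)) auto
  then have "arr V i x \<in> carrier (space V (Suc i))" using Suc.prems(4) by (rule lin_hom_closed)
  then show ?case using Suc.IH[of "Suc i" "arr V i x"] Suc.prems by simp
qed simp

lemma path_natural:
  assumes "\<phi> \<in> rep_hom n V W" "is_rep n V" "1 \<le> i" "i + d \<le> n" "x \<in> carrier (space V i)"
  shows "\<phi> (i + d) (path V i d x) = path W i d (\<phi> i x)"
  using assms
proof (induction d arbitrary: i x)
  case (Suc d)
  have i: "i \<in> {1..<n}" using Suc.prems by auto
  have "arr V i x \<in> carrier (space V (Suc i))"
    using is_repD(3)[OF Suc.prems(2) i] Suc.prems(5) by (rule lin_hom_closed)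
  then show ?case
    using Suc.IH[of "Suc i" "arr V i x"] Suc.prems rep_homD(2)[OF Suc.prems(1) i Suc.prems(5)] by simp
qed simp

text \<open>All facts go through one induction: the kernel of the outermost quotient is a socle
  inside the value of the inner word, and computing it there requires that this value is a
  representation whose arrows commute with \<open>canon\<close>. The last fact identifies the kernel
  of \<open>canon\<close> with that of a structure map of V.\<close>

lemma word_functor_canon:
  fixes V :: "'r::field rep"
  assumes V: "is_rep n V" and w: "set w \<subseteq> {1..n}"
  defines "F \<equiv> ob (word_functor n w) V"
  shows "is_rep n F"
    and "\<And>i. i \<in> {1..n} \<Longrightarrow> canon n w V i \<in> lin_hom (space V i) (space F i)"
    and "\<And>i. i \<in> {1..n} \<Longrightarrow> canon n w V i ` carrier (space V i) = carrier (space F i)"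
    and "\<And>i x. i \<in> {1..<n} \<Longrightarrow> x \<in> carrier (space V i) \<Longrightarrow>
      arr F i (canon n w V i x) = canon n w V (Suc i) (arr V i x)"
    and "\<And>i x. i \<in> {1..n} \<Longrightarrow> x \<in> carrier (space V i) \<Longrightarrow>
      canon n w V i x = \<zero>\<^bsub>space F i\<^esub> \<longleftrightarrow> vanishes n V i (route w i) x"
proof -
  have "is_rep n (ob (word_functor n w) V) \<and>
    (\<forall>i\<in>{1..n}. canon n w V i \<in> lin_hom (space V i) (space (ob (word_functor n w) V) i) \<and>
      canon n w V i ` carrier (space V i) = carrier (space (ob (word_functor n w) V) i)) \<and>
    (\<forall>i\<in>{1..<n}. \<forall>x\<in>carrier (space V i).
      arr (ob (word_functor n w) V) i (canon n w V i x) = canon n w V (Suc i) (arr V i x)) \<and>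
    (\<forall>i\<in>{1..n}. \<forall>x\<in>carrier (space V i).
      canon n w V i x = \<zero>\<^bsub>space (ob (word_functor n w) V) i\<^esub> \<longleftrightarrow> vanishes n V i (route w i) x)"
    using w
  proof (induction w)
    case Nil
    show ?case using V by (auto simp: vanishes_def LinearCombinations.module_hom_def)
  next
    case (Cons t w)
    let ?G = "ob (word_functor n w) V" and ?G' = "ob (word_functor n (t # w)) V"
    let ?U = "trace_submod n t ?G"
    let ?q = "\<lambda>i. coset_rep (space ?G i) (?U i)"
    have t: "t \<in> {1..n}" and w: "set w \<subseteq> {1..n}" using Cons.prems by auto
    note IH = Cons.IH[OF w]
    have G: "is_rep n ?G" using IH by blast
    have U: "?U = socle_at n t ?G" using G t by (rule trace_submod_eq_socle_at)
    have sub: "is_submod n ?G ?U" unfolding U using G by (rule is_submod_socle_at)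
    have G': "?G' = quot_rep ?G ?U" by (rule ob_word_functor_Cons)
    have canon: "canon n (t # w) V i x = ?q i (canon n w V i x)" for i x by simp
    have hom: "canon n w V i \<in> lin_hom (space V i) (space ?G i)" if "i \<in> {1..n}" for i
      using IH that by blast
    have surj: "canon n w V i ` carrier (space V i) = carrier (space ?G i)" if "i \<in> {1..n}" for i
      using IH that by blast
    have arr: "arr ?G i (canon n w V i x) = canon n w V (Suc i) (arr V i x)"
      if "i \<in> {1..<n}" "x \<in> carrier (space V i)" for i x using IH that by blast
    have ker: "canon n w V i x = \<zero>\<^bsub>space ?G i\<^esub> \<longleftrightarrow> vanishes n V i (route w i) x"
      if "i \<in> {1..n}" "x \<in> carrier (space V i)" for i x using IH that by blast
    have closed: "canon n w V i x \<in> carrier (space ?G i)"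
      if "i \<in> {1..n}" "x \<in> carrier (space V i)" for i x
      using hom[OF that(1)] that(2) by (rule lin_hom_closed)
    have q: "?q i \<in> lin_hom (space ?G i) (space ?G' i)" if "i \<in> {1..n}" for i
      unfolding G' quot_rep_simps using is_submodD(1)[OF sub that] by (rule coset_rep_hom)
    show ?case
    proof (intro conjI ballI)
      show "is_rep n ?G'" unfolding G' using G sub by (rule is_rep_quot_rep)
    next
      fix i assume i: "i \<in> {1..n}"
      show "canon n (t # w) V i \<in> lin_hom (space V i) (space ?G' i)"
      proof (rule lin_homI)
        fix x assume x: "x \<in> carrier (space V i)"
        show "canon n (t # w) V i x \<in> carrier (space ?G' i)"
          unfolding canon by (rule lin_hom_closed[OF q[OF i] closed[OF i x]])
        show "canon n (t # w) V i (c \<odot>\<^bsub>space V i\<^esub> x) = c \<odot>\<^bsub>space ?G' i\<^esub> canon n (t # w) V i x" for c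
          unfolding canon lin_hom_smult[OF hom[OF i] x] by (rule lin_hom_smult[OF q[OF i] closed[OF i x]])
        fix y assume y: "y \<in> carrier (space V i)"
        show "canon n (t # w) V i (x \<oplus>\<^bsub>space V i\<^esub> y) =
            canon n (t # w) V i x \<oplus>\<^bsub>space ?G' i\<^esub> canon n (t # w) V i y"
          unfolding canon lin_hom_add[OF hom[OF i] x y]
          by (rule lin_hom_add[OF q[OF i] closed[OF i x] closed[OF i y]])
      qed
      have "canon n (t # w) V i ` carrier (space V i) = ?q i ` (canon n w V i ` carrier (space V i))"
        by (simp add: image_image)
      also have "\<dots> = carrier (space ?G' i)"
        unfolding surj[OF i] G' quot_rep_simps by (simp add: quot_space_def)
      finally show "canon n (t # w) V i ` carrier (space V i) = carrier (space ?G' i)" .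
    next
      fix i x assume i: "i \<in> {1..<n}" and x: "x \<in> carrier (space V i)"
      then have i': "i \<in> {1..n}" by auto
      show "arr ?G' i (canon n (t # w) V i x) = canon n (t # w) V (Suc i) (arr V i x)"
        unfolding canon G' coset_rep_arr[OF G sub i closed[OF i' x]] arr[OF i x] ..
    next
      fix i x assume i: "i \<in> {1..n}" and x: "x \<in> carrier (space V i)"
      have "canon n (t # w) V i x = \<zero>\<^bsub>space ?G' i\<^esub> \<longleftrightarrow> canon n w V i x \<in> ?U i"
        unfolding canon G' quot_rep_simps
        using is_submodD(1)[OF sub i] closed[OF i x] by (rule coset_rep_eq_zero_iff)
      also have "\<dots> \<longleftrightarrow> vanishes n V i (route (t # w) i) x"
      proof (cases "i = t")
        case False
        then have "canon n w V i x \<in> ?U i \<longleftrightarrow> canon n w V i x = \<zero>\<^bsub>space ?G i\<^esub>"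
          using i by (simp add: U socle_at_def)
        then show ?thesis using ker[OF i x] False by (simp add: bump_def)
      next
        case it: True
        show ?thesis
        proof (cases "t < n")
          case True
          then have Suc: "i \<in> {1..<n}" "Suc i \<in> {1..n}" using it i by auto
          have ax: "arr V i x \<in> carrier (space V (Suc i))"
            using is_repD(3)[OF V Suc(1)] x by (rule lin_hom_closed)
          \<comment> \<open>The new kernel at t is the preimage under the arrow of the old kernel at
            \<open>Suc t\<close>. This is the origin of \<open>bump\<close>.\<close>
          have "canon n w V i x \<in> ?U i \<longleftrightarrow> arr ?G i (canon n w V i x) = \<zero>\<^bsub>space ?G (Suc i)\<^esub>"
            using i it True closed[OF i x] by (simp add: U socle_at_def)
          also have "\<dots> \<longleftrightarrow> vanishes n V (Suc i) (route w (Suc i)) (arr V i x)"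
            unfolding arr[OF Suc(1) x] by (rule ker[OF Suc(2) ax])
          also have "\<dots> \<longleftrightarrow> vanishes n V i (route w (Suc i)) x"
          proof -
            \<comment> \<open>The target is at least \<open>Suc i\<close>, so the truncated
              differences count honest path lengths, and the path from i has one arrow more.\<close>
            have "route w (Suc i) - i = Suc (route w (Suc i) - Suc i)"
              using route_ge[of "Suc i" w] by simp
            then show ?thesis by (simp add: vanishes_def)
          qed
          finally show ?thesis using it by (simp add: bump_def)
        next
          case False
          \<comment> \<open>For t = n the trace is the whole space, and the target
            \<open>Suc n\<close> makes \<open>vanishes\<close> true of every element.\<close>
          then have "canon n w V i x \<in> ?U i"
            unfolding U using i it t closed[OF i x] by (simp add: socle_at_def)
          moreover have "route (t # w) i = Suc n"
            using False it t route_fixed[OF w, of "Suc n"] by (simp add: bump_def)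
          ultimately show ?thesis by (simp add: vanishes_def)
        qed
      qed
      finally show "canon n (t # w) V i x = \<zero>\<^bsub>space ?G' i\<^esub> \<longleftrightarrow> vanishes n V i (route (t # w) i) x" .
    qed
  qed
  then show "is_rep n F"
    and "\<And>i. i \<in> {1..n} \<Longrightarrow> canon n w V i \<in> lin_hom (space V i) (space F i)"
    and "\<And>i. i \<in> {1..n} \<Longrightarrow> canon n w V i ` carrier (space V i) = carrier (space F i)"
    and "\<And>i x. i \<in> {1..<n} \<Longrightarrow> x \<in> carrier (space V i) \<Longrightarrow>
      arr F i (canon n w V i x) = canon n w V (Suc i) (arr V i x)"
    and "\<And>i x. i \<in> {1..n} \<Longrightarrow> x \<in> carrier (space V i) \<Longrightarrow>
      canon n w V i x = \<zero>\<^bsub>space F i\<^esub> \<longleftrightarrow> vanishes n V i (route w i) x"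
    unfolding F_def by blast+
qed

lemma canon_eq_iff:
  assumes V: "is_rep n V" and w: "set w \<subseteq> {1..n}" and i: "i \<in> {1..n}"
    and xy: "x \<in> carrier (space V i)" "y \<in> carrier (space V i)"
  shows "canon n w V i x = canon n w V i y \<longleftrightarrow> vanishes n V i (route w i) (x \<ominus>\<^bsub>space V i\<^esub> y)"
proof -
  interpret V: vectorspace class_ring "space V i" by (rule is_repD(1)[OF V i])
  have "x \<ominus>\<^bsub>space V i\<^esub> y \<in> carrier (space V i)" using xy by simp
  then show ?thesis
    using lin_hom_eq_iff[OF is_repD(1)[OF V i] is_repD(1)[OF word_functor_canon(1)[OF V w] i]
        word_functor_canon(2)[OF V w i] xy] word_functor_canon(5)[OF V w i] by simp
qed

text \<open>A morphism commutes with the structure maps, so it carries the kernel of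
  \<open>canon\<close> for V into the kernel of \<open>canon\<close> for W.\<close>

lemma canon_natural:
  assumes V: "is_rep n V" and W: "is_rep n W" and \<phi>: "\<phi> \<in> rep_hom n V W"
    and w: "set w \<subseteq> {1..n}" and i: "i \<in> {1..n}"
    and xy: "x \<in> carrier (space V i)" "y \<in> carrier (space V i)"
    and eq: "canon n w V i x = canon n w V i y"
  shows "canon n w W i (\<phi> i x) = canon n w W i (\<phi> i y)"
proof -
  interpret V: vectorspace class_ring "space V i" by (rule is_repD(1)[OF V i])
  let ?z = "x \<ominus>\<^bsub>space V i\<^esub> y" and ?j = "route w i"
  have hom: "\<phi> i \<in> lin_hom (space V i) (space W i)" using \<phi> i by (rule rep_homD)
  have z: "?z \<in> carrier (space V i)" using xy by simp
  have "vanishes n W i ?j (\<phi> i ?z)"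
    unfolding vanishes_def
  proof
    assume j: "?j \<le> n"
    have ij: "i + (?j - i) = ?j" "1 \<le> i" "?j \<in> {1..n}" using route_ge[of i w] i j by auto
    have "path V i (?j - i) ?z = \<zero>\<^bsub>space V ?j\<^esub>"
      using eq canon_eq_iff[OF V w i xy] j by (simp add: vanishes_def)
    then have "path W i (?j - i) (\<phi> i ?z) = \<phi> ?j \<zero>\<^bsub>space V ?j\<^esub>"
      using path_natural[OF \<phi> V ij(2) _ z, of "?j - i"] ij j by simp
    also have "\<dots> = \<zero>\<^bsub>space W ?j\<^esub>"
      using is_repD(1)[OF V ij(3)] is_repD(1)[OF W ij(3)] rep_homD(1)[OF \<phi> ij(3)]
      by (rule lin_hom_zero)
    finally show "path W i (?j - i) (\<phi> i ?z) = \<zero>\<^bsub>space W ?j\<^esub>" .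
  qed
  also have "\<phi> i ?z = \<phi> i x \<ominus>\<^bsub>space W i\<^esub> \<phi> i y"
    using is_repD(1)[OF V i] is_repD(1)[OF W i] hom xy by (rule lin_hom_diff)
  finally show ?thesis
    using canon_eq_iff[OF W w i] lin_hom_closed[OF hom] xy by blast
qed

text \<open>The outer functor acts on the chosen representative, which is the \<open>canon\<close>
  image under the inner word of some y in place of x. Since choosing representatives is idempotent,
  x and y have the same image under the full word, and \<open>canon_natural\<close> removes the
  difference.\<close>

lemma mor_word_functor:
  assumes V: "is_rep n V" and W: "is_rep n W" and \<phi>: "\<phi> \<in> rep_hom n V W"
    and w: "set w \<subseteq> {1..n}" and i: "i \<in> {1..n}" and x: "x \<in> carrier (space V i)"
  shows "mor (word_functor n w) V W \<phi> i (canon n w V i x) = canon n w W i (\<phi> i x)"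
  using w x
proof (induction w arbitrary: x)
  case Nil
  then show ?case by (simp add: id_functor_def)
next
  case (Cons t w)
  let ?G = "ob (word_functor n w) V"
  have t: "t \<in> {1..n}" and w: "set w \<subseteq> {1..n}" using Cons.prems by auto
  have G: "is_rep n ?G" using V w by (rule word_functor_canon)
  have "trace_submod n t ?G = socle_at n t ?G" using G t by (rule trace_submod_eq_socle_at)
  then have sub: "subspace class_ring (trace_submod n t ?G i) (space ?G i)"
    using subspace_socle_at[OF G i] by simp
  have cx: "canon n w V i x \<in> carrier (space ?G i)"
    using word_functor_canon(2)[OF V w i] Cons.prems(2) by (rule lin_hom_closed)
  let ?z = "canon n (t # w) V i x"
  have "?z \<in> carrier (space ?G i)"
    using sub cx unfolding canon.simps by (rule coset_rep_closed)
  then obtain y where y: "y \<in> carrier (space V i)" "?z = canon n w V i y"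
    using word_functor_canon(3)[OF V w i] by auto
  have "canon n (t # w) V i y = coset_rep (space ?G i) (trace_submod n t ?G i) ?z"
    unfolding y(2) by simp
  also have "\<dots> = ?z" unfolding canon.simps using sub cx by (rule coset_rep_idem)
  finally have yx: "canon n (t # w) V i y = canon n (t # w) V i x" .
  have "mor (word_functor n (t # w)) V W \<phi> i ?z =
      coset_rep (space (ob (word_functor n w) W) i) (trace_submod n t (ob (word_functor n w) W) i)
        (mor (word_functor n w) V W \<phi> i ?z)"
    by (simp only: word_functor_Cons comp_functor_def proj_functor_def endofunctor.simps)
  also have "mor (word_functor n w) V W \<phi> i ?z = canon n w W i (\<phi> i y)"
    unfolding y(2) using w y(1) by (rule Cons.IH)
  also have "coset_rep (space (ob (word_functor n w) W) i) (trace_submod n t (ob (word_functor n w) W) i)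
      (canon n w W i (\<phi> i y)) = canon n (t # w) W i (\<phi> i y)"
    by simp
  also have "\<dots> = canon n (t # w) W i (\<phi> i x)"
    by (rule canon_natural[OF V W \<phi> Cons.prems(1) i y(1) Cons.prems(2) yx])
  finally show ?case .
qed

text \<open>At every vertex both functors are quotients of the same space, with kernels determined
  by the route alone. Equal routes give equal kernels, and sending one canonical image of x to the
  other is a well-defined isomorphism.\<close>

lemma nat_iso_word_functor:
  fixes u v :: "nat list"
  assumes u: "set u \<subseteq> {1..n}" and v: "set v \<subseteq> {1..n}" and uv: "route u = route v"
  shows "nat_iso n (word_functor n u :: 'r::field endofunctor) (word_functor n v)"
proof -
  define \<eta> :: "'r rep \<Rightarrow> 'r rep_map" where
    "\<eta> V i y = canon n v V i (SOME x. x \<in> carrier (space V i) \<and> canon n u V i x = y)" for V i y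
  have eq_iff: "canon n u V i x = canon n u V i y \<longleftrightarrow> canon n v V i x = canon n v V i y"
    if "is_rep n V" "i \<in> {1..n}" "x \<in> carrier (space V i)" "y \<in> carrier (space V i)"
    for V :: "'r rep" and i x y
    using canon_eq_iff[OF that(1) u that(2-4)] canon_eq_iff[OF that(1) v that(2-4)] uv by simp
  have \<eta>: "\<eta> V i (canon n u V i x) = canon n v V i x"
    if "is_rep n V" "i \<in> {1..n}" "x \<in> carrier (space V i)" for V i x
  proof -
    let ?y = "SOME y. y \<in> carrier (space V i) \<and> canon n u V i y = canon n u V i x"
    have "?y \<in> carrier (space V i) \<and> canon n u V i ?y = canon n u V i x"
      using that(3) by (intro someI[of "\<lambda>y. y \<in> _ \<and> canon n u V i y = _"]) auto
    then show ?thesis using eq_iff[OF that(1,2)] that(3) unfolding \<eta>_def by blast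
  qed
  have iso: "\<eta> V \<in> rep_iso n (ob (word_functor n u) V) (ob (word_functor n v) V)"
    if V: "is_rep n V" for V
    unfolding rep_iso_def rep_hom_def
  proof safe
    note hu = word_functor_canon(2)[OF V u] and hv = word_functor_canon(2)[OF V v]
    note su = word_functor_canon(3)[OF V u] and sv = word_functor_canon(3)[OF V v]
    fix i assume i: "i \<in> {1..n}"
    interpret V: vectorspace class_ring "space V i" by (rule is_repD(1)[OF V i])
    show "\<eta> V i \<in> lin_hom (space (ob (word_functor n u) V) i) (space (ob (word_functor n v) V) i)"
    proof (rule lin_homI)
      fix a assume "a \<in> carrier (space (ob (word_functor n u) V) i)"
      then obtain x where x: "x \<in> carrier (space V i)" "a = canon n u V i x"
        using su[OF i] by auto
      then show "\<eta> V i a \<in> carrier (space (ob (word_functor n v) V) i)"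
        using \<eta>[OF V i] lin_hom_closed[OF hv[OF i]] by simp
      show "\<eta> V i (c \<odot>\<^bsub>space (ob (word_functor n u) V) i\<^esub> a) =
          c \<odot>\<^bsub>space (ob (word_functor n v) V) i\<^esub> \<eta> V i a" for c
        unfolding x(2) lin_hom_smult[OF hu[OF i] x(1), symmetric] using x(1)
        by (simp add: \<eta>[OF V i] lin_hom_smult[OF hv[OF i]])
      fix b assume "b \<in> carrier (space (ob (word_functor n u) V) i)"
      then obtain y where y: "y \<in> carrier (space V i)" "b = canon n u V i y"
        using su[OF i] by auto
      show "\<eta> V i (a \<oplus>\<^bsub>space (ob (word_functor n u) V) i\<^esub> b) =
          \<eta> V i a \<oplus>\<^bsub>space (ob (word_functor n v) V) i\<^esub> \<eta> V i b"
        unfolding x(2) y(2) lin_hom_add[OF hu[OF i] x(1) y(1), symmetric] using x(1) y(1)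
        by (simp add: \<eta>[OF V i] lin_hom_add[OF hv[OF i]])
    qed
    show "bij_betw (\<eta> V i) (carrier (space (ob (word_functor n u) V) i))
        (carrier (space (ob (word_functor n v) V) i))"
    proof (rule bij_betw_imageI)
      show "inj_on (\<eta> V i) (carrier (space (ob (word_functor n u) V) i))"
        unfolding su[OF i, symmetric] inj_on_def using \<eta>[OF V i] eq_iff[OF V i] by auto
      show "\<eta> V i ` carrier (space (ob (word_functor n u) V) i) = carrier (space (ob (word_functor n v) V) i)"
        unfolding su[OF i, symmetric] sv[OF i, symmetric] image_image
        by (rule image_cong[OF refl]) (rule \<eta>[OF V i])
    qed
  next
    fix i y assume i: "i \<in> {1..<n}" and "y \<in> carrier (space (ob (word_functor n u) V) i)"
    then have i': "i \<in> {1..n}" "Suc i \<in> {1..n}" by auto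
    with \<open>y \<in> _\<close> obtain x where x: "x \<in> carrier (space V i)" "y = canon n u V i x"
      using word_functor_canon(3)[OF V u i'(1)] by auto
    have ax: "arr V i x \<in> carrier (space V (Suc i))"
      using is_repD(3)[OF V i] x(1) by (rule lin_hom_closed)
    show "\<eta> V (i + 1) (arr (ob (word_functor n u) V) i y) = arr (ob (word_functor n v) V) i (\<eta> V i y)"
      unfolding x(2) word_functor_canon(4)[OF V u i x(1)] \<eta>[OF V i'(1) x(1)]
        word_functor_canon(4)[OF V v i x(1)]
      using \<eta>[OF V i'(2) ax] by simp
  qed
  have nat: "\<eta> W i (mor (word_functor n u) V W \<phi> i y) = mor (word_functor n v) V W \<phi> i (\<eta> V i y)"
    if V: "is_rep n V" and W: "is_rep n W" and \<phi>: "\<phi> \<in> rep_hom n V W" and i: "i \<in> {1..n}"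
      and y: "y \<in> carrier (space (ob (word_functor n u) V) i)" for V W \<phi> i y
  proof -
    obtain x where x: "x \<in> carrier (space V i)" "y = canon n u V i x"
      using y word_functor_canon(3)[OF V u i] by auto
    have "\<phi> i x \<in> carrier (space W i)" using rep_homD(1)[OF \<phi> i] x(1) by (rule lin_hom_closed)
    then show ?thesis
      by (simp add: x \<eta>[OF V i] \<eta>[OF W i] mor_word_functor[OF V W \<phi> u i] mor_word_functor[OF V W \<phi> v i])
  qed
  show ?thesis unfolding nat_iso_def using iso nat by blast
qed

section \<open>Separating routes by interval representations\<close>

definition chain_rep :: "nat \<Rightarrow> 'r::field rep" where
  "chain_rep j = \<lparr>space = \<lambda>i. module_vec TYPE('r) (if i \<le> j then 1 else 0),
     arr = \<lambda>i x. if Suc i \<le> j then x else 0\<^sub>v 0\<rparr>"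

lemma is_rep_chain_rep: "is_rep n (chain_rep j :: 'r::field rep)"
  unfolding is_rep_def
proof (intro conjI ballI)
  fix i
  show "vectorspace class_ring (space (chain_rep j :: 'r rep) i)"
    by (simp add: chain_rep_def vec_vs)
  show "vectorspace.fin_dim class_ring (space (chain_rep j :: 'r rep) i)"
    using vec_space.fin_dim[where 'a='r] by (simp add: chain_rep_def)
  show "arr (chain_rep j) i \<in> lin_hom (space (chain_rep j :: 'r rep) i) (space (chain_rep j) (i + 1))"
    by (rule lin_homI) (auto simp: chain_rep_def module_vec_simps)
qed

lemma path_chain_rep: "i + d \<le> j \<Longrightarrow> path (chain_rep j) i d x = x"
  by (induction d arbitrary: i) (auto simp: chain_rep_def)

text \<open>Up to vertex j the path is the identity, so the unit vector survives; beyond j the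
  spaces are zero, and k = \<open>Suc n\<close> counts as zero by the convention of
  \<open>vanishes\<close>.\<close>

lemma vanishes_chain_rep:
  assumes "1 \<le> i" "i \<le> j" "j \<le> n" "i \<le> k"
  shows "(\<forall>x\<in>carrier (space (chain_rep j :: 'r::field rep) i). vanishes n (chain_rep j) i k x) \<longleftrightarrow> j < k"
proof
  assume *: "\<forall>x\<in>carrier (space (chain_rep j :: 'r rep) i). vanishes n (chain_rep j) i k x"
  let ?x = "unit_vec 1 0 :: 'r vec"
  show "j < k"
  proof (rule ccontr)
    assume "\<not> j < k"
    then have "path (chain_rep j) i (k - i) ?x = ?x" using assms by (intro path_chain_rep) auto
    moreover have "?x \<in> carrier (space (chain_rep j :: 'r rep) i)"
      using assms by (simp add: chain_rep_def module_vec_simps)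
    ultimately have "?x = \<zero>\<^bsub>space (chain_rep j :: 'r rep) k\<^esub>"
      using * \<open>\<not> j < k\<close> assms by (auto simp: vanishes_def)
    then have "?x = 0\<^sub>v 1" using \<open>\<not> j < k\<close> by (simp add: chain_rep_def module_vec_simps)
    then have "?x $ 0 = 0\<^sub>v 1 $ 0" by simp
    then show False by simp
  qed
next
  assume "j < k"
  show "\<forall>x\<in>carrier (space (chain_rep j :: 'r rep) i). vanishes n (chain_rep j) i k x"
  proof
    fix x :: "'r vec" assume x: "x \<in> carrier (space (chain_rep j) i)"
    show "vanishes n (chain_rep j) i k x"
      unfolding vanishes_def
    proof
      assume "k \<le> n"
      then have "path (chain_rep j) i (k - i) x \<in> carrier (space (chain_rep j) (i + (k - i)))"
        using is_rep_chain_rep x assms by (intro path_closed) auto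
      moreover have "i + (k - i) = k" "\<not> k \<le> j" using assms(4) \<open>j < k\<close> by simp_all
      ultimately have "path (chain_rep j) i (k - i) x \<in> carrier_vec 0"
        by (simp add: chain_rep_def module_vec_simps)
      then have "path (chain_rep j) i (k - i) x = 0\<^sub>v 0" by (intro eq_vecI) auto
      then show "path (chain_rep j) i (k - i) x = \<zero>\<^bsub>space (chain_rep j) k\<^esub>"
        using \<open>\<not> k \<le> j\<close> by (simp add: chain_rep_def module_vec_simps)
    qed
  qed
qed

lemma rep_iso_trivial_iff:
  assumes \<phi>: "\<phi> \<in> rep_iso n V W" and V: "is_rep n V" and W: "is_rep n W" and i: "i \<in> {1..n}"
  shows "carrier (space V i) = {\<zero>\<^bsub>space V i\<^esub>} \<longleftrightarrow> carrier (space W i) = {\<zero>\<^bsub>space W i\<^esub>}"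
proof -
  interpret V: vectorspace class_ring "space V i" by (rule is_repD(1)[OF V i])
  have bij: "bij_betw (\<phi> i) (carrier (space V i)) (carrier (space W i))"
    using \<phi> i by (simp add: rep_iso_def)
  have "\<phi> \<in> rep_hom n V W" using \<phi> by (simp add: rep_iso_def)
  then have 0: "\<phi> i \<zero>\<^bsub>space V i\<^esub> = \<zero>\<^bsub>space W i\<^esub>"
    using is_repD(1)[OF V i] is_repD(1)[OF W i] rep_homD(1) i by (intro lin_hom_zero)
  have "carrier (space V i) = {\<zero>\<^bsub>space V i\<^esub>} \<longleftrightarrow>
      \<phi> i ` carrier (space V i) = \<phi> i ` {\<zero>\<^bsub>space V i\<^esub>}"
    using bij by (intro inj_on_image_eq_iff[symmetric, of _ "carrier (space V i)"])
      (auto simp: bij_betw_def)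
  then show ?thesis using bij 0 by (simp add: bij_betw_def)
qed

lemma image_eq_single_iff: "A \<noteq> {} \<Longrightarrow> f ` A = {z} \<longleftrightarrow> (\<forall>x\<in>A. f x = z)"
  by auto

text \<open>On the interval representation ending at j, the value at vertex i is zero iff j lies
  below the route of i. Isomorphic values therefore give the same comparisons for both
  routes.\<close>

lemma route_eq_if_nat_iso:
  assumes u: "set u \<subseteq> {1..n}" and v: "set v \<subseteq> {1..n}"
    and iso: "nat_iso n (word_functor n u :: 'r::field endofunctor) (word_functor n v)"
  shows "route u = route v"
proof
  fix i
  show "route u i = route v i"
  proof (cases "i \<in> {1..n}")
    case i: True
    have triv: "carrier (space (ob (word_functor n w) (chain_rep j :: 'r rep)) i) =
        {\<zero>\<^bsub>space (ob (word_functor n w) (chain_rep j :: 'r rep)) i\<^esub>} \<longleftrightarrow> j < route w i"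
      if w: "set w \<subseteq> {1..n}" and j: "i \<le> j" "j \<le> n" for w j
    proof -
      let ?V = "chain_rep j :: 'r rep"
      note V = is_rep_chain_rep[of n j, where 'r='r]
      interpret V: vectorspace class_ring "space ?V i" by (rule is_repD(1)[OF V i])
      have "carrier (space (ob (word_functor n w) ?V) i) = {\<zero>\<^bsub>space (ob (word_functor n w) ?V) i\<^esub>}
          \<longleftrightarrow> (\<forall>x\<in>carrier (space ?V i). canon n w ?V i x = \<zero>\<^bsub>space (ob (word_functor n w) ?V) i\<^esub>)"
        unfolding word_functor_canon(3)[OF V w i, symmetric] by (rule image_eq_single_iff) (use V.M.zero_closed in blast)
      also have "\<dots> \<longleftrightarrow> (\<forall>x\<in>carrier (space ?V i). vanishes n ?V i (route w i) x)"
        using word_functor_canon(5)[OF V w i] by blast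
      also have "\<dots> \<longleftrightarrow> j < route w i" using i j route_ge by (intro vanishes_chain_rep) auto
      finally show ?thesis .
    qed
    have less_iff: "j < route u i \<longleftrightarrow> j < route v i" if j: "i \<le> j" "j \<le> n" for j
    proof -
      note V = is_rep_chain_rep[of n j, where 'r='r]
      obtain \<eta> where "\<eta> \<in> rep_iso n (ob (word_functor n u) (chain_rep j :: 'r rep)) (ob (word_functor n v) (chain_rep j))"
        using iso V unfolding nat_iso_def by blast
      from rep_iso_trivial_iff[OF this word_functor_canon(1)[OF V u] word_functor_canon(1)[OF V v] i]
      show ?thesis using triv[OF u j] triv[OF v j] by blast
    qed
    \<comment> \<open>Both values lie between i and \<open>Suc n\<close>, so the tests with j from i
      to n determine them.\<close>
    have "route u i \<le> Suc n" "route v i \<le> Suc n" using route_le[OF u] route_le[OF v] i by auto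
    then show ?thesis
      using less_iff[of "route u i"] less_iff[of "route v i"] route_ge[of i u] route_ge[of i v]
      by (metis le_SucE less_irrefl less_Suc_eq_le linorder_neqE_nat)
  qed (simp add: route_fixed[OF u] route_fixed[OF v])
qed

section \<open>The monoid of isomorphism classes in terms of words\<close>

definition word_class :: "nat \<Rightarrow> nat list \<Rightarrow> 'r::field endofunctor set" where
  "word_class n w = nat_iso_rel n `` {word_functor n w}"

lemma comp_functor_assoc: "comp_functor (comp_functor F G) H = comp_functor F (comp_functor G H)"
  by (simp add: comp_functor_def)

lemma comp_functor_id [simp]: "comp_functor id_functor F = F" "comp_functor F id_functor = F"
  by (simp_all add: comp_functor_def id_functor_def)

lemma comp_word_functor: "comp_functor (word_functor n u) (word_functor n v) = word_functor n (u @ v)"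
  by (induction u) (simp_all add: word_functor_Cons comp_functor_assoc)

lemma proj_comps_eq: "proj_comps n = word_functor n ` {w. set w \<subseteq> {1..n}}"
  unfolding proj_comps_def word_functor_def by blast

lemma word_class_eq:
  assumes "set u \<subseteq> {1..n}"
  shows "word_class n u = word_functor n ` {v. set v \<subseteq> {1..n} \<and> route v = route u}"
proof -
  have "nat_iso n (word_functor n u :: 'a endofunctor) (word_functor n v) \<longleftrightarrow> route v = route u"
    if "set v \<subseteq> {1..n}" for v
    using nat_iso_word_functor[OF assms that] route_eq_if_nat_iso[OF assms that, where 'r='a] by metis
  then show ?thesis
    using assms by (auto simp: word_class_def nat_iso_rel_def proj_comps_eq)
qed

lemma word_class_eq_iff:
  assumes "set u \<subseteq> {1..n}" "set v \<subseteq> {1..n}"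
  shows "(word_class n u :: 'r::field endofunctor set) = word_class n v \<longleftrightarrow> route u = route v"
proof
  assume "(word_class n u :: 'r endofunctor set) = word_class n v"
  moreover have "(word_functor n u :: 'r endofunctor) \<in> word_class n u"
    using assms(1) by (auto simp: word_class_eq)
  ultimately have "(word_functor n v :: 'r endofunctor, word_functor n u) \<in> nat_iso_rel n"
    by (simp add: word_class_def)
  then have "nat_iso n (word_functor n v :: 'r endofunctor) (word_functor n u)"
    by (simp add: nat_iso_rel_def)
  then show "route u = route v" using route_eq_if_nat_iso[OF assms(2,1)] by metis
qed (simp add: word_class_eq[OF assms(1)] word_class_eq[OF assms(2)])

lemma carrier_proj_monoid: "carrier (proj_monoid n) = word_class n ` {w. set w \<subseteq> {1..n}}"
  by (auto simp: proj_monoid_def quotient_def proj_comps_eq word_class_def)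

lemma one_proj_monoid: "\<one>\<^bsub>proj_monoid n\<^esub> = word_class n []"
  by (simp add: proj_monoid_def word_class_def)

text \<open>The product is a union over all pairs of representatives. Each pair contributes the same
  class, because the route of a concatenation depends only on the two routes.\<close>

lemma mult_proj_monoid:
  assumes u: "set u \<subseteq> {1..n}" and v: "set v \<subseteq> {1..n}"
  shows "word_class n u \<otimes>\<^bsub>proj_monoid n\<^esub> word_class n v = (word_class n (u @ v) :: 'r::field endofunctor set)"
proof -
  have "nat_iso_rel n `` {comp_functor F G} = word_class n (u @ v)"
    if F: "F \<in> word_class n u" and G: "G \<in> word_class n v" for F G :: "'r endofunctor"
  proof -
    obtain u' where u': "set u' \<subseteq> {1..n}" "route u' = route u" "F = word_functor n u'"
      using F unfolding word_class_eq[OF u] by blast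
    obtain v' where v': "set v' \<subseteq> {1..n}" "route v' = route v" "G = word_functor n v'"
      using G unfolding word_class_eq[OF v] by blast
    have "nat_iso_rel n `` {comp_functor F G} = word_class n (u' @ v')"
      by (simp add: u'(3) v'(3) comp_word_functor word_class_def)
    also have "\<dots> = word_class n (u @ v)"
      using u v u' v' by (subst word_class_eq_iff) (simp_all add: route_append)
    finally show ?thesis .
  qed
  \<comment> \<open>Both classes are nonempty, so the union has at least one member and equals the
    common class.\<close>
  moreover have "(word_functor n u :: 'r endofunctor) \<in> word_class n u"
    "(word_functor n v :: 'r endofunctor) \<in> word_class n v"
    unfolding word_class_eq[OF u] word_class_eq[OF v] using u v by blast+
  ultimately show ?thesis by (simp add: proj_monoid_def) blast
qed

section \<open>A faithful matrix representation\<close>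

lemma lookup_scale [simp]: "Poly_Mapping.lookup (scale c f) k = c * Poly_Mapping.lookup f k"
  by (simp add: scale_def Poly_Mapping.map.rep_eq when_def)

lemma keys_scale: "Poly_Mapping.keys (scale c f) \<subseteq> Poly_Mapping.keys f"
  by (auto simp: in_keys_iff)

definition linext :: "('b \<Rightarrow> 'r) \<Rightarrow> ('b \<Rightarrow>\<^sub>0 'r) \<Rightarrow> 'r::field" where
  "linext c x = (\<Sum>m\<in>Poly_Mapping.keys x. Poly_Mapping.lookup x m * c m)"

lemma linext_superset:
  assumes "finite S" "Poly_Mapping.keys x \<subseteq> S"
  shows "linext c x = (\<Sum>m\<in>S. Poly_Mapping.lookup x m * c m)"
  unfolding linext_def using assms by (intro sum.mono_neutral_left) (auto simp: in_keys_iff)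

lemma linext_add: "linext c (x + y) = linext c x + linext c y"
proof -
  let ?S = "Poly_Mapping.keys x \<union> Poly_Mapping.keys y"
  have "linext c z = (\<Sum>m\<in>?S. Poly_Mapping.lookup z m * c m)" if "Poly_Mapping.keys z \<subseteq> ?S" for z
    using that by (intro linext_superset) auto
  then show ?thesis
    using Poly_Mapping.keys_add[of x y]
    by (simp add: lookup_add distrib_right sum.distrib)
qed

lemma linext_scale: "linext c (scale a x) = a * linext c x"
proof -
  have "linext c (scale a x) = (\<Sum>m\<in>Poly_Mapping.keys x. Poly_Mapping.lookup (scale a x) m * c m)"
    by (intro linext_superset keys_scale) simp
  then show ?thesis by (simp add: linext_def sum_distrib_left mult.assoc)
qed

lemma linext_zero [simp]: "linext c 0 = 0"
  by (simp add: linext_def)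

lemma linext_uminus: "linext c (- x) = - linext c x"
  using linext_add[of c x "- x"] by (simp add: eq_neg_iff_add_eq_0 add.commute)

lemma linext_diff: "linext c (x - y) = linext c x - linext c y"
  using linext_add[of c x "- y"] by (simp add: linext_uminus)

lemma linext_single [simp]: "linext c (Poly_Mapping.single m a) = a * c m"
  by (simp add: linext_def)

lemma linext_sum: "linext c (\<Sum>i\<in>I. f i) = (\<Sum>i\<in>I. linext c (f i))"
  by (induction I rule: infinite_finite_induct) (simp_all add: linext_add)

lemma keys_sum_subset:
  "(\<And>i. i \<in> I \<Longrightarrow> Poly_Mapping.keys (f i) \<subseteq> B) \<Longrightarrow> Poly_Mapping.keys (sum f I) \<subseteq> B"
  using keys_sum[of f I] by (meson UN_least order_trans)

lemma keys_free_product: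
  assumes "\<And>a b. a \<in> B \<Longrightarrow> b \<in> B \<Longrightarrow> Poly_Mapping.keys (\<mu> a b) \<subseteq> B"
    and "Poly_Mapping.keys f \<subseteq> B" "Poly_Mapping.keys g \<subseteq> B"
  shows "Poly_Mapping.keys (\<Sum>a\<in>Poly_Mapping.keys f. \<Sum>b\<in>Poly_Mapping.keys g.
    scale (Poly_Mapping.lookup f a * Poly_Mapping.lookup g b) (\<mu> a b)) \<subseteq> B"
proof (intro keys_sum_subset)
  fix a b assume "a \<in> Poly_Mapping.keys f" "b \<in> Poly_Mapping.keys g"
  then have "Poly_Mapping.keys (\<mu> a b) \<subseteq> B" by (intro assms(1) subsetD[OF assms(2)] subsetD[OF assms(3)])
  with keys_scale
  show "Poly_Mapping.keys (scale (Poly_Mapping.lookup f a * Poly_Mapping.lookup g b) (\<mu> a b)) \<subseteq> B"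
    by (rule order_trans)
qed

section \<open>The operations of the monoid algebra\<close>

lemma proj_algebra_simps:
  "carrier (\<A> n) = {x. Poly_Mapping.keys x \<subseteq> carrier (proj_monoid n)}"
  "x \<otimes>\<^bsub>\<A> n\<^esub> y = (\<Sum>a\<in>Poly_Mapping.keys x. \<Sum>b\<in>Poly_Mapping.keys y.
     scale (Poly_Mapping.lookup x a * Poly_Mapping.lookup y b)
       (Poly_Mapping.single (a \<otimes>\<^bsub>proj_monoid n\<^esub> b) 1))"
  "\<one>\<^bsub>\<A> n\<^esub> = Poly_Mapping.single \<one>\<^bsub>proj_monoid n\<^esub> 1"
  "\<zero>\<^bsub>\<A> n\<^esub> = 0"
  "x \<oplus>\<^bsub>\<A> n\<^esub> y = x + y"
  "c \<odot>\<^bsub>\<A> n\<^esub> x = scale c x"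
  by (simp_all add: proj_algebra_def monoid_algebra_def free_algebra_on_def)

lemma mult_proj_monoid_closed:
  "a \<in> carrier (proj_monoid n) \<Longrightarrow> b \<in> carrier (proj_monoid n) \<Longrightarrow>
    a \<otimes>\<^bsub>proj_monoid n\<^esub> b \<in> carrier (proj_monoid n)"
  unfolding carrier_proj_monoid by (auto simp: mult_proj_monoid simp del: One_nat_def)

lemma proj_algebra_closed:
  shows "x \<in> carrier (\<A> n) \<Longrightarrow> y \<in> carrier (\<A> n) \<Longrightarrow> x \<otimes>\<^bsub>\<A> n\<^esub> y \<in> carrier (\<A> n)"
    and "x \<in> carrier (\<A> n) \<Longrightarrow> y \<in> carrier (\<A> n) \<Longrightarrow> x + y \<in> carrier (\<A> n)"
    and "x \<in> carrier (\<A> n) \<Longrightarrow> y \<in> carrier (\<A> n) \<Longrightarrow> x - y \<in> carrier (\<A> n)"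
    and "x \<in> carrier (\<A> n) \<Longrightarrow> scale c x \<in> carrier (\<A> n)"
    and "0 \<in> carrier (\<A> n)"
    and "set w \<subseteq> {1..n} \<Longrightarrow> Poly_Mapping.single (word_class n w) c \<in> carrier (\<A> n)"
proof -
  show "x \<otimes>\<^bsub>\<A> n\<^esub> y \<in> carrier (\<A> n)" if "x \<in> carrier (\<A> n)" "y \<in> carrier (\<A> n)"
    using that unfolding proj_algebra_simps mem_Collect_eq
    by (intro keys_free_product) (simp_all add: mult_proj_monoid_closed)
  show "x + y \<in> carrier (\<A> n)" if "x \<in> carrier (\<A> n)" "y \<in> carrier (\<A> n)"
    using that Poly_Mapping.keys_add[of x y] by (auto simp: proj_algebra_simps)
  show "x - y \<in> carrier (\<A> n)" if "x \<in> carrier (\<A> n)" "y \<in> carrier (\<A> n)"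
    using that keys_diff[of x y] by (auto simp: proj_algebra_simps)
  show "scale c x \<in> carrier (\<A> n)" if "x \<in> carrier (\<A> n)"
    using that keys_scale[of c x] by (auto simp: proj_algebra_simps)
  show "Poly_Mapping.single (word_class n w) c \<in> carrier (\<A> n)" if "set w \<subseteq> {1..n}"
    using that by (auto simp: proj_algebra_simps carrier_proj_monoid)
qed (simp add: proj_algebra_simps)

lemma abelian_group_proj_algebra: "abelian_group (\<A> n :: ('r::field, 'r proj_alg_elt) module)"
proof (rule abelian_groupI)
  fix x :: "'r proj_alg_elt" assume "x \<in> carrier (\<A> n)"
  then have "0 - x \<in> carrier (\<A> n)" by (intro proj_algebra_closed)
  then show "\<exists>y\<in>carrier (\<A> n). y \<oplus>\<^bsub>\<A> n\<^esub> x = \<zero>\<^bsub>\<A> n\<^esub>"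
    by (intro bexI[of _ "0 - x"]) (simp_all add: proj_algebra_simps(4,5))
qed (simp_all add: proj_algebra_simps(4,5) proj_algebra_closed add.assoc add.commute)

text \<open>Subtraction in the record goes through an additive inverse selected within the carrier,
  so it agrees with pointwise subtraction once y is known to lie there.\<close>

lemma minus_proj_algebra:
  assumes "y \<in> carrier (\<A> n)"
  shows "x \<ominus>\<^bsub>\<A> n\<^esub> y = x - y"
proof -
  interpret abelian_group "\<A> n" by (rule abelian_group_proj_algebra)
  have "- y \<in> carrier (\<A> n)" using proj_algebra_closed(3)[OF zero_closed assms] by (simp add: proj_algebra_simps(4))
  then have "\<ominus>\<^bsub>\<A> n\<^esub> y = - y"
    using assms by (intro minus_equality) (simp_all add: proj_algebra_simps(4,5))
  then show ?thesis by (simp add: a_minus_def proj_algebra_simps(5))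
qed

lemma finsum_proj_algebra:
  assumes "finite I" "\<And>i. i \<in> I \<Longrightarrow> f i \<in> carrier (\<A> n)"
  shows "finsum (\<A> n) f I = sum f I"
proof -
  interpret abelian_group "\<A> n" by (rule abelian_group_proj_algebra)
  show ?thesis
    using assms by (induction I rule: finite_induct)
      (simp_all add: proj_algebra_simps(4,5) Pi_def)
qed

section \<open>Classes acting on subsets, and the matrices of this action\<close>

definition class_route :: "nat \<Rightarrow> 'r::field endofunctor set \<Rightarrow> nat \<Rightarrow> nat" where
  "class_route n m = route (SOME w. set w \<subseteq> {1..n} \<and> word_class n w = m)"

lemma class_route_word_class:
  assumes "set w \<subseteq> {1..n}"
  shows "class_route n (word_class n w :: 'r::field endofunctor set) = route w"
proof -
  let ?v = "SOME v. set v \<subseteq> {1..n} \<and> word_class n v = (word_class n w :: 'r endofunctor set)"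
  have v: "set ?v \<subseteq> {1..n} \<and> word_class n ?v = (word_class n w :: 'r endofunctor set)"
    using assms by (intro someI[of "\<lambda>v. set v \<subseteq> {1..n} \<and> word_class n v = _"]) simp
  then have "route ?v = route w"
    using word_class_eq_iff[OF conjunct1[OF v] assms, where 'r='r] by blast
  then show ?thesis unfolding class_route_def .
qed

text \<open>
  The matrix of the right action of an element of the algebra on the free module on the
  subsets of \<open>{1..n}\<close>.
\<close>

definition matrix :: "nat \<Rightarrow> 'r::field proj_alg_elt \<Rightarrow> nat set \<Rightarrow> nat set \<Rightarrow> 'r" where
  "matrix n x K L = linext (\<lambda>m. of_bool (transport n (class_route n m) K = Some L)) x"

lemma matrix_add: "matrix n (x + y) K L = matrix n x K L + matrix n y K L"
  by (simp add: matrix_def linext_add)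

lemma matrix_diff: "matrix n (x - y) K L = matrix n x K L - matrix n y K L"
  by (simp add: matrix_def linext_diff)

lemma matrix_scale: "matrix n (scale c x) K L = c * matrix n x K L"
  by (simp add: matrix_def linext_scale)

lemma matrix_sum: "matrix n (\<Sum>i\<in>I. f i) K L = (\<Sum>i\<in>I. matrix n (f i) K L)"
  by (simp add: matrix_def linext_sum)

lemma matrix_zero [simp]: "matrix n 0 K L = 0"
  by (simp add: matrix_def)

lemma matrix_word_class:
  "set w \<subseteq> {1..n} \<Longrightarrow>
    matrix n (Poly_Mapping.single (word_class n w) 1) K L = of_bool (transport n (route w) K = Some L)"
  by (simp add: matrix_def class_route_word_class)

lemma matrix_nonzeroE:
  assumes "matrix n x K L \<noteq> 0" "x \<in> carrier (\<A> n)"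
  obtains w where "set w \<subseteq> {1..n}" "transport n (route w) K = Some L"
proof -
  from assms(1) obtain m where m: "m \<in> Poly_Mapping.keys x" "transport n (class_route n m) K = Some L"
    unfolding matrix_def linext_def by (elim sum.not_neutral_contains_not_neutral) (simp split: if_splits)
  then obtain w where w: "set w \<subseteq> {1..n}" "m = word_class n w"
    using assms(2) unfolding proj_algebra_simps(1) carrier_proj_monoid by blast
  have "transport n (route w) K = Some L"
    using m(2) unfolding w(2) class_route_word_class[OF w(1)] .
  with w(1) show thesis by (rule that)
qed

lemma matrix_nonzero_poset_ge:
  assumes "matrix n x K L \<noteq> 0" "x \<in> carrier (\<A> n)" "K \<subseteq> {1..n}"
  shows "poset_ge n K L"
proof -
  obtain w where "set w \<subseteq> {1..n}" "transport n (route w) K = Some L"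
    using assms(1,2) by (rule matrix_nonzeroE)
  then show ?thesis using assms(3) transport_route_poset_ge by blast
qed

lemma matrix_one:
  assumes "K \<subseteq> {1..n}"
  shows "matrix n \<one>\<^bsub>\<A> n\<^esub> K L = of_bool (L = K)"
proof -
  have "matrix n \<one>\<^bsub>\<A> n\<^esub> K L = of_bool (transport n (route []) K = Some L)"
    unfolding proj_algebra_simps(3) one_proj_monoid by (rule matrix_word_class) simp
  then show ?thesis unfolding route_simps(1) transport_id[OF assms] by auto
qed

lemma one_proj_algebra_closed: "\<one>\<^bsub>\<A> n\<^esub> \<in> carrier (\<A> n)"
  using proj_algebra_closed(6)[of "[]" n 1] by (simp add: proj_algebra_simps(3) one_proj_monoid)

text \<open>For two words the concatenation passes through at most one intermediate subset, the one
  reached by the first word. This is the matrix product on basis elements, and both sides are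
  bilinear.\<close>

lemma matrix_mult:
  fixes x y :: "'r::field proj_alg_elt"
  assumes x: "x \<in> carrier (\<A> n)" and y: "y \<in> carrier (\<A> n)" and K: "K \<subseteq> {1..n}"
  shows "matrix n (x \<otimes>\<^bsub>\<A> n\<^esub> y) K L = (\<Sum>M\<in>Pow {1..n}. matrix n x K M * matrix n y M L)"
proof -
  define c where "c K L m = (of_bool (transport n (class_route n m) K = Some L) :: 'r)"
    for K L and m :: "'r endofunctor set"
  have c: "c K L (a \<otimes>\<^bsub>proj_monoid n\<^esub> b) = (\<Sum>M\<in>Pow {1..n}. c K M a * c M L b)"
    if a: "a \<in> Poly_Mapping.keys x" and b: "b \<in> Poly_Mapping.keys y" for a b
  proof -
    obtain u where u: "set u \<subseteq> {1..n}" "a = word_class n u"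
      using x a unfolding proj_algebra_simps(1) carrier_proj_monoid by blast
    obtain v where v: "set v \<subseteq> {1..n}" "b = word_class n v"
      using y b unfolding proj_algebra_simps(1) carrier_proj_monoid by blast
    have ab: "class_route n (a \<otimes>\<^bsub>proj_monoid n\<^esub> b) = route (u @ v)"
      using u v by (simp add: mult_proj_monoid class_route_word_class)
    show ?thesis
    proof (cases "transport n (route u) K")
      case None
      then show ?thesis
        using u v ab by (simp add: c_def class_route_word_class transport_append)
    next
      case (Some N)
      then have N: "N \<in> Pow {1..n}"
        using transport_route_poset_ge[OF u(1) K] by (auto simp: poset_ge_def)
      have "(\<Sum>M\<in>Pow {1..n}. c K M a * c M L b) = (\<Sum>M\<in>Pow {1..n}. if M = N then c N L b else 0)"
        using Some u by (intro sum.cong) (auto simp: c_def class_route_word_class)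
      also have "\<dots> = c N L b" using N by (simp del: Pow_iff)
      finally show ?thesis
        using Some u v ab by (simp add: c_def class_route_word_class transport_append)
    qed
  qed
  have "matrix n (x \<otimes>\<^bsub>\<A> n\<^esub> y) K L = (\<Sum>a\<in>Poly_Mapping.keys x. \<Sum>b\<in>Poly_Mapping.keys y.
      Poly_Mapping.lookup x a * Poly_Mapping.lookup y b * c K L (a \<otimes>\<^bsub>proj_monoid n\<^esub> b))"
    by (simp add: matrix_def proj_algebra_simps(2) linext_sum linext_scale c_def)
  also have "\<dots> = (\<Sum>a\<in>Poly_Mapping.keys x. \<Sum>b\<in>Poly_Mapping.keys y. \<Sum>M\<in>Pow {1..n}.
      (Poly_Mapping.lookup x a * c K M a) * (Poly_Mapping.lookup y b * c M L b))"
    by (intro sum.cong refl) (simp add: c sum_distrib_left mult_ac)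
  also have "\<dots> = (\<Sum>M\<in>Pow {1..n}. \<Sum>a\<in>Poly_Mapping.keys x. \<Sum>b\<in>Poly_Mapping.keys y.
      (Poly_Mapping.lookup x a * c K M a) * (Poly_Mapping.lookup y b * c M L b))"
    by (subst sum.swap[of _ "Pow {1..n}"], subst sum.swap[of _ "Pow {1..n}"]) simp
  also have "\<dots> = (\<Sum>M\<in>Pow {1..n}. matrix n x K M * matrix n y M L)"
    by (simp only: matrix_def linext_def c_def sum_product)
  finally show ?thesis .
qed

text \<open>In the support of a nonzero difference a class m with the smallest sum of route values
  is chosen. By \<open>transport_determines\<close> some entry is hit by m and otherwise only by
  routes pointwise below that of m; minimality of the sum leaves m alone. This entry is the
  coefficient of m, which is nonzero.\<close>

lemma matrix_inject:
  fixes x y :: "'r::field proj_alg_elt"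
  assumes xy: "x \<in> carrier (\<A> n)" "y \<in> carrier (\<A> n)"
    and eq: "\<And>K L. K \<subseteq> {1..n} \<Longrightarrow> L \<subseteq> {1..n} \<Longrightarrow> matrix n x K L = matrix n y K L"
  shows "x = y"
proof (rule ccontr)
  assume "x \<noteq> y"
  define d where "d = x - y"
  have d: "d \<in> carrier (\<A> n)" unfolding d_def using xy by (rule proj_algebra_closed)
  have "d \<noteq> 0" using \<open>x \<noteq> y\<close> by (simp add: d_def)
  then have "Poly_Mapping.keys d \<noteq> {}" by simp
  define size where "size m = (\<Sum>i\<in>{1..n}. class_route n m i)" for m :: "'r endofunctor set"
  obtain m where m: "m \<in> Poly_Mapping.keys d" "\<And>m'. m' \<in> Poly_Mapping.keys d \<Longrightarrow> size m \<le> size m'"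
    using ex_is_arg_min_if_finite[OF finite_keys \<open>Poly_Mapping.keys d \<noteq> {}\<close>, of size]
    unfolding is_arg_min_linorder by blast
  have repr: "\<exists>w. set w \<subseteq> {1..n} \<and> m' = word_class n w" if "m' \<in> Poly_Mapping.keys d" for m'
    using that d unfolding proj_algebra_simps(1) carrier_proj_monoid by blast
  obtain u where u: "set u \<subseteq> {1..n}" "m = word_class n u" using repr[OF m(1)] by auto
  obtain K L where K: "K \<subseteq> {1..n}" and KL: "transport n (route u) K = Some L"
    and max: "\<And>v. set v \<subseteq> {1..n} \<Longrightarrow> transport n (route v) K = Some L \<Longrightarrow> \<forall>i. route v i \<le> route u i"
    using transport_determines[OF u(1)] by metis
  have only: "m' = m" if m': "m' \<in> Poly_Mapping.keys d" "transport n (class_route n m') K = Some L" for m'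
  proof -
    obtain v where v: "set v \<subseteq> {1..n}" "m' = word_class n v" using repr[OF m'(1)] by auto
    then have le: "route v i \<le> route u i" for i using max m'(2) by (simp add: class_route_word_class)
    have ge: "(\<Sum>i\<in>{1..n}. route u i) \<le> (\<Sum>i\<in>{1..n}. route v i)"
      using m(2)[OF m'(1)] u v by (simp add: size_def class_route_word_class)
    have sum: "(\<Sum>i\<in>{1..n}. route v i) = (\<Sum>i\<in>{1..n}. route u i)"
      by (rule antisym[OF sum_mono[OF le] ge])
    have "route v i = route u i" if "i \<in> {1..n}" for i
      using sum_mono_inv[OF sum le that] by simp
    then have "route v i = route u i" for i
      using route_fixed[OF u(1), of i] route_fixed[OF v(1), of i] by (cases "i \<in> {1..n}") simp_all
    then have "route v = route u" ..
    then show ?thesis using word_class_eq_iff[OF v(1) u(1)] u(2) v(2) by blast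
  qed
  have "matrix n d K L = (\<Sum>m'\<in>Poly_Mapping.keys d. if m' = m then Poly_Mapping.lookup d m else 0)"
    unfolding matrix_def linext_def
  proof (intro sum.cong refl)
    fix m' assume m': "m' \<in> Poly_Mapping.keys d"
    have "transport n (class_route n m) K = Some L"
      using KL unfolding u(2) class_route_word_class[OF u(1)] .
    then have "transport n (class_route n m') K = Some L \<longleftrightarrow> m' = m" using only[OF m'] by blast
    then show "Poly_Mapping.lookup d m' * of_bool (transport n (class_route n m') K = Some L) =
        (if m' = m then Poly_Mapping.lookup d m else 0)" by simp
  qed
  also have "\<dots> = Poly_Mapping.lookup d m" using m(1) by simp
  also have "\<dots> \<noteq> 0" using m(1) by (simp add: in_keys_iff)
  finally have "matrix n d K L \<noteq> 0" .
  moreover have "L \<subseteq> {1..n}"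
    using transport_route_poset_ge[OF u(1) K KL] by (simp add: poset_ge_def)
  ultimately show False using eq[OF K] by (simp add: d_def matrix_diff)
qed

section \<open>The matrices of the elements y, z and g\<close>

lemma word_class_singleton: "word_class n [t] = nat_iso_rel n `` {proj_functor n t}"
  by (simp add: word_class_def word_functor_Cons)

lemma proj_elt_eq: "\<P> n t = Poly_Mapping.single (word_class n [t]) 1"
  by (simp add: proj_elt_def word_class_singleton)

lemma proj_elt_closed: "t \<in> {1..n} \<Longrightarrow> \<P> n t \<in> carrier (\<A> n)"
  unfolding proj_elt_eq by (rule proj_algebra_closed) simp

lemma matrix_proj_elt:
  assumes "t \<in> {1..n}" "K \<subseteq> {1..n}"
  shows "matrix n (\<P> n t) K L =
    (if t \<in> K then of_bool (L = K)
     else if Suc t \<in> K then of_bool (L = insert t (K - {Suc t})) else 0)"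
proof -
  have "route [t] = bump t" by (rule ext) simp
  moreover have "matrix n (\<P> n t) K L = of_bool (transport n (route [t]) K = Some L)"
    unfolding proj_elt_eq by (rule matrix_word_class) (use assms(1) in simp)
  ultimately have "matrix n (\<P> n t) K L = of_bool (transport n (bump t) K = Some L)" by simp
  also have "(transport n (bump t) K = Some L) \<longleftrightarrow>
      (if t \<in> K then L = K else if Suc t \<in> K then L = insert t (K - {Suc t}) else False)"
    unfolding transport_bump[OF assms(2,1)] by (auto split: if_splits)
  finally show ?thesis by (simp only: if_distrib[of of_bool] of_bool_eq)
qed

lemma matrix_mult_row:
  assumes "x \<in> carrier (\<A> n)" "y \<in> carrier (\<A> n)" "K \<subseteq> {1..n}" "N \<subseteq> {1..n}"
    and row: "\<And>M. matrix n x K M = of_bool (M = N)"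
  shows "matrix n (x \<otimes>\<^bsub>\<A> n\<^esub> y) K L = matrix n y N L"
proof -
  have "matrix n (x \<otimes>\<^bsub>\<A> n\<^esub> y) K L = (\<Sum>M\<in>Pow {1..n}. if M = N then matrix n y N L else 0)"
    unfolding matrix_mult[OF assms(1-3)] by (intro sum.cong refl) (simp add: row)
  also have "\<dots> = matrix n y N L"
    using assms(4) by (simp del: Pow_iff add: Pow_def)
  finally show ?thesis .
qed

lemma matrix_mult_zero_row:
  assumes "x \<in> carrier (\<A> n)" "y \<in> carrier (\<A> n)" "K \<subseteq> {1..n}" "\<And>M. matrix n x K M = 0"
  shows "matrix n (x \<otimes>\<^bsub>\<A> n\<^esub> y) K L = 0"
  unfolding matrix_mult[OF assms(1-3)] by (simp add: assms(4))

lemma matrix_mult_nonzeroE: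
  assumes "x \<in> carrier (\<A> n)" "y \<in> carrier (\<A> n)" "K \<subseteq> {1..n}"
    and "matrix n (x \<otimes>\<^bsub>\<A> n\<^esub> y) K L \<noteq> 0"
  obtains M where "M \<subseteq> {1..n}" "matrix n x K M \<noteq> 0" "matrix n y M L \<noteq> 0"
proof -
  from assms(4) obtain M where "M \<in> Pow {1..n}" "matrix n x K M * matrix n y M L \<noteq> 0"
    unfolding matrix_mult[OF assms(1-3)] by (rule sum.not_neutral_contains_not_neutral)
  then show thesis by (intro that[of M]) auto
qed

lemma matrix_proj_elt_mult:
  assumes "t \<in> {1..n}" "x \<in> carrier (\<A> n)" "K \<subseteq> {1..n}"
  shows "matrix n (\<P> n t \<otimes>\<^bsub>\<A> n\<^esub> x) K L =
    (if t \<in> K then matrix n x K L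
     else if Suc t \<in> K then matrix n x (insert t (K - {Suc t})) L else 0)"
proof -
  have P: "\<P> n t \<in> carrier (\<A> n)" using assms(1) by (rule proj_elt_closed)
  note row = matrix_proj_elt[OF assms(1,3)]
  show ?thesis
  proof (cases "t \<in> K")
    case True
    then have "matrix n (\<P> n t) K M = of_bool (M = K)" for M by (simp add: row)
    from matrix_mult_row[OF P assms(2,3,3) this] show ?thesis using True by simp
  next
    case False
    show ?thesis
    proof (cases "Suc t \<in> K")
      case True
      have sub: "insert t (K - {Suc t}) \<subseteq> {1..n}" using assms(1,3) by blast
      have "matrix n (\<P> n t) K M = of_bool (M = insert t (K - {Suc t}))" for M
        using False True by (simp add: row)
      from matrix_mult_row[OF P assms(2,3) sub this] show ?thesis using False True by simp
    next
      case no: False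
      then have "matrix n (\<P> n t) K M = 0" for M using False by (simp add: row)
      from matrix_mult_zero_row[OF P assms(2,3) this] show ?thesis using False no by simp
    qed
  qed
qed

text \<open>
  Elements generated by \<open>\<P> n 1, \<dots>, \<P> n m\<close> move only elements of subsets within \<open>{1..Suc m}\<close>,
  and only downwards.
\<close>

definition low :: "nat \<Rightarrow> nat \<Rightarrow> 'r::field proj_alg_elt \<Rightarrow> bool" where
  "low n m x \<longleftrightarrow> x \<in> carrier (\<A> n) \<and> (\<forall>K L. K \<subseteq> {1..n} \<longrightarrow> matrix n x K L \<noteq> 0 \<longrightarrow>
     (\<forall>i>Suc m. i \<in> L \<longleftrightarrow> i \<in> K) \<and> (Suc m \<in> L \<longrightarrow> Suc m \<in> K))"

lemma lowD:
  assumes "low n m x" "K \<subseteq> {1..n}" "matrix n x K L \<noteq> 0"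
  shows "i > Suc m \<Longrightarrow> i \<in> L \<longleftrightarrow> i \<in> K" and "Suc m \<in> L \<Longrightarrow> Suc m \<in> K"
proof -
  from assms(1) have "\<forall>K L. K \<subseteq> {1..n} \<longrightarrow> matrix n x K L \<noteq> 0 \<longrightarrow>
     (\<forall>i>Suc m. i \<in> L \<longleftrightarrow> i \<in> K) \<and> (Suc m \<in> L \<longrightarrow> Suc m \<in> K)"
    unfolding low_def by (rule conjunct2)
  from this[THEN spec, THEN spec, THEN mp, OF assms(2), THEN mp, OF assms(3)]
  have *: "(\<forall>i>Suc m. i \<in> L \<longleftrightarrow> i \<in> K) \<and> (Suc m \<in> L \<longrightarrow> Suc m \<in> K)" .
  show "i \<in> L \<longleftrightarrow> i \<in> K" if "i > Suc m" using * that by simp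
  show "Suc m \<in> K" if "Suc m \<in> L" using * that by simp
qed

lemma low_carrier: "low n m x \<Longrightarrow> x \<in> carrier (\<A> n)"
  unfolding low_def by (rule conjunct1)

lemma low_mono:
  assumes "low n m x" "m \<le> m'"
  shows "low n m' x"
  unfolding low_def
proof (intro conjI allI impI)
  show "x \<in> carrier (\<A> n)" using assms(1) by (rule low_carrier)
next
  fix K L i assume K: "K \<subseteq> {1..n}" "matrix n x K L \<noteq> 0"
  note D = lowD[OF assms(1) K]
  show "i \<in> L \<longleftrightarrow> i \<in> K" if "Suc m' < i" using that assms(2) by (intro D) simp
  show "Suc m' \<in> K" if "Suc m' \<in> L"
    using that D(1)[of "Suc m'"] D(2) assms(2) by (cases "m = m'") auto
qed

lemma low_zero: "low n m 0"
  by (simp add: low_def proj_algebra_closed(5))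

lemma low_one: "low n m \<one>\<^bsub>\<A> n\<^esub>"
  unfolding low_def
proof (intro conjI allI impI)
  fix K L i assume "K \<subseteq> {1..n}" "matrix n \<one>\<^bsub>\<A> n\<^esub> K L \<noteq> 0"
  then have "L = K" by (simp add: matrix_one del: One_nat_def)
  then show "i \<in> L \<longleftrightarrow> i \<in> K" and "Suc m \<in> L \<Longrightarrow> Suc m \<in> K" by simp_all
qed (rule one_proj_algebra_closed)

lemma low_proj_elt:
  assumes "t \<in> {1..n}" "t \<le> m"
  shows "low n m (\<P> n t)"
  unfolding low_def
proof (intro conjI allI impI)
  fix K L i assume "K \<subseteq> {1..n}" "matrix n (\<P> n t) K L \<noteq> 0"
  then have L: "L = K \<or> L = insert t (K - {Suc t})"
    by (simp add: matrix_proj_elt[OF assms(1)] split: if_splits)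
  show "i \<in> L \<longleftrightarrow> i \<in> K" if "i > Suc m" using L that assms(2) by auto
  show "Suc m \<in> K" if "Suc m \<in> L" using L that assms(2) by auto
qed (rule proj_elt_closed[OF assms(1)])

lemma low_add:
  assumes "low n m x" "low n m y"
  shows "low n m (x + y)"
  unfolding low_def
proof (intro conjI allI impI)
  show "x + y \<in> carrier (\<A> n)" using assms by (intro proj_algebra_closed low_carrier)
  fix K L i assume K: "K \<subseteq> {1..n}" and nz: "matrix n (x + y) K L \<noteq> 0"
  have or: "matrix n x K L \<noteq> 0 \<or> matrix n y K L \<noteq> 0" using nz by (auto simp: matrix_add)
  show "i \<in> L \<longleftrightarrow> i \<in> K" if "i > Suc m"
    using or lowD(1)[OF assms(1) K _ that] lowD(1)[OF assms(2) K _ that] by blast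
  show "Suc m \<in> K" if "Suc m \<in> L"
    using or lowD(2)[OF assms(1) K _ that] lowD(2)[OF assms(2) K _ that] by blast
qed

lemma low_diff:
  assumes "low n m x" "low n m y"
  shows "low n m (x - y)"
  unfolding low_def
proof (intro conjI allI impI)
  show "x - y \<in> carrier (\<A> n)" using assms by (intro proj_algebra_closed low_carrier)
  fix K L i assume K: "K \<subseteq> {1..n}" and nz: "matrix n (x - y) K L \<noteq> 0"
  have or: "matrix n x K L \<noteq> 0 \<or> matrix n y K L \<noteq> 0" using nz by (auto simp: matrix_diff)
  show "i \<in> L \<longleftrightarrow> i \<in> K" if "i > Suc m"
    using or lowD(1)[OF assms(1) K _ that] lowD(1)[OF assms(2) K _ that] by blast
  show "Suc m \<in> K" if "Suc m \<in> L"
    using or lowD(2)[OF assms(1) K _ that] lowD(2)[OF assms(2) K _ that] by blast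
qed

lemma low_mult:
  assumes "low n m x" "low n m y"
  shows "low n m (x \<otimes>\<^bsub>\<A> n\<^esub> y)"
  unfolding low_def
proof (intro conjI allI impI)
  have xy: "x \<in> carrier (\<A> n)" "y \<in> carrier (\<A> n)" using assms by (simp_all add: low_carrier)
  then show "x \<otimes>\<^bsub>\<A> n\<^esub> y \<in> carrier (\<A> n)" by (rule proj_algebra_closed)
  fix K L i assume K: "K \<subseteq> {1..n}" and "matrix n (x \<otimes>\<^bsub>\<A> n\<^esub> y) K L \<noteq> 0"
  from xy this obtain M where M: "M \<subseteq> {1..n}" "matrix n x K M \<noteq> 0" "matrix n y M L \<noteq> 0"
    by (rule matrix_mult_nonzeroE)
  show "i \<in> L \<longleftrightarrow> i \<in> K" if "i > Suc m"
    using lowD(1)[OF assms(1) K M(2) that] lowD(1)[OF assms(2) M(1,3) that] by simp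
  show "Suc m \<in> K" if "Suc m \<in> L"
    using lowD(2)[OF assms(1) K M(2)] lowD(2)[OF assms(2) M(1,3) that] by simp
qed

lemma y_elt_zero: "m < k \<Longrightarrow> y_elt n m k = 0"
  by (cases m) (simp_all add: proj_algebra_simps(4))

lemma mult_zero_right: "x \<otimes>\<^bsub>\<A> n\<^esub> 0 = 0"
  by (simp add: proj_algebra_simps(2))

lemma mult_zero_left: "0 \<otimes>\<^bsub>\<A> n\<^esub> x = 0"
  by (simp add: proj_algebra_simps(2))

lemma one_mult_left:
  assumes "x \<in> carrier (\<A> n)"
  shows "\<one>\<^bsub>\<A> n\<^esub> \<otimes>\<^bsub>\<A> n\<^esub> x = x"
proof (rule matrix_inject[OF proj_algebra_closed(1)[OF one_proj_algebra_closed assms] assms])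
  fix K L assume K: "K \<subseteq> {1..n}"
  show "matrix n (\<one>\<^bsub>\<A> n\<^esub> \<otimes>\<^bsub>\<A> n\<^esub> x) K L = matrix n x K L"
    by (rule matrix_mult_row[OF one_proj_algebra_closed assms K K]) (rule matrix_one[OF K])
qed

text \<open>With the value \<open>1\<close> at \<open>k = 0\<close> the two cases of the recursion for \<open>y\<close> become one.\<close>

definition y_ext :: "nat \<Rightarrow> nat \<Rightarrow> nat \<Rightarrow> 'r::field proj_alg_elt" where
  "y_ext n m k = (if k = 0 then \<one>\<^bsub>\<A> n\<^esub> else y_elt n m k)"

text \<open>The property \<open>low\<close> is an assumption here because the recursion is used
  within the very induction that establishes it; the assumption supplies membership in the carrier
  for the subtraction.\<close>

lemma y_ext_Suc_aux:
  fixes n m k :: nat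
  assumes "Suc m \<le> n" "\<And>k. low n m (y_ext n m k :: 'r::field proj_alg_elt)"
  shows "(y_ext n (Suc m) (Suc k) :: 'r proj_alg_elt) =
    (y_ext n m (Suc k) - \<P> n (Suc m) \<otimes>\<^bsub>\<A> n\<^esub> y_ext n m (Suc k)) + y_ext n m k \<otimes>\<^bsub>\<A> n\<^esub> \<P> n (Suc m)"
proof -
  have P: "(\<P> n (Suc m) :: 'r proj_alg_elt) \<in> carrier (\<A> n)"
    using assms(1) by (intro proj_elt_closed) simp
  have y: "(y_elt n m (Suc k) :: 'r proj_alg_elt) \<in> carrier (\<A> n)"
    using low_carrier[OF assms(2)[of "Suc k"]] by (simp add: y_ext_def)
  have minus: "y_elt n m (Suc k) \<ominus>\<^bsub>\<A> n\<^esub> \<P> n (Suc m) \<otimes>\<^bsub>\<A> n\<^esub> y_elt n m (Suc k) =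
      (y_elt n m (Suc k) - \<P> n (Suc m) \<otimes>\<^bsub>\<A> n\<^esub> y_elt n m (Suc k) :: 'r proj_alg_elt)"
    using P y by (intro minus_proj_algebra proj_algebra_closed)
  \<comment> \<open>The unit at index 0 times the generator reproduces the separate summand in the
    rule for k = 1 and also the start value at superscript 1; for m < k both sides are zero.\<close>
  consider "m < k" | "k \<le> m" "m = 0" | "k \<le> m" "m \<noteq> 0" "k = 0" | "k \<le> m" "m \<noteq> 0" "k \<noteq> 0"
    by linarith
  then show ?thesis
  proof cases
    case 1
    then show ?thesis
      by (simp add: y_ext_def y_elt_zero mult_zero_left mult_zero_right proj_algebra_simps(4))
  next
    case 2
    then show ?thesis using one_mult_left[OF P]
      by (simp add: y_ext_def y_elt_zero mult_zero_right proj_algebra_simps(4))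
  next
    case 3
    then show ?thesis using one_mult_left[OF P] minus
      by (simp add: y_ext_def proj_algebra_simps(5))
  next
    case 4
    then show ?thesis using minus by (simp add: y_ext_def proj_algebra_simps(5))
  qed
qed

lemma low_y_ext: "m \<le> n \<Longrightarrow> low n m (y_ext n m k :: 'r::field proj_alg_elt)"
proof (induction m arbitrary: k)
  case 0
  show ?case by (simp add: y_ext_def low_one low_zero proj_algebra_simps(4))
next
  case (Suc m)
  have IH: "low n m (y_ext n m k :: 'r proj_alg_elt)" for k using Suc by simp
  then have "low n (Suc m) (y_ext n m k :: 'r proj_alg_elt)" for k by (rule low_mono) simp
  moreover have "low n (Suc m) (\<P> n (Suc m))" using Suc.prems by (intro low_proj_elt) auto
  ultimately show ?case
  proof (cases k)
    case 0
    then show ?thesis by (simp add: y_ext_def low_one)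
  next
    case (Suc j)
    show ?thesis
      unfolding Suc y_ext_Suc_aux[OF Suc.prems IH]
      by (intro low_add low_diff low_mult; fact)
  qed
qed

lemma y_ext_Suc:
  assumes "Suc m \<le> n"
  shows "y_ext n (Suc m) (Suc k) =
    (y_ext n m (Suc k) - \<P> n (Suc m) \<otimes>\<^bsub>\<A> n\<^esub> y_ext n m (Suc k)) + y_ext n m k \<otimes>\<^bsub>\<A> n\<^esub> \<P> n (Suc m)"
proof -
  have "m \<le> n" using assms by simp
  from y_ext_Suc_aux[OF assms low_y_ext[OF this]] show ?thesis .
qed

lemma card_initial_Suc: "card (K \<inter> {1..Suc m}) = card (K \<inter> {1..m}) + of_bool (Suc m \<in> K)"
proof -
  have "K \<inter> {1..Suc m} = (if Suc m \<in> K then insert (Suc m) (K \<inter> {1..m}) else K \<inter> {1..m})"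
    by (auto simp: le_Suc_eq)
  then show ?thesis by simp
qed

text \<open>The rows with k at most the number c of elements of K in {1..m} are already final, and
  the rows with k beyond the count in {1..Suc m} vanish. What remains is k = c + 1 with
  \<open>Suc m\<close> in K, where entries can be off the diagonal. All that is kept there is that
  \<open>Suc m\<close> has moved away, which is what the next superscript needs.\<close>

lemma matrix_y_ext:
  fixes n m k :: nat and K L :: "nat set"
  defines "Y \<equiv> \<lambda>m k. matrix n (y_ext n m k :: 'r::field proj_alg_elt)"
  assumes "m \<le> n" "K \<subseteq> {1..n}"
  shows "k \<le> card (K \<inter> {1..m}) \<Longrightarrow> Y m k K L = of_bool (L = K)"
    and "card (K \<inter> {1..Suc m}) < k \<Longrightarrow> Y m k K L = 0"
    and "k = Suc (card (K \<inter> {1..m})) \<Longrightarrow> Suc m \<in> K \<Longrightarrow> Y m k K L \<noteq> 0 \<Longrightarrow> Suc m \<notin> L"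
proof -
  have "(k \<le> card (K \<inter> {1..m}) \<longrightarrow> Y m k K L = of_bool (L = K)) \<and>
    (card (K \<inter> {1..Suc m}) < k \<longrightarrow> Y m k K L = 0) \<and>
    (k = Suc (card (K \<inter> {1..m})) \<longrightarrow> Suc m \<in> K \<longrightarrow> Y m k K L \<noteq> 0 \<longrightarrow> Suc m \<notin> L)"
    using assms(2,3)
  proof (induction m arbitrary: k K L)
    case 0
    then show ?case by (auto simp: Y_def y_ext_def matrix_one proj_algebra_simps(4) simp del: One_nat_def)
  next
    case (Suc m)
    let ?t = "Suc m"
    have t: "?t \<in> {1..n}" and m: "m \<le> n" using Suc.prems by auto
    have K: "K \<subseteq> {1..n}" by fact
    define c where "c K m = card (K \<inter> {1..m})" for K :: "nat set" and m :: nat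
    have c_Suc: "c K (Suc m) = c K m + of_bool (Suc m \<in> K)" for K m
      unfolding c_def by (rule card_initial_Suc)
    have one: "Y m k K L = of_bool (L = K)" if "k \<le> c K m" "K \<subseteq> {1..n}" for k K L
      using Suc.IH[OF m that(2)] that(1) unfolding c_def by blast
    have zero: "Y m k K L = 0" if "c K ?t < k" "K \<subseteq> {1..n}" for k K L
      using Suc.IH[OF m that(2)] that(1) unfolding c_def by blast
    have gap: "?t \<notin> L" if "k = Suc (c K m)" "?t \<in> K" "Y m k K L \<noteq> 0" "K \<subseteq> {1..n}" for k K L
      using Suc.IH[OF m that(4)] that(1-3) unfolding c_def by blast
    have low: "low n m (y_ext n m k :: 'r proj_alg_elt)" for k using m by (rule low_y_ext)
    have car: "(y_ext n m k :: 'r proj_alg_elt) \<in> carrier (\<A> n)" for k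
      using low by (rule low_carrier)
    have P: "(\<P> n ?t :: 'r proj_alg_elt) \<in> carrier (\<A> n)" using t by (rule proj_elt_closed)
    define R where "R k = matrix n (y_ext n m k \<otimes>\<^bsub>\<A> n\<^esub> \<P> n ?t :: 'r proj_alg_elt)" for k
    have R_one: "R k K L = matrix n (\<P> n ?t) K L" if "k \<le> c K m" "K \<subseteq> {1..n}" for k K L
      unfolding R_def using one[OF that]
      by (intro matrix_mult_row[OF car P that(2) that(2)]) (simp add: Y_def)
    have R_zero: "R k K L = 0" if "c K ?t < k" "K \<subseteq> {1..n}" for k K L
      unfolding R_def using zero[OF that]
      by (intro matrix_mult_zero_row[OF car P that(2)]) (simp add: Y_def)
    \<comment> \<open>The first factor has emptied the position \<open>?t\<close>, so the generator
      acts nontrivially only by sliding \<open>Suc ?t\<close> into it. Hence \<open>Suc ?t\<close>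
      was in K and is gone afterwards.\<close>
    have R_gap: "Suc ?t \<in> K \<and> Suc ?t \<notin> L" if k: "k = Suc (c K m)" "?t \<in> K" and "R k K L \<noteq> 0" and K: "K \<subseteq> {1..n}" for k K L
    proof -
      from \<open>R k K L \<noteq> 0\<close> obtain M where M: "M \<subseteq> {1..n}"
        "matrix n (y_ext n m k :: 'r proj_alg_elt) K M \<noteq> 0" "matrix n (\<P> n ?t :: 'r proj_alg_elt) M L \<noteq> 0"
        unfolding R_def by (rule matrix_mult_nonzeroE[OF car P K])
      have "?t \<notin> M" using gap[OF k _ K] M(2) by (simp add: Y_def)
      moreover have "Suc ?t \<in> M \<longleftrightarrow> Suc ?t \<in> K" using lowD(1)[OF low K M(2)] by simp
      ultimately show ?thesis
        using M(3) matrix_proj_elt[OF t M(1), where 'a='r] by (auto split: if_splits)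
    qed
    show ?case
    proof (cases k)
      case 0
      then show ?thesis using K by (simp add: Y_def y_ext_def matrix_one del: One_nat_def)
    next
      case (Suc j)
      have F: "Y ?t k K L = Y m (Suc j) K L -
          (if ?t \<in> K then Y m (Suc j) K L
           else if Suc ?t \<in> K then Y m (Suc j) (insert ?t (K - {Suc ?t})) L else 0) + R j K L"
        unfolding Suc Y_def R_def y_ext_Suc[OF \<open>?t \<le> n\<close>] matrix_add matrix_diff
          matrix_proj_elt_mult[OF t car K] ..
      note PK = matrix_proj_elt[OF t K, where 'a='r]
      have goal: "(k \<le> c K ?t \<longrightarrow> Y ?t k K L = of_bool (L = K)) \<and>
        (c K (Suc ?t) < k \<longrightarrow> Y ?t k K L = 0) \<and>
        (k = Suc (c K ?t) \<longrightarrow> Suc ?t \<in> K \<longrightarrow> Y ?t k K L \<noteq> 0 \<longrightarrow> Suc ?t \<notin> L)"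
      proof (cases "?t \<in> K")
        case tK: True
        then have Y: "Y ?t k K L = R j K L" using F by simp
        show ?thesis
        proof (intro conjI impI)
          assume "k \<le> c K ?t"
          then have "j \<le> c K m" using tK Suc by (simp add: c_Suc)
          then show "Y ?t k K L = of_bool (L = K)" unfolding Y using R_one[OF _ K] PK tK by simp
        next
          assume less: "c K (Suc ?t) < k"
          show "Y ?t k K L = 0"
          proof (cases "c K ?t < j")
            case True
            then show ?thesis unfolding Y using K by (rule R_zero)
          next
            case False
            \<comment> \<open>This is the one row not covered by \<open>R_zero\<close>. The gap left
              at \<open>?t\<close> could be filled only by \<open>Suc ?t\<close>, which is missing
              from K.\<close>
            then have "j = Suc (c K m)" "Suc ?t \<notin> K" using less tK Suc by (auto simp: c_Suc split: if_splits)
            then show ?thesis unfolding Y using R_gap[OF _ tK _ K] by blast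
          qed
        next
          assume "k = Suc (c K ?t)" "Y ?t k K L \<noteq> 0"
          then show "Suc ?t \<notin> L" using R_gap[OF _ tK _ K, of j L] tK Suc unfolding Y by (simp add: c_Suc)
        qed
      next
        case tK: False
        then have ct: "c K ?t = c K m" by (simp add: c_Suc)
        show ?thesis
        proof (cases "Suc ?t \<in> K")
          case StK: True
          let ?K' = "insert ?t (K - {Suc ?t})"
          have K': "?K' \<subseteq> {1..n}" using K t by blast
          have cK': "c ?K' m = c K m"
            unfolding c_def by (rule arg_cong[where f = card]) auto
          then have cK't: "c ?K' ?t = Suc (c K m)" by (simp add: c_Suc)
          have cSt: "c K (Suc ?t) = Suc (c K m)" using StK ct by (simp add: c_Suc[of K ?t])
          have Y: "Y ?t k K L = Y m (Suc j) K L - Y m (Suc j) ?K' L + R j K L"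
            using F tK StK by simp
          show ?thesis
          proof (intro conjI impI)
            assume "k \<le> c K ?t"
            then have j: "Suc j \<le> c K m" "j \<le> c K m" "Suc j \<le> c ?K' m" using ct cK' Suc by auto
            \<comment> \<open>Multiplying by the generator from the left and from the right yields
              the same unit entry at \<open>?K'\<close> with opposite signs, so only the diagonal
              entry is left.\<close>
            show "Y ?t k K L = of_bool (L = K)"
              unfolding Y one[OF j(1) K] one[OF j(3) K'] R_one[OF j(2) K] using PK tK StK by simp
          next
            assume "c K (Suc ?t) < k"
            then have "c K ?t < Suc j" "c ?K' ?t < Suc j" "c K ?t < j" using ct cK't cSt Suc by auto
            then show "Y ?t k K L = 0" unfolding Y using zero K K' R_zero by simp
          next
            assume k: "k = Suc (c K ?t)" and nz: "Y ?t k K L \<noteq> 0"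
            have j: "j \<le> c K m" "c K ?t < Suc j" using k ct Suc by auto
            have "Y m (Suc j) ?K' L \<noteq> 0 \<or> R j K L \<noteq> 0" using nz unfolding Y zero[OF j(2) K] by auto
            then show "Suc ?t \<notin> L"
            proof
              assume "Y m (Suc j) ?K' L \<noteq> 0"
              then have "Suc ?t \<in> L \<longleftrightarrow> Suc ?t \<in> ?K'" unfolding Y_def using lowD(1)[OF low K'] by blast
              then show ?thesis by simp
            next
              assume "R j K L \<noteq> 0"
              then show ?thesis using R_one[OF j(1) K] PK tK StK by (auto split: if_splits)
            qed
          qed
        next
          case StK: False
          have Y: "Y ?t k K L = Y m (Suc j) K L + R j K L" using F tK StK by simp
          have cSt: "c K (Suc ?t) = c K m" using StK ct by (simp add: c_Suc[of K ?t])
          have R: "R j K L = 0"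
          proof (cases "j \<le> c K m")
            case True
            then show ?thesis using R_one[OF _ K] PK tK StK by simp
          next
            case False
            then show ?thesis using R_zero[OF _ K] ct by simp
          qed
          show ?thesis
            unfolding Y R using one[of "Suc j" K L] zero[of K "Suc j" L] K Suc ct cSt StK by simp
        qed
      qed
      then show ?thesis unfolding c_def .
    qed
  qed
  then show "k \<le> card (K \<inter> {1..m}) \<Longrightarrow> Y m k K L = of_bool (L = K)"
    and "card (K \<inter> {1..Suc m}) < k \<Longrightarrow> Y m k K L = 0"
    and "k = Suc (card (K \<inter> {1..m})) \<Longrightarrow> Suc m \<in> K \<Longrightarrow> Y m k K L \<noteq> 0 \<Longrightarrow> Suc m \<notin> L"
    by blast+
qed

lemma y_elt_closed:
  assumes "k \<noteq> 0" "m \<le> n"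
  shows "(y_elt n m k :: 'r::field proj_alg_elt) \<in> carrier (\<A> n)"
proof -
  have "(y_ext n m k :: 'r proj_alg_elt) \<in> carrier (\<A> n)"
    by (rule low_carrier[OF low_y_ext[OF assms(2)]])
  then show ?thesis using assms(1) by (simp add: y_ext_def)
qed

text \<open>At superscript n the undetermined rows are absent: \<open>Suc n\<close> is never in K,
  so the counts in {1..n} and {1..Suc n} both equal the size of K.\<close>

lemma matrix_y_elt:
  assumes "K \<subseteq> {1..n}" "k \<noteq> 0"
  shows "matrix n (y_elt n n k :: 'r::field proj_alg_elt) K L = of_bool (k \<le> card K \<and> L = K)"
proof -
  have eq: "(y_elt n n k :: 'r proj_alg_elt) = y_ext n n k" using assms(2) by (simp add: y_ext_def)
  have K: "K \<inter> {1..n} = K" "K \<inter> {1..Suc n} = K" using assms(1) by auto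
  note Y = matrix_y_ext(1,2)[OF order_refl assms(1), where 'r='r, unfolded K]
  show ?thesis
  proof (cases "k \<le> card K")
    case True
    from Y(1)[OF this] show ?thesis unfolding eq using True by simp
  next
    case False
    then have "card K < k" by simp
    from Y(2)[OF this] show ?thesis unfolding eq using False by simp
  qed
qed

lemma z_elt_eq:
  "(z_elt n k :: 'r::field proj_alg_elt) = (if k = 0 then \<one>\<^bsub>\<A> n\<^esub> - y_elt n n 1 else y_elt n n k - y_elt n n (Suc k))"
proof -
  have "x \<ominus>\<^bsub>\<A> n\<^esub> y_elt n n (Suc k) = x - y_elt n n (Suc k)"
    for x :: "'r proj_alg_elt" and k
    by (intro minus_proj_algebra y_elt_closed) simp_all
  then show ?thesis unfolding z_elt_def Suc_eq_plus1[symmetric] One_nat_def by simp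
qed

lemma z_elt_closed: "(z_elt n k :: 'r::field proj_alg_elt) \<in> carrier (\<A> n)"
proof -
  have "(y_elt n n (Suc k) :: 'r proj_alg_elt) \<in> carrier (\<A> n)" for k by (rule y_elt_closed) simp_all
  moreover from this[of "k - 1"] have "k \<noteq> 0 \<Longrightarrow> (y_elt n n k :: 'r proj_alg_elt) \<in> carrier (\<A> n)" by simp
  ultimately show ?thesis
    unfolding z_elt_eq One_nat_def by (simp add: proj_algebra_closed(3) one_proj_algebra_closed)
qed

lemma matrix_z_elt:
  assumes "K \<subseteq> {1..n}"
  shows "matrix n (z_elt n k :: 'r::field proj_alg_elt) K L = of_bool (card K = k \<and> L = K)"
proof (cases "k = 0")
  case True
  then have "matrix n (z_elt n k :: 'r proj_alg_elt) K L = of_bool (L = K) - of_bool (1 \<le> card K \<and> L = K)"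
    by (simp add: z_elt_eq matrix_diff matrix_one[OF assms] matrix_y_elt[OF assms])
  then show ?thesis using True by (cases "L = K") (simp_all add: of_bool_def)
next
  case False
  then have "matrix n (z_elt n k :: 'r proj_alg_elt) K L =
      of_bool (k \<le> card K \<and> L = K) - of_bool (Suc k \<le> card K \<and> L = K)"
    by (simp add: z_elt_eq matrix_diff matrix_y_elt[OF assms])
  then show ?thesis by (cases "L = K") (auto simp: of_bool_def)
qed

text \<open>As for \<open>y_ext\<close>, the value \<open>1\<close> at the empty set makes the recursion for \<open>g\<close> uniform.\<close>

definition g_ext :: "nat \<Rightarrow> nat \<Rightarrow> nat set \<Rightarrow> 'r::field proj_alg_elt" where
  "g_ext n m J = (if J = {} then \<one>\<^bsub>\<A> n\<^esub> else g_elt n m J)"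

lemma g_ext_Suc_aux:
  assumes "Suc m \<le> n" "J \<noteq> {}" "\<And>J. low n m (g_ext n m J :: 'r::field proj_alg_elt)"
  shows "(g_ext n (Suc m) J :: 'r proj_alg_elt) =
    (if Suc m \<in> J then g_ext n m (J - {Suc m}) \<otimes>\<^bsub>\<A> n\<^esub> \<P> n (Suc m)
     else g_ext n m J - \<P> n (Suc m) \<otimes>\<^bsub>\<A> n\<^esub> g_ext n m J)"
proof -
  have P: "(\<P> n (Suc m) :: 'r proj_alg_elt) \<in> carrier (\<A> n)"
    using assms(1) by (intro proj_elt_closed) simp
  show ?thesis
  proof (cases "Suc m \<in> J")
    case True
    then show ?thesis using one_mult_left[OF P] assms(2) by (auto simp: g_ext_def)
  next
    case False
    have "(g_elt n m J :: 'r proj_alg_elt) \<in> carrier (\<A> n)"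
      using low_carrier[OF assms(3)[of J]] assms(2) by (simp add: g_ext_def)
    then have "g_elt n m J \<ominus>\<^bsub>\<A> n\<^esub> \<P> n (Suc m) \<otimes>\<^bsub>\<A> n\<^esub> g_elt n m J =
      (g_elt n m J - \<P> n (Suc m) \<otimes>\<^bsub>\<A> n\<^esub> g_elt n m J :: 'r proj_alg_elt)"
      using P by (intro minus_proj_algebra proj_algebra_closed)
    then show ?thesis using False assms(2) by (simp add: g_ext_def)
  qed
qed

lemma low_g_ext: "m \<le> n \<Longrightarrow> low n m (g_ext n m J :: 'r::field proj_alg_elt)"
proof (induction m arbitrary: J)
  case 0
  show ?case by (simp add: g_ext_def low_one low_zero proj_algebra_simps(4))
next
  case (Suc m)
  have IH: "low n m (g_ext n m J :: 'r proj_alg_elt)" for J using Suc by simp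
  then have "low n (Suc m) (g_ext n m J :: 'r proj_alg_elt)" for J by (rule low_mono) simp
  moreover have "low n (Suc m) (\<P> n (Suc m))" using Suc.prems by (intro low_proj_elt) auto
  ultimately show ?case
  proof (cases "J = {}")
    case True
    then show ?thesis by (simp add: g_ext_def low_one)
  next
    case False
    have "low n (Suc m) (g_ext n m (J - {Suc m}) \<otimes>\<^bsub>\<A> n\<^esub> \<P> n (Suc m) :: 'r proj_alg_elt)"
      "low n (Suc m) (g_ext n m J - \<P> n (Suc m) \<otimes>\<^bsub>\<A> n\<^esub> g_ext n m J :: 'r proj_alg_elt)"
      by (intro low_diff low_mult; fact)+
    then show ?thesis
      unfolding g_ext_Suc_aux[OF Suc.prems False IH] by (cases "Suc m \<in> J") simp_all
  qed
qed

text \<open>Off these rows g need not be diagonal, but in the end the factor z discards the subsets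
  of the wrong size, so only rows with the size of J are computed. The condition on
  \<open>Suc m\<close> excludes the entries in which this element slides down; it is vacuous at m =
  n.\<close>

lemma matrix_g_ext:
  fixes n m :: nat and J K L :: "nat set"
  assumes "m \<le> n" "J \<subseteq> {1..m}" "K \<subseteq> {1..n}" "card (K \<inter> {1..m}) = card J"
    "Suc m \<in> K \<Longrightarrow> Suc m \<in> L"
  shows "matrix n (g_ext n m J :: 'r::field proj_alg_elt) K L = of_bool (K \<inter> {1..m} = J \<and> L = K)"
  using assms
proof (induction m arbitrary: J K L)
  case 0
  then show ?case by (simp add: g_ext_def matrix_one del: One_nat_def)
next
  case (Suc m)
  let ?t = "Suc m"
  have t: "?t \<in> {1..n}" and m: "m \<le> n" using Suc.prems by auto
  have K: "K \<subseteq> {1..n}" by fact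
  have low: "low n m (g_ext n m J :: 'r proj_alg_elt)" for J using m by (rule low_g_ext)
  have car: "(g_ext n m J :: 'r proj_alg_elt) \<in> carrier (\<A> n)" for J
    using low by (rule low_carrier)
  have P: "(\<P> n ?t :: 'r proj_alg_elt) \<in> carrier (\<A> n)" using t by (rule proj_elt_closed)
  have cK: "card (K \<inter> {1..m}) + of_bool (?t \<in> K) = card J"
    using Suc.prems(4) by (simp only: card_initial_Suc)
  show ?case
  proof (cases "J = {}")
    case True
    then have "K \<inter> {1..?t} = {}" using Suc.prems(4) by (simp del: One_nat_def)
    then show ?thesis using True K by (simp add: g_ext_def matrix_one del: One_nat_def)
  next
    case J: False
    note g_Suc = g_ext_Suc_aux[OF Suc.prems(1) J low]
    show ?thesis
    proof (cases "?t \<in> J")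
      case tJ: False
      then have Jm: "J \<subseteq> {1..m}" using Suc.prems(2) by (auto simp: le_Suc_eq)
      have F: "matrix n (g_ext n ?t J :: 'r proj_alg_elt) K L = matrix n (g_ext n m J) K L -
          (if ?t \<in> K then matrix n (g_ext n m J) K L
           else if Suc ?t \<in> K then matrix n (g_ext n m J) (insert ?t (K - {Suc ?t})) L else 0)"
        using g_Suc tJ matrix_proj_elt_mult[OF t car K] by (simp add: matrix_diff)
      show ?thesis
      proof (cases "?t \<in> K")
        case True
        then have "K \<inter> {1..?t} \<noteq> J" using tJ by auto
        then show ?thesis using F True by simp
      next
        case tK: False
        then have "matrix n (g_ext n m J :: 'r proj_alg_elt) K L = of_bool (K \<inter> {1..m} = J \<and> L = K)"
          using m Jm K cK by (intro Suc.IH) auto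
        moreover have "K \<inter> {1..?t} = K \<inter> {1..m}" using tK by (auto simp: le_Suc_eq)
        \<comment> \<open>The sliding has removed \<open>Suc ?t\<close>, and g with superscript m
          cannot restore it, whereas L must contain it.\<close>
        moreover have "matrix n (g_ext n m J :: 'r proj_alg_elt) (insert ?t (K - {Suc ?t})) L = 0"
          if "Suc ?t \<in> K"
        proof (rule ccontr)
          assume nz: "matrix n (g_ext n m J :: 'r proj_alg_elt) (insert ?t (K - {Suc ?t})) L \<noteq> 0"
          have "insert ?t (K - {Suc ?t}) \<subseteq> {1..n}" using K t by blast
          from lowD(1)[OF low this nz, of "Suc ?t"] show False using Suc.prems(5)[OF that] by simp
        qed
        ultimately show ?thesis using F tK by simp
      qed
    next
      case tJ: True
      let ?J' = "J - {?t}"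
      have J': "?J' \<subseteq> {1..m}" using Suc.prems(2) by (auto simp: le_Suc_eq)
      have "finite J" using Suc.prems(2) finite_subset by blast
      then have cJ: "card J = Suc (card ?J')" using tJ by (metis card_Suc_Diff1)
      \<comment> \<open>Only M = K contributes. If \<open>?t\<close> is in M, then it was in K and
        the induction hypothesis applies with M as the column. If it is not, the generator would
        have to slide \<open>Suc ?t\<close> down, which the condition on L forbids.\<close>
      have summand: "matrix n (g_ext n m ?J' :: 'r proj_alg_elt) K M * matrix n (\<P> n ?t) M L =
          (if M = K then of_bool (K \<inter> {1..?t} = J \<and> L = K) else 0)"
        if M: "M \<subseteq> {1..n}" for M
      proof (cases "matrix n (g_ext n m ?J' :: 'r proj_alg_elt) K M = 0")
        case nz: False
        note D = lowD[OF low K nz]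
        note PM = matrix_proj_elt[OF t M, where 'a='r]
        have Suc_t: "Suc ?t \<in> M \<longleftrightarrow> Suc ?t \<in> K" using D(1) by simp
        show ?thesis
        proof (cases "?t \<in> M")
          case True
          then have tK: "?t \<in> K" using D(2) by simp
          then have "matrix n (g_ext n m ?J' :: 'r proj_alg_elt) K M = of_bool (K \<inter> {1..m} = ?J' \<and> M = K)"
            using m J' K cK cJ True by (intro Suc.IH) auto
          moreover have "K \<inter> {1..?t} = insert ?t (K \<inter> {1..m})" using tK by (auto simp: le_Suc_eq)
          then have "K \<inter> {1..?t} = J \<longleftrightarrow> K \<inter> {1..m} = ?J'" using tJ by auto
          ultimately show ?thesis using PM True by auto
        next
          case tM: False
          have "matrix n (\<P> n ?t :: 'r proj_alg_elt) M L = 0"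
            using PM tM Suc_t Suc.prems(5) by auto
          moreover have "K \<inter> {1..?t} \<noteq> J" if "M = K" using tM tJ that by auto
          ultimately show ?thesis by auto
        qed
      next
        case z: True
        have "K \<inter> {1..?t} \<noteq> J \<or> L \<noteq> K" if "M = K"
        proof (rule ccontr)
          assume "\<not> ?thesis"
          then have eq: "K \<inter> {1..?t} = J" by simp
          then have "?t \<in> K" using tJ by auto
          have "K \<inter> {1..m} = ?J'" using eq by (auto simp: le_Suc_eq)
          moreover have "matrix n (g_ext n m ?J' :: 'r proj_alg_elt) K K = of_bool (K \<inter> {1..m} = ?J' \<and> K = K)"
            using m J' K cK cJ \<open>?t \<in> K\<close> by (intro Suc.IH) auto
          ultimately show False using z that by simp
        qed
        then show ?thesis using z by auto
      qed
      have "matrix n (g_ext n ?t J :: 'r proj_alg_elt) K L =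
          (\<Sum>M\<in>Pow {1..n}. matrix n (g_ext n m ?J' :: 'r proj_alg_elt) K M * matrix n (\<P> n ?t) M L)"
        using g_Suc tJ matrix_mult[OF car P K] by simp
      also have "\<dots> = (\<Sum>M\<in>Pow {1..n}. if M = K then of_bool (K \<inter> {1..?t} = J \<and> L = K) else 0)"
        by (intro sum.cong refl) (simp only: summand Pow_iff)
      also have "\<dots> = of_bool (K \<inter> {1..?t} = J \<and> L = K)"
        using K by (simp del: One_nat_def)
      finally show ?thesis .
    qed
  qed
qed

section \<open>The isomorphism\<close>

lemma g_elt_closed:
  assumes "J \<noteq> {}"
  shows "(g_elt n n J :: 'r::field proj_alg_elt) \<in> carrier (\<A> n)"
  using low_carrier[OF low_g_ext[OF order_refl, of n J, where 'r='r]] assms by (simp add: g_ext_def)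

lemma f_elt_closed: "(f_elt n J :: 'r::field proj_alg_elt) \<in> carrier (\<A> n)"
  by (simp add: f_elt_def z_elt_closed g_elt_closed proj_algebra_closed(1))

lemma matrix_g_elt:
  assumes "J \<noteq> {}" "J \<subseteq> {1..n}" "K \<subseteq> {1..n}" "card K = card J"
  shows "matrix n (g_elt n n J :: 'r::field proj_alg_elt) K L = of_bool (K = J \<and> L = K)"
proof -
  have K: "K \<inter> {1..n} = K" "Suc n \<notin> K" using assms(3) by auto
  have "matrix n (g_ext n n J :: 'r proj_alg_elt) K L = of_bool (K \<inter> {1..n} = J \<and> L = K)"
    using assms(2-4) K by (intro matrix_g_ext) simp_all
  then show ?thesis using assms(1) K(1) by (simp add: g_ext_def)
qed

text \<open>The factor z keeps only the columns of size \<open>card J\<close>. Since g preserves the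
  size of subsets, K has this size as well, and there the row of g is known.\<close>

lemma matrix_f_elt:
  assumes J: "J \<subseteq> {1..n}" and K: "K \<subseteq> {1..n}"
  shows "matrix n (f_elt n J :: 'r::field proj_alg_elt) K L = of_bool (K = J \<and> L = J)"
proof (cases "J = {}")
  case True
  have "finite K" using K finite_subset by blast
  then show ?thesis using True matrix_z_elt[OF K, of 0 L, where 'r='r] by (auto simp: f_elt_def)
next
  case False
  let ?g = "g_elt n n J :: 'r proj_alg_elt" and ?z = "z_elt n (card J) :: 'r proj_alg_elt"
  have g: "?g \<in> carrier (\<A> n)" using False by (rule g_elt_closed)
  have summand: "matrix n ?g K M * matrix n ?z M L =
      (if M = K then of_bool (K = J \<and> L = J) else 0)" if M: "M \<subseteq> {1..n}" for M
  proof (cases "matrix n ?g K M = 0 \<or> card M \<noteq> card J")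
    case True
    have "K \<noteq> J" if "M = K"
      using True that matrix_g_elt[OF False J K, of K, where 'r='r] by auto
    then have "(if M = K then of_bool (K = J \<and> L = J) else 0 :: 'r) = 0" by simp
    moreover have "matrix n ?g K M * matrix n ?z M L = 0"
      using True matrix_z_elt[OF M, of "card J" L, where 'r='r] by auto
    ultimately show ?thesis by (rule trans[OF _ sym, rotated])
  next
    case nz: False
    then have "card K = card J"
      using matrix_nonzero_poset_ge[OF _ g K, of M] by (auto simp: poset_ge_def)
    then show ?thesis
      using matrix_g_elt[OF False J K, of M, where 'r='r] matrix_z_elt[OF M, of "card J" L, where 'r='r] by auto
  qed
  have "matrix n (f_elt n J :: 'r proj_alg_elt) K L = (\<Sum>M\<in>Pow {1..n}. matrix n ?g K M * matrix n ?z M L)"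
    using False matrix_mult[OF g z_elt_closed K, of "card J" L] by (simp add: f_elt_def)
  also have "\<dots> = (\<Sum>M\<in>Pow {1..n}. if M = K then of_bool (K = J \<and> L = J) else 0)"
    by (intro sum.cong refl) (simp only: summand Pow_iff)
  also have "\<dots> = of_bool (K = J \<and> L = J)" using K by (simp del: One_nat_def)
  finally show ?thesis .
qed

lemma single_mult_single:
  assumes "set u \<subseteq> {1..n}" "set v \<subseteq> {1..n}"
  shows "Poly_Mapping.single (word_class n u) 1 \<otimes>\<^bsub>\<A> n\<^esub> Poly_Mapping.single (word_class n v) 1 =
    (Poly_Mapping.single (word_class n (u @ v)) 1 :: 'r::field proj_alg_elt)"
proof -
  have "scale 1 x = x" for x :: "'r proj_alg_elt" by (rule poly_mapping_eqI) simp
  then show ?thesis by (simp add: proj_algebra_simps(2) mult_proj_monoid[OF assms])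
qed

lemma word_elt_eq:
  "set w \<subseteq> {1..n} \<Longrightarrow> (word_elt n w :: 'r::field proj_alg_elt) = Poly_Mapping.single (word_class n w) 1"
proof (induction w)
  case Nil
  show ?case by (simp add: word_elt_def proj_algebra_simps(3) one_proj_monoid)
next
  case (Cons t w)
  have "(word_elt n (t # w) :: 'r proj_alg_elt) = \<P> n t \<otimes>\<^bsub>\<A> n\<^esub> word_elt n w" by (simp add: word_elt_def)
  also have "(word_elt n w :: 'r proj_alg_elt) = Poly_Mapping.single (word_class n w) 1" using Cons by simp
  also have "(\<P> n t :: 'r proj_alg_elt) \<otimes>\<^bsub>\<A> n\<^esub> \<dots> = Poly_Mapping.single (word_class n ([t] @ w)) 1"
    unfolding proj_elt_eq using Cons.prems by (intro single_mult_single) simp_all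
  finally show ?case by simp
qed

lemma pair_elt_eq:
  assumes "set (pair_word K J) \<subseteq> {1..n}"
  shows "pair_elt n K J = Poly_Mapping.single (word_class n (pair_word K J)) 1"
proof -
  have "foldr (\<lambda>(k, j) x. word_elt n (down_word k j) \<otimes>\<^bsub>\<A> n\<^esub> x) ps \<one>\<^bsub>\<A> n\<^esub> =
      Poly_Mapping.single (word_class n (concat (map (\<lambda>(k, j). down_word k j) ps))) 1"
    if "set (concat (map (\<lambda>(k, j). down_word k j) ps)) \<subseteq> {1..n}" for ps
    using that
  proof (induction ps)
    case Nil
    show ?case by (simp add: proj_algebra_simps(3) one_proj_monoid)
  next
    case (Cons p ps)
    obtain k j where p: "p = (k, j)" by force
    let ?w = "down_word k j" and ?v = "concat (map (\<lambda>(k, j). down_word k j) ps)"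
    have wv: "set ?w \<subseteq> {1..n}" "set ?v \<subseteq> {1..n}" using Cons.prems by (simp_all add: p)
    from Cons.IH[OF wv(2)] show ?case
      by (simp add: p word_elt_eq[OF wv(1)] single_mult_single[OF wv])
  qed
  with assms show ?thesis unfolding pair_elt_def pair_word_def by blast
qed

definition inc_image :: "nat \<Rightarrow> nat set \<times> nat set \<Rightarrow> 'r::field proj_alg_elt" where
  "inc_image n = (\<lambda>(K, J). f_elt n K \<otimes>\<^bsub>\<A> n\<^esub> pair_elt n K J \<otimes>\<^bsub>\<A> n\<^esub> f_elt n J)"

lemma pair_elt_closed:
  assumes "poset_ge n K J"
  shows "pair_elt n K J \<in> carrier (\<A> n)"
  unfolding pair_elt_eq[OF transport_pair_word(2)[OF assms]]
  using transport_pair_word(2)[OF assms] by (rule proj_algebra_closed(6))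

lemma inc_image_closed:
  "poset_ge n K J \<Longrightarrow> (inc_image n (K, J) :: 'r::field proj_alg_elt) \<in> carrier (\<A> n)"
  by (simp add: inc_image_def proj_algebra_closed(1) f_elt_closed pair_elt_closed)

text \<open>The left factor removes every row except K, so the pair word is evaluated at K alone,
  where it gives J. Its effect on other subsets never enters.\<close>

lemma matrix_inc_image:
  assumes KJ: "poset_ge n K J" and M: "M \<subseteq> {1..n}"
  shows "matrix n (inc_image n (K, J) :: 'r::field proj_alg_elt) M L = of_bool (M = K \<and> L = J)"
proof -
  let ?f = "\<lambda>J. f_elt n J :: 'r proj_alg_elt" and ?p = "pair_elt n K J :: 'r proj_alg_elt"
  have K: "K \<subseteq> {1..n}" and J: "J \<subseteq> {1..n}" using KJ by (simp_all add: poset_ge_def)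
  have p: "?p \<in> carrier (\<A> n)" using KJ by (rule pair_elt_closed)
  have fp: "?f K \<otimes>\<^bsub>\<A> n\<^esub> ?p \<in> carrier (\<A> n)" using f_elt_closed p by (rule proj_algebra_closed)
  have pK: "matrix n ?p K N = of_bool (N = J)" for N
    unfolding pair_elt_eq[OF transport_pair_word(2)[OF KJ]]
      matrix_word_class[OF transport_pair_word(2)[OF KJ]] transport_pair_word(1)[OF KJ] by auto
  have fM: "matrix n (?f I) N L = of_bool (N = I \<and> L = I)"
    if "I \<subseteq> {1..n}" "N \<subseteq> {1..n}" for I N L
    using that by (rule matrix_f_elt)
  show ?thesis
  proof (cases "M = K")
    case True
    have 1: "matrix n (?f K) K N = of_bool (N = K)" for N using fM[OF K K] by simp
    have 2: "matrix n (?f K \<otimes>\<^bsub>\<A> n\<^esub> ?p) K N = of_bool (N = J)" for N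
      using matrix_mult_row[OF f_elt_closed p K K 1, of N] pK by simp
    have "matrix n (?f K \<otimes>\<^bsub>\<A> n\<^esub> ?p \<otimes>\<^bsub>\<A> n\<^esub> ?f J) K L = matrix n (?f J) J L"
      by (rule matrix_mult_row[OF fp f_elt_closed K J 2])
    then show ?thesis using True fM[OF J J] by (simp add: inc_image_def)
  next
    case False
    have 1: "matrix n (?f K) M N = 0" for N using fM[OF K M] False by simp
    have 2: "matrix n (?f K \<otimes>\<^bsub>\<A> n\<^esub> ?p) M N = 0" for N
      by (rule matrix_mult_zero_row[OF f_elt_closed p M 1])
    have "matrix n (?f K \<otimes>\<^bsub>\<A> n\<^esub> ?p \<otimes>\<^bsub>\<A> n\<^esub> ?f J) M L = 0"
      by (rule matrix_mult_zero_row[OF fp f_elt_closed M 2])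
    then show ?thesis using False by (simp add: inc_image_def)
  qed
qed

section \<open>The incidence algebra and the map \<open>Phi\<close>\<close>

lemma inc_algebra_simps:
  "carrier (inc_algebra n) = {x. Poly_Mapping.keys x \<subseteq> {(K, J). poset_ge n K J}}"
  "x \<otimes>\<^bsub>inc_algebra n\<^esub> y = (\<Sum>a\<in>Poly_Mapping.keys x. \<Sum>b\<in>Poly_Mapping.keys y.
     scale (Poly_Mapping.lookup x a * Poly_Mapping.lookup y b)
       ((\<lambda>(L, K) (K', J). if K = K' then inc_gen L J else 0) a b))"
  "\<one>\<^bsub>inc_algebra n\<^esub> = (\<Sum>K\<in>Pow {1..n}. inc_gen K K)"
  "x \<oplus>\<^bsub>inc_algebra n\<^esub> y = x + y"
  "c \<odot>\<^bsub>inc_algebra n\<^esub> x = scale c x"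
  by (simp_all add: inc_algebra_def free_algebra_on_def)

lemma inc_algebra_closed:
  shows "x \<in> carrier (inc_algebra n) \<Longrightarrow> y \<in> carrier (inc_algebra n) \<Longrightarrow>
      x \<otimes>\<^bsub>inc_algebra n\<^esub> y \<in> carrier (inc_algebra n)"
    and "x \<in> carrier (inc_algebra n) \<Longrightarrow> y \<in> carrier (inc_algebra n) \<Longrightarrow>
      x + y \<in> carrier (inc_algebra n)"
    and "x \<in> carrier (inc_algebra n) \<Longrightarrow> scale c x \<in> carrier (inc_algebra n)"
    and "\<one>\<^bsub>inc_algebra n\<^esub> \<in> carrier (inc_algebra n)"
proof -
  show "x \<otimes>\<^bsub>inc_algebra n\<^esub> y \<in> carrier (inc_algebra n)"
    if "x \<in> carrier (inc_algebra n)" "y \<in> carrier (inc_algebra n)"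
    using that unfolding inc_algebra_simps mem_Collect_eq
  proof (rule keys_free_product[rotated])
    fix a b assume "a \<in> {(K, J). poset_ge n K J}" "b \<in> {(K, J). poset_ge n K J}"
    then show "Poly_Mapping.keys ((\<lambda>(L, K) (K', J). if K = K' then inc_gen L J else 0) a b)
        \<subseteq> {(K, J). poset_ge n K J}"
      by (auto simp: inc_gen_def split: if_splits intro: poset_ge_trans)
  qed
  show "x + y \<in> carrier (inc_algebra n)"
    if "x \<in> carrier (inc_algebra n)" "y \<in> carrier (inc_algebra n)"
    using that Poly_Mapping.keys_add[of x y] unfolding inc_algebra_simps mem_Collect_eq by blast
  show "scale c x \<in> carrier (inc_algebra n)" if "x \<in> carrier (inc_algebra n)"
    using that keys_scale[of c x] unfolding inc_algebra_simps mem_Collect_eq by blast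
  show "\<one>\<^bsub>inc_algebra n\<^esub> \<in> carrier (inc_algebra n)"
    unfolding inc_algebra_simps mem_Collect_eq
    by (rule keys_sum_subset) (simp add: inc_gen_def poset_ge_refl del: One_nat_def)
qed

text \<open>Coefficients of the incidence algebra multiply as matrices over all subsets, with zeros
  outside the order, which matches the rule for \<open>matrix\<close>.\<close>

lemma lookup_inc_mult:
  fixes x y :: "'r::field inc_elt"
  assumes y: "y \<in> carrier (inc_algebra n)"
  shows "Poly_Mapping.lookup (x \<otimes>\<^bsub>inc_algebra n\<^esub> y) (K, L) =
    (\<Sum>M\<in>Pow {1..n}. Poly_Mapping.lookup x (K, M) * Poly_Mapping.lookup y (M, L))"
proof -
  define c where "c a b = (of_bool (fst a = K \<and> snd a = fst b \<and> snd b = L) :: 'r)"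
    for a b :: "nat set \<times> nat set"
  have c: "c a b = (\<Sum>M\<in>Pow {1..n}. of_bool (a = (K, M)) * of_bool (b = (M, L)))"
    if "b \<in> Poly_Mapping.keys y" for a b
  proof -
    have "b \<in> {(K, J). poset_ge n K J}" using that y unfolding inc_algebra_simps(1) by blast
    \<comment> \<open>The only possible intermediate subset is the first component of b, and it lies
      in {1..n} because y is in the carrier.\<close>
    then have "fst b \<in> Pow {1..n}" by (simp add: case_prod_unfold poset_ge_def)
    then have "c a b = (\<Sum>M\<in>Pow {1..n}. if M = fst b then c a b else 0)" by (simp del: Pow_iff)
    also have "\<dots> = (\<Sum>M\<in>Pow {1..n}. of_bool (a = (K, M)) * of_bool (b = (M, L)))"
      by (intro sum.cong refl) (auto simp: c_def prod_eq_iff)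
    finally show ?thesis .
  qed
  have expand: "Poly_Mapping.lookup z i = (\<Sum>a\<in>Poly_Mapping.keys z. Poly_Mapping.lookup z a * of_bool (a = i))"
    for z :: "'r inc_elt" and i
    by (simp add: of_bool_def if_distrib in_keys_iff cong: if_cong)
  have "Poly_Mapping.lookup (x \<otimes>\<^bsub>inc_algebra n\<^esub> y) (K, L) =
      (\<Sum>a\<in>Poly_Mapping.keys x. \<Sum>b\<in>Poly_Mapping.keys y.
        Poly_Mapping.lookup x a * Poly_Mapping.lookup y b * c a b)"
    unfolding inc_algebra_simps(2) lookup_sum
    by (intro sum.cong refl) (auto simp: c_def inc_gen_def lookup_single when_def split: prod.splits)
  also have "\<dots> = (\<Sum>a\<in>Poly_Mapping.keys x. \<Sum>b\<in>Poly_Mapping.keys y. \<Sum>M\<in>Pow {1..n}.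
      (Poly_Mapping.lookup x a * of_bool (a = (K, M))) * (Poly_Mapping.lookup y b * of_bool (b = (M, L))))"
    by (intro sum.cong refl) (simp only: c sum_distrib_left mult_ac)
  also have "\<dots> = (\<Sum>M\<in>Pow {1..n}. \<Sum>a\<in>Poly_Mapping.keys x. \<Sum>b\<in>Poly_Mapping.keys y.
      (Poly_Mapping.lookup x a * of_bool (a = (K, M))) * (Poly_Mapping.lookup y b * of_bool (b = (M, L))))"
    by (subst sum.swap[of _ "Pow {1..n}"], subst sum.swap[of _ "Pow {1..n}"]) simp
  also have "\<dots> = (\<Sum>M\<in>Pow {1..n}. Poly_Mapping.lookup x (K, M) * Poly_Mapping.lookup y (M, L))"
  proof (intro sum.cong refl)
    fix M
    show "(\<Sum>a\<in>Poly_Mapping.keys x. \<Sum>b\<in>Poly_Mapping.keys y.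
        (Poly_Mapping.lookup x a * of_bool (a = (K, M))) * (Poly_Mapping.lookup y b * of_bool (b = (M, L)))) =
      Poly_Mapping.lookup x (K, M) * Poly_Mapping.lookup y (M, L)"
      unfolding expand[of x "(K, M)"] expand[of y "(M, L)"] sum_product ..
  qed
  finally show ?thesis .
qed

lemma Phi_eq_sum:
  assumes "x \<in> carrier (inc_algebra n)"
  shows "Phi n x = (\<Sum>p\<in>Poly_Mapping.keys x. scale (Poly_Mapping.lookup x p) (inc_image n p))"
proof -
  have "scale (Poly_Mapping.lookup x p) (inc_image n p) \<in> carrier (\<A> n)"
    if "p \<in> Poly_Mapping.keys x" for p
    using that assms by (auto simp: inc_algebra_simps(1) intro!: proj_algebra_closed(4) inc_image_closed)
  then have "finsum (\<A> n) (\<lambda>p. scale (Poly_Mapping.lookup x p) (inc_image n p)) (Poly_Mapping.keys x) =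
      (\<Sum>p\<in>Poly_Mapping.keys x. scale (Poly_Mapping.lookup x p) (inc_image n p))"
    by (intro finsum_proj_algebra) simp_all
  then show ?thesis
    by (simp add: Phi_def proj_algebra_simps(6) inc_image_def case_prod_unfold)
qed

lemma Phi_closed:
  fixes x :: "'r::field inc_elt"
  assumes "x \<in> carrier (inc_algebra n)"
  shows "Phi n x \<in> carrier (\<A> n)"
proof -
  have "Poly_Mapping.keys (scale (Poly_Mapping.lookup x p) (inc_image n p :: 'r proj_alg_elt)) \<subseteq> carrier (proj_monoid n)"
    if "p \<in> Poly_Mapping.keys x" for p
  proof -
    obtain K J where p: "p = (K, J)" by force
    have "poset_ge n K J" using that assms p by (auto simp: inc_algebra_simps(1))
    then have "scale (Poly_Mapping.lookup x p) (inc_image n p :: 'r proj_alg_elt) \<in> carrier (\<A> n)"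
      unfolding p by (intro proj_algebra_closed(4) inc_image_closed)
    then show ?thesis by (simp add: proj_algebra_simps(1))
  qed
  then show ?thesis
    unfolding Phi_eq_sum[OF assms] proj_algebra_simps(1) mem_Collect_eq by (rule keys_sum_subset)
qed

lemma matrix_Phi:
  fixes x :: "'r::field inc_elt"
  assumes x: "x \<in> carrier (inc_algebra n)" and K: "K \<subseteq> {1..n}"
  shows "matrix n (Phi n x) K L = Poly_Mapping.lookup x (K, L)"
proof -
  have "matrix n (Phi n x) K L =
      (\<Sum>p\<in>Poly_Mapping.keys x. Poly_Mapping.lookup x p * matrix n (inc_image n p) K L)"
    by (simp add: Phi_eq_sum[OF x] matrix_sum matrix_scale)
  also have "\<dots> = (\<Sum>p\<in>Poly_Mapping.keys x. if p = (K, L) then Poly_Mapping.lookup x (K, L) else 0)"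
  proof (intro sum.cong refl)
    fix p assume p: "p \<in> Poly_Mapping.keys x"
    obtain M J where MJ: "p = (M, J)" by force
    have "poset_ge n M J" using p x MJ by (auto simp: inc_algebra_simps(1))
    from matrix_inc_image[OF this K, of L]
    show "Poly_Mapping.lookup x p * matrix n (inc_image n p) K L =
        (if p = (K, L) then Poly_Mapping.lookup x (K, L) else 0)"
      unfolding MJ by auto
  qed
  also have "\<dots> = Poly_Mapping.lookup x (K, L)" by (simp add: in_keys_iff)
  finally show ?thesis .
qed

text \<open>As the matrix of \<open>Phi n x\<close> consists of the coefficients of x, faithfulness
  reduces each algebra law for \<open>Phi\<close> to a comparison of entries.\<close>

lemma Phi_eqI:
  fixes x :: "'r::field inc_elt"
  assumes x: "x \<in> carrier (inc_algebra n)" and a: "a \<in> carrier (\<A> n)"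
    and eq: "\<And>K L. K \<subseteq> {1..n} \<Longrightarrow> L \<subseteq> {1..n} \<Longrightarrow> Poly_Mapping.lookup x (K, L) = matrix n a K L"
  shows "Phi n x = a"
  using Phi_closed[OF x] a
proof (rule matrix_inject)
  fix K L assume "K \<subseteq> {1..n}" "L \<subseteq> {1..n}"
  then show "matrix n (Phi n x) K L = matrix n a K L" using matrix_Phi[OF x] eq by simp
qed

lemma Phi_add:
  fixes x y :: "'r::field inc_elt"
  assumes x: "x \<in> carrier (inc_algebra n)" and y: "y \<in> carrier (inc_algebra n)"
  shows "Phi n (x + y) = Phi n x + Phi n y"
proof (rule Phi_eqI)
  show "x + y \<in> carrier (inc_algebra n)" using x y by (rule inc_algebra_closed)
  show "Phi n x + Phi n y \<in> carrier (\<A> n)" using x y by (intro proj_algebra_closed Phi_closed)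
  fix K L assume K: "K \<subseteq> {1..n}"
  show "Poly_Mapping.lookup (x + y) (K, L) = matrix n (Phi n x + Phi n y) K L"
    by (simp add: lookup_add matrix_add matrix_Phi[OF x K] matrix_Phi[OF y K])
qed

lemma Phi_scale:
  fixes x :: "'r::field inc_elt"
  assumes x: "x \<in> carrier (inc_algebra n)"
  shows "Phi n (scale c x) = scale c (Phi n x)"
proof (rule Phi_eqI)
  show "scale c x \<in> carrier (inc_algebra n)" using x by (rule inc_algebra_closed)
  show "scale c (Phi n x) \<in> carrier (\<A> n)" using x by (intro proj_algebra_closed Phi_closed)
  fix K L assume K: "K \<subseteq> {1..n}"
  show "Poly_Mapping.lookup (scale c x) (K, L) = matrix n (scale c (Phi n x)) K L"
    by (simp add: matrix_scale matrix_Phi[OF x K])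
qed

lemma Phi_mult:
  fixes x y :: "'r::field inc_elt"
  assumes x: "x \<in> carrier (inc_algebra n)" and y: "y \<in> carrier (inc_algebra n)"
  shows "Phi n (x \<otimes>\<^bsub>inc_algebra n\<^esub> y) = Phi n x \<otimes>\<^bsub>\<A> n\<^esub> Phi n y"
proof (rule Phi_eqI)
  show "x \<otimes>\<^bsub>inc_algebra n\<^esub> y \<in> carrier (inc_algebra n)" using x y by (rule inc_algebra_closed)
  show "Phi n x \<otimes>\<^bsub>\<A> n\<^esub> Phi n y \<in> carrier (\<A> n)" using x y by (intro proj_algebra_closed Phi_closed)
  fix K L assume K: "K \<subseteq> {1..n}"
  show "Poly_Mapping.lookup (x \<otimes>\<^bsub>inc_algebra n\<^esub> y) (K, L) = matrix n (Phi n x \<otimes>\<^bsub>\<A> n\<^esub> Phi n y) K L"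
    unfolding matrix_mult[OF Phi_closed[OF x] Phi_closed[OF y] K] lookup_inc_mult[OF y]
    by (intro sum.cong refl) (simp add: matrix_Phi[OF x K] matrix_Phi[OF y] del: One_nat_def)
qed

lemma Phi_one: "Phi n \<one>\<^bsub>inc_algebra n\<^esub> = (\<one>\<^bsub>\<A> n\<^esub> :: 'r::field proj_alg_elt)"
proof (rule Phi_eqI)
  show "\<one>\<^bsub>inc_algebra n\<^esub> \<in> carrier (inc_algebra n)" by (rule inc_algebra_closed)
  show "\<one>\<^bsub>\<A> n\<^esub> \<in> carrier (\<A> n)" by (rule one_proj_algebra_closed)
  fix K L assume K: "K \<subseteq> {1..n}"
  have "Poly_Mapping.lookup (\<one>\<^bsub>inc_algebra n\<^esub> :: 'r inc_elt) (K, L) =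
      (\<Sum>M\<in>Pow {1..n}. if M = K then of_bool (L = K) else 0)"
    unfolding inc_algebra_simps(3) lookup_sum
    by (intro sum.cong refl) (auto simp: inc_gen_def lookup_single when_def)
  also have "\<dots> = of_bool (L = K)" using K by (simp del: One_nat_def)
  also have "\<dots> = matrix n \<one>\<^bsub>\<A> n\<^esub> K L" by (rule matrix_one[OF K, symmetric])
  finally show "Poly_Mapping.lookup (\<one>\<^bsub>inc_algebra n\<^esub> :: 'r inc_elt) (K, L) = matrix n \<one>\<^bsub>\<A> n\<^esub> K L" .
qed

lemma Phi_inj: "inj_on (Phi n :: 'r::field inc_elt \<Rightarrow> 'r proj_alg_elt) (carrier (inc_algebra n))"
proof (rule inj_onI)
  fix x y :: "'r inc_elt"
  assume x: "x \<in> carrier (inc_algebra n)" and y: "y \<in> carrier (inc_algebra n)" and eq: "Phi n x = Phi n y"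
  show "x = y"
  proof (rule poly_mapping_eqI)
    fix p :: "nat set \<times> nat set"
    obtain K L where p: "p = (K, L)" by force
    show "Poly_Mapping.lookup x p = Poly_Mapping.lookup y p"
    proof (cases "K \<subseteq> {1..n}")
      case True
      then show ?thesis unfolding p using matrix_Phi[OF x True, of L] matrix_Phi[OF y True, of L] eq by simp
    next
      case False
      then have "p \<notin> Poly_Mapping.keys x" "p \<notin> Poly_Mapping.keys y"
        using x y by (auto simp: inc_algebra_simps(1) poset_ge_def p simp del: One_nat_def)
      then show ?thesis by (simp add: in_keys_iff)
    qed
  qed
qed

text \<open>The preimage is the matrix of a, read as a family of coefficients. Its nonzero entries
  sit at pairs of the order, so it belongs to the incidence algebra.\<close>

lemma Phi_surj:
  fixes a :: "'r::field proj_alg_elt"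
  assumes a: "a \<in> carrier (\<A> n)"
  shows "\<exists>x\<in>carrier (inc_algebra n). Phi n x = a"
proof -
  let ?B = "Pow {1..n} \<times> Pow {1..n} :: (nat set \<times> nat set) set"
  define x where "x = (\<Sum>p\<in>?B. Poly_Mapping.single p (matrix n a (fst p) (snd p)))"
  have x: "x \<in> carrier (inc_algebra n)"
    unfolding x_def inc_algebra_simps mem_Collect_eq
  proof (rule keys_sum_subset)
    fix p assume p: "p \<in> ?B"
    show "Poly_Mapping.keys (Poly_Mapping.single p (matrix n a (fst p) (snd p))) \<subseteq> {(K, J). poset_ge n K J}"
      using matrix_nonzero_poset_ge[OF _ a, of "fst p" "snd p"] p by (auto simp: case_prod_unfold)
  qed
  have "Phi n x = a"
  proof (rule Phi_eqI[OF x a])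
    fix K L assume "K \<subseteq> {1..n}" "L \<subseteq> {1..n}"
    then have KL: "(K, L) \<in> ?B" by simp
    have "Poly_Mapping.lookup x (K, L) = (\<Sum>p\<in>?B. if p = (K, L) then matrix n a K L else 0)"
      unfolding x_def lookup_sum by (intro sum.cong refl) (auto simp: lookup_single when_def)
    also have "\<dots> = matrix n a K L" using KL by (simp del: mem_Sigma_iff Pow_iff)
    finally show "Poly_Mapping.lookup x (K, L) = matrix n a K L" .
  qed
  with x show ?thesis by blast
qed

lemma Phi_inc_gen:
  assumes "poset_ge n K J"
  shows "Phi n (inc_gen K J) = inc_image n (K, J)"
proof -
  have x: "inc_gen K J \<in> carrier (inc_algebra n)"
    using assms by (simp add: inc_algebra_simps(1) inc_gen_def)
  have "scale 1 y = y" for y :: "'a proj_alg_elt" by (rule poly_mapping_eqI) simp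
  then show ?thesis unfolding Phi_eq_sum[OF x] by (simp add: inc_gen_def)
qed

theorem theorem5p3:
  fixes n :: nat
  assumes "n \<ge> 1"
  shows "(Phi n :: 'r::field inc_elt \<Rightarrow> 'r proj_alg_elt) \<in>
           LinearCombinations.module_hom class_ring (inc_algebra n) (\<A> n) \<inter>
           ring_iso (inc_algebra n) (\<A> n) \<and>
         (\<forall>K J. poset_ge n K J \<longrightarrow>
           (Phi n (inc_gen K J) :: 'r proj_alg_elt) =
             f_elt n K \<otimes>\<^bsub>\<A> n\<^esub> pair_elt n K J \<otimes>\<^bsub>\<A> n\<^esub> f_elt n J)"
proof (intro conjI IntI allI impI)
  show "(Phi n :: 'r inc_elt \<Rightarrow> _) \<in> LinearCombinations.module_hom class_ring (inc_algebra n) (\<A> n)"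
    by (rule lin_homI)
      (simp_all add: Phi_closed Phi_add Phi_scale inc_algebra_simps(4,5) proj_algebra_simps(5,6))
  show "(Phi n :: 'r inc_elt \<Rightarrow> _) \<in> ring_iso (inc_algebra n) (\<A> n)"
    unfolding ring_iso_def
  proof (intro CollectI conjI)
    show "(Phi n :: 'r inc_elt \<Rightarrow> _) \<in> Ring.ring_hom (inc_algebra n) (\<A> n)"
      by (rule Ring.ring_hom_memI)
        (simp_all add: Phi_closed Phi_mult Phi_add Phi_one inc_algebra_simps(4) proj_algebra_simps(5))
    show "bij_betw (Phi n :: 'r inc_elt \<Rightarrow> _) (carrier (inc_algebra n)) (carrier (\<A> n))"
      using Phi_inj Phi_closed Phi_surj by (intro bij_betw_imageI) blast+
  qed
  fix K J assume "poset_ge n K J"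
  then show "(Phi n (inc_gen K J) :: 'r proj_alg_elt) =
      f_elt n K \<otimes>\<^bsub>\<A> n\<^esub> pair_elt n K J \<otimes>\<^bsub>\<A> n\<^esub> f_elt n J"
    by (simp add: Phi_inc_gen inc_image_def)
qed

end
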